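(* Let $\Sigma$ be a Polish space. Let $m(n)$ be positive integers with $\lim_{n\to\infty}m(n)/n=\lambda>0$ and let $((W_i^n)_{1\le i\le n})_{n\ge1}$ be random variables such that, for every $n\ge1$, $$\frac{m(n)}{n}(W_1^n,\dots,W_n^n)\sim\mathrm{Mult}_n\big(m(n),(1/n,\dots,1/n)\big).$$ Let $((X_i^n)_{1\le i\le n})_{n\ge1}$ be a triangular array of $\Sigma$-valued random variables on the same probability space such that $\left(\frac1n\sum_{i=1}^n\delta_{X_i^n}\right)_{n\ge1}$ satisfies an LDP on $M_1(\Sigma)$ endowed with the weak convergence topology with good rate function $I^X$ and, for every $n$, the vectors $(X_1^n,\dots,X_n^n)$ and $(W_1^n,\dots,W_n^n)$ are independent. Let $\mathcal{Z}=\{\eta\in M_1(\Sigma): I^X(\eta)=0\}$. Then the sequence $L^n=\frac1n\sum_{i=1}^nW_i^n\delta_{X_i^n}$, $n\ge1$, satisfies an LDP on $M_1(\Sigma)$ endowed with the weak convergence topology with good rate function $K$ such that, for every $\nu\in M_1(\Sigma)$, $$K(\nu)=\inf_{\zeta\in M_1(\Sigma)}\{\lambda H(\nu|\zeta)+I^X(\zeta)\}\le\lambda\inf_{\eta\in\mathcal{Z}}H(\nu|\eta).$$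
   Context: $M_1(\Sigma)$ is the set of Borel probability measures on $\Sigma$. $\mathrm{Mult}_n(m,(1/n,\dots,1/n))$ is the law of the occupation numbers of $n$ urns when $m$ balls are thrown independently and uniformly into the urns. LDP: a sequence of Borel probability measures $(P^n)$ on a topological space satisfies an LDP with rate function $I$ if $I$ is nonnegative, lower semicontinuous and, for every measurable $A$, $-\inf_{A^o}I\le\liminf_n\frac1n\log P^n(A)\le\limsup_n\frac1n\log P^n(A)\le-\inf_{\bar A}I$; $I$ is good if its level sets $\{I\le\alpha\}$, $\alpha<\infty$, are compact. A sequence of random variables satisfies an LDP if their laws do. $H(\nu|\rho)=\int\log\frac{d\nu}{d\rho}d\nu$ if $\nu\ll\rho$, $+\infty$ otherwise. *)

theory Defs
  imports "HOL-Probability.Probability"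
begin

section \<open>Large deviation principles on a topological space\<close>

definition borel_of :: "'b topology \<Rightarrow> 'b measure" where
  "borel_of T = sigma (topspace T) {U. openin T U}"

definition lsc_on :: "'b topology \<Rightarrow> ('b \<Rightarrow> ereal) \<Rightarrow> bool" where
  "lsc_on T I \<longleftrightarrow> (\<forall>a. openin T {x \<in> topspace T. a < I x})"

text \<open>Extended logarithm on $[0,1]$; the value at 0 is $-\infty$, unlike that of \<^const>\<open>ln\<close>.\<close>

definition log_prob :: "real \<Rightarrow> ereal" where
  "log_prob p = (if p = 0 then -\<infinity> else ereal (ln p))"

text \<open>Sequences are indexed by $n \ge 1$; nothing is asked of the entry at index 0.
  Only the values of \<open>I\<close> on \<open>topspace T\<close> matter. The infimum over the empty set is $\infty$.\<close>

definition LDP :: "'b topology \<Rightarrow> (nat \<Rightarrow> 'b measure) \<Rightarrow> ('b \<Rightarrow> ereal) \<Rightarrow> bool" where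
  "LDP T P I \<longleftrightarrow>
     (\<forall>n\<ge>1. prob_space (P n) \<and> sets (P n) = sets (borel_of T)) \<and>
     (\<forall>x\<in>topspace T. 0 \<le> I x) \<and>
     lsc_on T I \<and>
     (\<forall>A\<in>sets (borel_of T).
        - (INF x\<in>T interior_of A. I x)
          \<le> liminf (\<lambda>n. ereal (1 / real n) * log_prob (measure (P n) A)) \<and>
        limsup (\<lambda>n. ereal (1 / real n) * log_prob (measure (P n) A))
          \<le> - (INF x\<in>T closure_of A. I x))"

definition good_rate :: "'b topology \<Rightarrow> ('b \<Rightarrow> ereal) \<Rightarrow> bool" where
  "good_rate T I \<longleftrightarrow> (\<forall>\<alpha>::real. compactin T {x \<in> topspace T. I x \<le> ereal \<alpha>})"


section \<open>Probability measures with the weak topology, relative entropy\<close>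

definition M1 :: "'a::topological_space measure set" where
  "M1 = {\<mu>. prob_space \<mu> \<and> sets \<mu> = sets borel}"

text \<open>The coarsest topology on \<open>M1\<close> making $\mu \mapsto \int f\,d\mu$ continuous for every bounded
  continuous real \<open>f\<close>.\<close>

definition weak_topology :: "'a::topological_space measure topology" where
  "weak_topology = topology_generated_by
     {{\<mu> \<in> M1. (\<integral>x. f x \<partial>\<mu>) \<in> U} | (f :: 'a \<Rightarrow> real) U.
        continuous_on UNIV f \<and> bounded (range f) \<and> open U}"

lemma topspace_weak_topology: "topspace weak_topology = M1"
proof -
  have "M1 = {\<mu> \<in> M1. (\<integral>x. (\<lambda>_::'a. 0::real) x \<partial>\<mu>) \<in> UNIV}" by simp
  then have "M1 \<in> {{\<mu> \<in> M1. (\<integral>x. f x \<partial>\<mu>) \<in> U} | (f :: 'a \<Rightarrow> real) U.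
        continuous_on UNIV f \<and> bounded (range f) \<and> open U}"
    by (intro CollectI exI[of _ "\<lambda>_. 0"] exI[of _ UNIV]) auto
  then show ?thesis
    unfolding weak_topology_def topology_generated_by_topspace by auto
qed

text \<open>$H(\nu|\rho)$. The integral of \<^term>\<open>entropy_density (exp 1) \<rho> \<nu>\<close>, i.e. of
  $\log (d\nu/d\rho)$, against \<open>\<nu>\<close> is taken as an extended-real integral (positive minus negative
  part, the latter being finite for probability measures), because \<^const>\<open>KL_divergence\<close> is 0
  when the density is not integrable.\<close>

definition rel_entropy :: "'a measure \<Rightarrow> 'a measure \<Rightarrow> ereal" where
  "rel_entropy \<nu> \<rho> =
     (if absolutely_continuous \<rho> \<nu>
      then enn2ereal (\<integral>\<^sup>+x. ennreal (entropy_density (exp 1) \<rho> \<nu> x) \<partial>\<nu>)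
         - enn2ereal (\<integral>\<^sup>+x. ennreal (- entropy_density (exp 1) \<rho> \<nu> x) \<partial>\<nu>)
      else \<infinity>)"


section \<open>Occupation numbers and weighted empirical measures\<close>

text \<open>The law of the occupation numbers of the urns \<open>{1..n}\<close> when the balls \<open>{..<m}\<close> are thrown
  independently and uniformly (for $n \ge 1$).\<close>

definition mult_unif_pmf :: "nat \<Rightarrow> nat \<Rightarrow> (nat \<Rightarrow> nat) pmf" where
  "mult_unif_pmf n m =
     map_pmf (\<lambda>urn. \<lambda>i\<in>{1..n}. card {k\<in>{..<m}. urn k = i})
       (Pi_pmf {..<m} 0 (\<lambda>_. pmf_of_set {1..n}))"

text \<open>$\frac1n\sum_{i=1}^n w_i\delta_{x_i}$; negative weights are cut off at 0.\<close>

definition weighted_empirical ::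
  "nat \<Rightarrow> (nat \<Rightarrow> real) \<Rightarrow> (nat \<Rightarrow> 'a::topological_space) \<Rightarrow> 'a measure" where
  "weighted_empirical n w x =
     distr (point_measure {1..n} (\<lambda>i. ennreal (w i / real n))) borel x"

lemma emeasure_weighted_empirical:
  assumes "B \<in> sets borel"
  shows "emeasure (weighted_empirical n w x) B =
    (\<Sum>i=1..n. ennreal (w i / real n) * indicator B (x i))"
proof -
  have "x \<in> measurable (point_measure {1..n} (\<lambda>i. ennreal (w i / real n))) borel"
    by (simp add: measurable_point_measure_eq1)
  then have "emeasure (weighted_empirical n w x) B =
      emeasure (point_measure {1..n} (\<lambda>i. ennreal (w i / real n))) (x -` B \<inter> {1..n})"
    unfolding weighted_empirical_def using assms by (simp add: emeasure_distr space_point_measure)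
  also have "\<dots> = (\<Sum>i\<in>x -` B \<inter> {1..n}. ennreal (w i / real n))"
    by (rule emeasure_point_measure_finite) auto
  also have "\<dots> = (\<Sum>i=1..n. ennreal (w i / real n) * indicator B (x i))"
    by (rule sum.mono_neutral_cong_left) (auto simp: indicator_def)
  finally show ?thesis .
qed

text \<open>The law of a random element of \<open>M1\<close>. The argument \<open>Y\<close> may leave \<open>M1\<close> on a null set:
  \<^const>\<open>distr\<close> assigns to each Borel set \<open>A\<close> of \<open>M1\<close> the probability of
  \<open>Y -` A \<inter> space M\<close> as soon as these preimages are events, and the result is then a probability
  measure iff \<open>Y\<close> is almost surely in \<open>M1\<close>.\<close>

definition law_M1 :: "'w measure \<Rightarrow> ('w \<Rightarrow> 'a::topological_space measure) \<Rightarrow> 'a measure measure" where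
  "law_M1 M Y = distr M (borel_of weak_topology) Y"

lemma emeasure_law_M1:
  fixes Y :: "'w \<Rightarrow> 'a::topological_space measure"
  assumes Y: "\<And>A. A \<in> sets (borel_of weak_topology) \<Longrightarrow> Y -` A \<inter> space M \<in> sets M"
    and A: "A \<in> sets (borel_of weak_topology)"
  shows "emeasure (law_M1 M Y) A = emeasure M (Y -` A \<inter> space M)"
  unfolding law_M1_def distr_def
proof (rule emeasure_measure_of_sigma)
  show "sigma_algebra (space (borel_of weak_topology)) (sets (borel_of weak_topology))"
    by (rule sets.sigma_algebra_axioms)
  show "positive (sets (borel_of weak_topology)) (\<lambda>A. emeasure M (Y -` A \<inter> space M))"
    by (simp add: positive_def)
  show "countably_additive (sets (borel_of weak_topology)) (\<lambda>A. emeasure M (Y -` A \<inter> space M))"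
  proof (rule countably_additiveI)
    fix F :: "nat \<Rightarrow> 'a measure set" assume F: "range F \<subseteq> sets (borel_of weak_topology)" "disjoint_family F"
    have "(\<Sum>i. emeasure M (Y -` F i \<inter> space M)) = emeasure M (\<Union>i. Y -` F i \<inter> space M)"
      using F Y by (intro suminf_emeasure) (auto simp: disjoint_family_on_def)
    also have "(\<Union>i. Y -` F i \<inter> space M) = Y -` (\<Union>i. F i) \<inter> space M" by auto
    finally show "(\<Sum>i. emeasure M (Y -` F i \<inter> space M)) = emeasure M (Y -` (\<Union>i. F i) \<inter> space M)" .
  qed
qed (rule A)


text \<open>Independence of two random variables with values in different types;
  \<^const>\<open>prob_space.indep_var\<close> requires the same type. Cf. \<open>indep_var_eq\<close>.\<close>

definition indep_rv ::
  "'w measure \<Rightarrow> 'b measure \<Rightarrow> ('w \<Rightarrow> 'b) \<Rightarrow> 'c measure \<Rightarrow> ('w \<Rightarrow> 'c) \<Rightarrow> bool" where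
  "indep_rv M S X T Y \<longleftrightarrow>
     X \<in> measurable M S \<and> Y \<in> measurable M T \<and>
     prob_space.indep_set M {X -` A \<inter> space M | A. A \<in> sets S} {Y -` B \<inter> space M | B. B \<in> sets T}"

end

theory Submission
  imports Defs "HOL-Real_Asymp.Real_Asymp"
begin

text \<open>Since the weights are multinomial and independent of the sample, $L^n$ is, given the sample,
  the empirical measure of $m(n)$ independent draws from $\zeta_n = \frac1n\sum_i\delta_{X_i^n}$.
  The exponential moments of these draws are $(\int e^f\,d\zeta_n)^{m(n)}$, a continuous function of
  $\zeta_n$; Chernoff bounds and exponential tilting therefore give Sanov-type estimates that are
  uniform for $\zeta_n$ in a weak neighbourhood, and these combine with the LDP of $\zeta_n$.

  For the upper bound and the goodness of $K$, $M_1(\Sigma)$ is embedded into the linear functionals on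
  bounded continuous functions that are bounded by the supremum norm, a compact set by Tychonoff.
  A functional $\Lambda$ with $\Lambda f \le c + \log\int e^f\,d\zeta$ for all $f$ is integration against a
  probability measure $\nu$ with $H(\nu|\zeta) \le c$, so the functionals that are not measures are
  infinitely costly and compactness is available without exponential tightness.\<close>

section \<open>Bounded continuous functions and approximation in mean\<close>

text \<open>The tilting function has to lie in \<open>Cb\<close>: a tilt by the true log-density
  would have the right cost, but its exponential moments need not be continuous in the sample
  measure. Hence the density is first replaced by a positive, bounded, continuous one with almost
  the same integrals and almost the same entropy. For the upper bound, a functional \<Lambda> and a
  measure \<zeta> whose joint cost exceeds a are separated by a single f in \<open>Cb\<close>, and
  the strict inequality survives on neighbourhoods of both. Level sets of the rate of the sample are
  compact, so finitely many neighbourhoods of measures \<zeta> suffice for one \<Lambda>; off them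
  the sample measure itself is too unlikely. The neighbourhood of \<Lambda> obtained in this way
  does two jobs: it bounds probabilities from above and \<open>K\<close> from below. The second job
  yields lower semicontinuity of \<open>K\<close> and closedness of its level sets in the compact
  space. Conditioning on the sample stays elementary, because the weights take finitely many values
  up to a null set: probabilities become finite sums over occupation vectors.\<close>

definition Cb :: "('a::topological_space \<Rightarrow> real) set" where
  "Cb = {f. continuous_on UNIV f \<and> bounded (range f)}"

lemma CbI:
  assumes "continuous_on UNIV f" "\<And>x. \<bar>f x\<bar> \<le> B"
  shows "f \<in> Cb"
  using assms unfolding Cb_def bounded_iff by auto

lemma CbE:
  assumes "f \<in> Cb"
  obtains B where "B > 0" "\<And>x. \<bar>f x\<bar> \<le> B"
proof -
  from assms obtain B where B: "\<And>x. \<bar>f x\<bar> \<le> B" unfolding Cb_def bounded_iff by auto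
  have "\<bar>f x\<bar> \<le> max B 1" for x using B[of x] by linarith
  then show ?thesis by (intro that[of "max B 1"]) auto
qed

lemma Cb_cont: "f \<in> Cb \<Longrightarrow> continuous_on UNIV f"
  by (simp add: Cb_def)

lemma Cb_measurable: "f \<in> Cb \<Longrightarrow> f \<in> borel_measurable borel"
  by (simp add: Cb_cont borel_measurable_continuous_onI)

lemma bounded_integrable:
  fixes f :: "'a \<Rightarrow> real"
  assumes "finite_measure \<mu>" "f \<in> borel_measurable \<mu>" "\<And>x. \<bar>f x\<bar> \<le> B"
  shows "integrable \<mu> f"
  using assms by (intro finite_measure.integrable_const_bound[where B=B]) auto

lemma Cb_integrable:
  assumes "f \<in> Cb" "finite_measure \<mu>" "sets \<mu> = sets borel"
  shows "integrable \<mu> f"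
proof -
  from CbE[OF assms(1)] obtain B where "B > 0" "\<And>x. \<bar>f x\<bar> \<le> B" by blast
  then show ?thesis
    using assms by (intro finite_measure.integrable_const_bound[where B=B])
      (auto simp: Cb_measurable cong: measurable_cong_sets)
qed

lemma Cb_const: "(\<lambda>_. c) \<in> Cb"
  by (rule CbI[where B="\<bar>c\<bar>"]) auto

lemma Cb_add:
  assumes "f \<in> Cb" "g \<in> Cb" shows "(\<lambda>x. f x + g x) \<in> Cb"
proof -
  from CbE[OF assms(1)] obtain B where B: "B > 0" "\<And>x. \<bar>f x\<bar> \<le> B" by blast
  from CbE[OF assms(2)] obtain C where C: "C > 0" "\<And>x. \<bar>g x\<bar> \<le> C" by blast
  have "\<bar>f x + g x\<bar> \<le> B + C" for x using B(2)[of x] C(2)[of x] by linarith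
  then show ?thesis using assms by (intro CbI[where B="B+C"]) (auto intro!: continuous_intros simp: Cb_cont)
qed

lemma Cb_comp:
  assumes "f \<in> Cb" "continuous_on UNIV g" shows "(\<lambda>x. g (f x)) \<in> Cb"
proof -
  from CbE[OF assms(1)] obtain B where B: "B > 0" "\<And>x. \<bar>f x\<bar> \<le> B" by blast
  have "compact (g ` {-B..B})"
    using assms(2) by (intro compact_continuous_image) (auto intro: continuous_on_subset)
  then obtain C where "\<forall>y\<in>g ` {-B..B}. norm y \<le> C"
    unfolding bounded_iff by (metis compact_imp_bounded bounded_iff)
  then have C: "\<bar>g y\<bar> \<le> C" if "y \<in> {-B..B}" for y using that by auto
  have "f x \<in> {-B..B}" for x using B(2)[of x] by auto
  then show ?thesis using assms C
    by (intro CbI[where B=C] continuous_on_compose2[OF assms(2)]) (auto simp: Cb_cont)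
qed

lemma Cb_scale: "f \<in> Cb \<Longrightarrow> (\<lambda>x. c * f x) \<in> Cb"
  by (rule Cb_comp[where g="\<lambda>y. c * y"]) (auto intro!: continuous_intros)

lemma Cb_exp: "f \<in> Cb \<Longrightarrow> (\<lambda>x. exp (f x)) \<in> Cb"
  by (rule Cb_comp[where g=exp]) (auto intro!: continuous_intros)

lemma Cb_sum: "finite S \<Longrightarrow> (\<And>i. i \<in> S \<Longrightarrow> f i \<in> Cb) \<Longrightarrow> (\<lambda>x. \<Sum>i\<in>S. f i x) \<in> Cb"
  by (induction S rule: finite_induct) (auto simp: Cb_const Cb_add)

lemma Cb_diff: "f \<in> Cb \<Longrightarrow> g \<in> Cb \<Longrightarrow> (\<lambda>x. f x - g x) \<in> Cb"
  using Cb_add[of f "\<lambda>x. (-1) * g x"] Cb_scale[of g "-1"] by simp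

lemma Cb_abs: "f \<in> Cb \<Longrightarrow> (\<lambda>x. \<bar>f x\<bar>) \<in> Cb"
  by (rule Cb_comp[where g=abs]) (auto intro!: continuous_intros)

lemma M1_finite: "\<mu> \<in> M1 \<Longrightarrow> finite_measure \<mu>"
  by (simp add: M1_def prob_space.finite_measure)

lemma M1_prob: "\<mu> \<in> M1 \<Longrightarrow> prob_space \<mu>"
  by (simp add: M1_def)

lemma M1_sets: "\<mu> \<in> M1 \<Longrightarrow> sets \<mu> = sets borel"
  by (simp add: M1_def)

lemma Cb_integrable_M1: "f \<in> Cb \<Longrightarrow> \<mu> \<in> M1 \<Longrightarrow> integrable \<mu> f"
  by (rule Cb_integrable[OF _ M1_finite M1_sets])

lemma integral_exp_pos:
  assumes "f \<in> Cb" "\<mu> \<in> M1" shows "0 < (\<integral>x. exp (f x) \<partial>\<mu>)"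
proof -
  interpret prob_space \<mu> using assms by (simp add: M1_prob)
  from CbE[OF assms(1)] obtain B where B: "B > 0" "\<And>x. \<bar>f x\<bar> \<le> B" by blast
  have "exp (-B) \<le> (\<integral>x. exp (f x) \<partial>\<mu>)"
  proof (rule integral_ge_const)
    show "integrable \<mu> (\<lambda>x. exp (f x))" using assms by (simp add: Cb_integrable_M1 Cb_exp)
    have "- B \<le> f x" for x using B(2)[of x] by linarith
    then show "AE x in \<mu>. exp (-B) \<le> exp (f x)" by simp
  qed
  then show ?thesis using exp_gt_zero[of "-B"] by linarith
qed

section \<open>Approximation of measurable functions in mean by continuous ones\<close>

lemma regular_sandwich:
  fixes \<mu> :: "'a::polish_space measure"
  assumes \<mu>: "finite_measure \<mu>" "sets \<mu> = sets borel" and A: "A \<in> sets borel" and "\<epsilon> > 0"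
  obtains K U where "closed K" "open U" "K \<subseteq> A" "A \<subseteq> U" "measure \<mu> (U - K) < \<epsilon>"
proof -
  interpret finite_measure \<mu> by fact
  have fin: "emeasure \<mu> (space \<mu>) \<noteq> \<infinity>" by simp
  \<comment> \<open>Otherwise the supremum over compact subsets would stay \<epsilon>/2 below the
    measure of A. The empty set gives \<epsilon>/2 \<le> \<mu>(A), so that the truncated subtraction
    of \<open>ennreal\<close> is a genuine one.\<close>
  have "\<exists>K. K \<subseteq> A \<and> compact K \<and> emeasure \<mu> A < emeasure \<mu> K + ennreal (\<epsilon>/2)"
  proof (rule ccontr)
    assume "\<not> ?thesis"
    then have *: "\<And>K. K \<subseteq> A \<Longrightarrow> compact K \<Longrightarrow> emeasure \<mu> K + ennreal (\<epsilon>/2) \<le> emeasure \<mu> A" by force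
    then have "emeasure \<mu> K \<le> emeasure \<mu> A - ennreal (\<epsilon>/2)" if "K \<subseteq> A" "compact K" for K
      using that by (simp add: ennreal_le_minus_iff add.commute)
    then have "emeasure \<mu> A \<le> emeasure \<mu> A - ennreal (\<epsilon>/2)"
      unfolding inner_regular[OF \<mu>(2) fin A, symmetric]
      by (subst (1) inner_regular[OF \<mu>(2) fin A]) (auto intro!: SUP_least)
    moreover have "emeasure \<mu> {} + ennreal (\<epsilon>/2) \<le> emeasure \<mu> A"
      using *[of "{}"] by simp
    ultimately show False using \<open>\<epsilon> > 0\<close>
      by (auto simp: emeasure_eq_measure ennreal_minus ennreal_le_iff2 zero_less_measure_iff)
  qed
  then obtain K where K: "K \<subseteq> A" "compact K" "emeasure \<mu> A < emeasure \<mu> K + ennreal (\<epsilon>/2)" by blast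
  have "(INF U\<in>{U. A \<subseteq> U \<and> open U}. emeasure \<mu> U) < emeasure \<mu> A + ennreal (\<epsilon>/2)"
    using \<open>\<epsilon> > 0\<close> unfolding outer_regular[OF \<mu>(2) fin A, symmetric]
    by (simp add: emeasure_eq_measure ennreal_less_iff flip: ennreal_plus)
  then obtain U where U: "A \<subseteq> U" "open U" "emeasure \<mu> U < emeasure \<mu> A + ennreal (\<epsilon>/2)"
    unfolding INF_less_iff by blast
  have s: "K \<in> sets \<mu>" "U \<in> sets \<mu>" "A \<in> sets \<mu>"
    using \<mu> A K U by (auto simp: compact_imp_closed)
  have "measure \<mu> (U - K) = measure \<mu> U - measure \<mu> K"
    using s K U by (intro finite_measure_Diff) auto
  moreover have "measure \<mu> A < measure \<mu> K + \<epsilon>/2" "measure \<mu> U < measure \<mu> A + \<epsilon>/2"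
    using K(3) U(3) \<open>\<epsilon> > 0\<close> by (auto simp: emeasure_eq_measure ennreal_less_iff simp flip: ennreal_plus)
  ultimately show ?thesis using K U by (intro that[of K U]) (auto simp: compact_imp_closed)
qed

text \<open>A Urysohn function between a closed set inside A and an open set around A differs from
  the indicator only on the gap. Two measures are treated at once because later the integrals of one
  and the same k under both are compared.\<close>

lemma approx_indicator:
  fixes \<mu> \<nu> :: "'a::polish_space measure"
  assumes \<mu>: "finite_measure \<mu>" "sets \<mu> = sets borel"
    and \<nu>: "finite_measure \<nu>" "sets \<nu> = sets borel"
    and A: "A \<in> sets borel" and "\<epsilon> > 0"
  obtains k where "continuous_on UNIV k" "\<And>x. 0 \<le> k x" "\<And>x. k x \<le> (1::real)"
    "(\<integral>x. \<bar>k x - indicator A x\<bar> \<partial>\<mu>) < \<epsilon>" "(\<integral>x. \<bar>k x - indicator A x\<bar> \<partial>\<nu>) < \<epsilon>"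
proof -
  from regular_sandwich[OF \<mu> A \<open>\<epsilon> > 0\<close>] obtain K1 U1 where
    1: "closed K1" "open U1" "K1 \<subseteq> A" "A \<subseteq> U1" "measure \<mu> (U1 - K1) < \<epsilon>" .
  from regular_sandwich[OF \<nu> A \<open>\<epsilon> > 0\<close>] obtain K2 U2 where
    2: "closed K2" "open U2" "K2 \<subseteq> A" "A \<subseteq> U2" "measure \<nu> (U2 - K2) < \<epsilon>" .
  \<comment> \<open>With the union of the inner sets and the intersection of the outer sets, the gap
    U - K lies in both original gaps, so one function serves both measures.\<close>
  define K where "K = K1 \<union> K2"
  define U where "U = U1 \<inter> U2"
  have KU: "closed K" "open U" "K \<subseteq> A" "A \<subseteq> U" using 1 2 by (auto simp: K_def U_def)
  have "normal_space (euclidean :: 'a topology)"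
    by (simp add: metrizable_imp_normal_space metrizable_space_euclidean)
  moreover have "closedin euclidean (- U)" "closedin euclidean K" "disjnt (- U) K"
    using KU by (auto simp: disjnt_def)
  ultimately obtain k :: "'a \<Rightarrow> real" where
    k: "continuous_map euclidean (top_of_set {0..1}) k" "k ` (- U) \<subseteq> {0}" "k ` K \<subseteq> {1}"
    using Urysohn_lemma[of euclidean "- U" K 0 1] by (metis zero_le_one)
  have c: "continuous_on UNIV k" using k(1) by (simp add: continuous_map_in_subtopology)
  have r: "0 \<le> k x" "k x \<le> 1" for x using k(1) by (auto simp: continuous_map_in_subtopology)
  have le: "\<bar>k x - indicator A x\<bar> \<le> indicator (U - K) x" for x
    using k(2,3) r[of x] KU by (auto simp: indicator_def image_subset_iff split: if_splits) 
  have *: "(\<integral>x. \<bar>k x - indicator A x\<bar> \<partial>m) \<le> measure m (U - K)"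
    if m: "finite_measure m" "sets m = sets borel" for m
  proof -
    interpret finite_measure m by fact
    have [measurable]: "k \<in> borel_measurable m" "A \<in> sets m" "U - K \<in> sets m"
      using c m A KU by (auto intro: borel_measurable_continuous_onI cong: measurable_cong_sets)
    have "(\<integral>x. \<bar>k x - indicator A x\<bar> \<partial>m) \<le> (\<integral>x. indicator (U - K) x \<partial>m)"
    proof (rule integral_mono)
      show "integrable m (\<lambda>x. \<bar>k x - indicator A x\<bar>)"
        using le by (intro integrable_const_bound[where B=1] AE_I2) (auto intro: order_trans simp: indicator_le_1)
      show "integrable m (indicator (U - K) :: _ \<Rightarrow> real)"
        by (simp add: integrable_indicator_iff less_top[symmetric])
    qed (rule le)
    also have "\<dots> = measure m (U - K)" by simp
    finally show ?thesis .
  qed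
  have "measure \<mu> (U - K) \<le> measure \<mu> (U1 - K1)" "measure \<nu> (U - K) \<le> measure \<nu> (U2 - K2)"
    using 1 2 \<mu> \<nu> by (auto intro!: finite_measure.finite_measure_mono simp: K_def U_def)
  then show ?thesis using *[OF \<mu>] *[OF \<nu>] 1(5) 2(5) c r
    by (intro that[of k] c r) (metis order_le_less_trans)+
qed

text \<open>The layer sum is $\lfloor N y\rfloor / N$.\<close>

lemma layer_approx:
  fixes y :: real assumes y: "0 \<le> y" "y \<le> 1" and N: "N > 0"
  shows "\<bar>y - (1 / real N) * (\<Sum>i=1..N. if real i / real N \<le> y then 1 else 0)\<bar> \<le> 1 / real N"
proof -
  define j where "j = nat \<lfloor>real N * y\<rfloor>"
  have fl: "real j = of_int \<lfloor>real N * y\<rfloor>" using y by (simp add: j_def)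
  have j: "real j \<le> real N * y" "real N * y < real j + 1" unfolding fl by linarith+
  have iff: "real i / real N \<le> y \<longleftrightarrow> i \<le> j" for i
  proof -
    have "real i / real N \<le> y \<longleftrightarrow> real i \<le> real N * y" using N by (simp add: field_simps)
    also have "\<dots> \<longleftrightarrow> i \<le> j" using j by linarith
    finally show ?thesis .
  qed
  have "j \<le> N"
  proof -
    have "real N * y \<le> real N" using y N by (simp add: mult_left_le)
    then show ?thesis using j(1) by linarith
  qed
  have "(\<Sum>i=1..N. if real i / real N \<le> y then 1 else 0::real) = real (card {i\<in>{1..N}. i \<le> j})"
    unfolding iff by (simp flip: sum.inter_filter)
  also have "{i\<in>{1..N}. i \<le> j} = {1..j}" using \<open>j \<le> N\<close> by auto
  finally have "(\<Sum>i=1..N. if real i / real N \<le> y then 1 else 0::real) = real j" by simp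
  moreover have "\<bar>y - real j / real N\<bar> = \<bar>real N * y - real j\<bar> / real N"
    using N by (simp add: abs_div_pos diff_divide_distrib)
  moreover have "\<bar>real N * y - real j\<bar> \<le> 1" using j by linarith
  ultimately show ?thesis using N by (simp add: divide_right_mono)
qed

text \<open>Rescale g to [0,1], slice it into N level sets, approximate the N indicators and
  average. An average of [0,1]-valued functions stays in [0,1], so the bounds a and b are kept
  exactly; the tilting later relies on the positive lower bound.\<close>

lemma approx_continuous:
  fixes \<mu> \<nu> :: "'a::polish_space measure"
  assumes \<mu>: "finite_measure \<mu>" "sets \<mu> = sets borel"
    and \<nu>: "finite_measure \<nu>" "sets \<nu> = sets borel"
    and g[measurable]: "g \<in> borel_measurable borel" and gb: "\<And>x. a \<le> g x" "\<And>x. g x \<le> (b::real)"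
    and ab: "a < b" and \<epsilon>: "\<epsilon> > 0"
  obtains k where "continuous_on UNIV k" "\<And>x. a \<le> k x" "\<And>x. k x \<le> b"
    "(\<integral>x. \<bar>k x - g x\<bar> \<partial>\<mu>) < \<epsilon>" "(\<integral>x. \<bar>k x - g x\<bar> \<partial>\<nu>) < \<epsilon>"
proof -
  define h where "h x = (g x - a) / (b - a)" for x
  have h: "0 \<le> h x" "h x \<le> 1" for x using gb[of x] ab by (simp_all add: h_def)
  have hm[measurable]: "h \<in> borel_measurable borel" unfolding h_def by simp
  \<comment> \<open>Integrating the slicing error 1/N gives at most the total mass over N. C bounds
    both masses, and the summand 1 keeps it positive.\<close>
  define C where "C = 1 + measure \<mu> (space \<mu>) + measure \<nu> (space \<nu>)"
  have C: "C > 0" "measure \<mu> (space \<mu>) \<le> C" "measure \<nu> (space \<nu>) \<le> C"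
    using measure_nonneg[of \<mu> "space \<mu>"] measure_nonneg[of \<nu> "space \<nu>"] unfolding C_def by linarith+
  \<comment> \<open>The division anticipates the factor b - a from undoing the rescaling. Of the two
    halves \<delta> of d, one is for the slicing and one for the indicators.\<close>
  define d where "d = \<epsilon> / (b - a)"
  define \<delta> where "\<delta> = d / 2"
  have \<delta>: "\<delta> > 0" using ab \<epsilon> by (simp add: \<delta>_def d_def)
  obtain N where N: "N > 0" "C / real N < \<delta>"
  proof -
    obtain N where "real N > C / \<delta>" using reals_Archimedean2 by blast
    then have *: "C < real N * \<delta>" using \<delta> by (simp add: pos_divide_less_eq)
    then have "N > 0" using C by (cases "N = 0") auto
    moreover from this have "C / real N < \<delta>" using * by (simp add: pos_divide_less_eq mult.commute)
    ultimately show ?thesis by (rule that)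
  qed
  define A where "A i = {x. real i / real N \<le> h x}" for i
  have A: "A i \<in> sets borel" for i unfolding A_def by measurable
  have "\<forall>i. \<exists>k. continuous_on UNIV k \<and> (\<forall>x. 0 \<le> k x \<and> k x \<le> (1::real)) \<and>
     (\<integral>x. \<bar>k x - indicator (A i) x\<bar> \<partial>\<mu>) < \<delta> \<and> (\<integral>x. \<bar>k x - indicator (A i) x\<bar> \<partial>\<nu>) < \<delta>"
  proof
    fix i
    obtain k where "continuous_on UNIV k" "\<And>x. 0 \<le> k x" "\<And>x. k x \<le> (1::real)"
      "(\<integral>x. \<bar>k x - indicator (A i) x\<bar> \<partial>\<mu>) < \<delta>" "(\<integral>x. \<bar>k x - indicator (A i) x\<bar> \<partial>\<nu>) < \<delta>"
      using approx_indicator[OF \<mu> \<nu> A \<delta>] by blast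
    then show "\<exists>k. continuous_on UNIV k \<and> (\<forall>x. 0 \<le> k x \<and> k x \<le> (1::real)) \<and>
     (\<integral>x. \<bar>k x - indicator (A i) x\<bar> \<partial>\<mu>) < \<delta> \<and> (\<integral>x. \<bar>k x - indicator (A i) x\<bar> \<partial>\<nu>) < \<delta>"
      by blast
  qed
  then obtain k where kc: "\<And>i. continuous_on UNIV (k i)" and kb: "\<And>i x. 0 \<le> k i x" "\<And>i x. k i x \<le> (1::real)"
    and k\<mu>: "\<And>i. (\<integral>x. \<bar>k i x - indicator (A i) x\<bar> \<partial>\<mu>) < \<delta>"
    and k\<nu>: "\<And>i. (\<integral>x. \<bar>k i x - indicator (A i) x\<bar> \<partial>\<nu>) < \<delta>" by metis
  define K where "K x = (1 / real N) * (\<Sum>i=1..N. k i x)" for x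
  have Kc: "continuous_on UNIV K" unfolding K_def using kc by (intro continuous_intros)
  have K0: "0 \<le> K x" for x unfolding K_def using kb by (intro mult_nonneg_nonneg sum_nonneg) auto
  have K1: "K x \<le> 1" for x
  proof -
    have "(\<Sum>i=1..N. k i x) \<le> (\<Sum>i=1..N. 1)" using kb by (intro sum_mono) auto
    then show ?thesis using N by (simp add: K_def)
  qed
  have bnd: "(\<integral>x. \<bar>K x - h x\<bar> \<partial>m) < 2 * \<delta>"
    if m: "finite_measure m" "sets m = sets borel" and mC: "measure m (space m) \<le> C"
      and km: "\<And>i. (\<integral>x. \<bar>k i x - indicator (A i) x\<bar> \<partial>m) < \<delta>" for m
  proof -
    interpret finite_measure m by fact
    have [measurable]: "k i \<in> borel_measurable m" "A i \<in> sets m" "K \<in> borel_measurable m" "h \<in> borel_measurable m" for i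
      unfolding measurable_cong_sets[OF m(2) refl] using kc Kc m A hm by (simp_all add: borel_measurable_continuous_onI)
    have pw: "\<bar>K x - h x\<bar> \<le> 1 / real N + (1 / real N) * (\<Sum>i=1..N. \<bar>k i x - indicator (A i) x\<bar>)" for x
    proof -
      have "\<bar>h x - (1 / real N) * (\<Sum>i=1..N. indicator (A i) x)\<bar> \<le> 1 / real N"
        using layer_approx[OF h[of x] N(1)] by (simp add: A_def indicator_def of_bool_def)
      moreover have "\<bar>K x - (1 / real N) * (\<Sum>i=1..N. indicator (A i) x)\<bar>
          = (1 / real N) * \<bar>\<Sum>i=1..N. k i x - indicator (A i) x\<bar>"
        unfolding K_def sum_subtractf right_diff_distrib[symmetric] abs_mult by simp
      moreover have "\<dots> \<le> (1 / real N) * (\<Sum>i=1..N. \<bar>k i x - indicator (A i) x\<bar>)"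
        by (intro mult_left_mono sum_abs) auto
      ultimately show ?thesis by linarith
    qed
    have int: "integrable m (\<lambda>x. \<bar>k i x - indicator (A i) x\<bar>)" for i
    proof (rule bounded_integrable[OF m(1)])
      show "\<bar>\<bar>k i x - indicator (A i) x\<bar>\<bar> \<le> 1" for x
        using kb(1)[of i x] kb(2)[of i x] by (simp add: indicator_def)
    qed simp
    have "(\<integral>x. \<bar>K x - h x\<bar> \<partial>m) \<le> (\<integral>x. 1 / real N + (1 / real N) * (\<Sum>i=1..N. \<bar>k i x - indicator (A i) x\<bar>) \<partial>m)"
    proof (rule integral_mono)
      show "integrable m (\<lambda>x. \<bar>K x - h x\<bar>)"
      proof (rule bounded_integrable[OF m(1)])
        show "\<bar>\<bar>K x - h x\<bar>\<bar> \<le> 1" for x using K0[of x] K1[of x] h[of x] by linarith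
      qed simp
      show "integrable m (\<lambda>x. 1 / real N + (1 / real N) * (\<Sum>i=1..N. \<bar>k i x - indicator (A i) x\<bar>))"
        by (intro Bochner_Integration.integrable_add integrable_mult_right Bochner_Integration.integrable_sum int integrable_const)
    qed (rule pw)
    also have "\<dots> = measure m (space m) / real N + (1 / real N) * (\<Sum>i=1..N. \<integral>x. \<bar>k i x - indicator (A i) x\<bar> \<partial>m)"
      using int by (subst Bochner_Integration.integral_add)
        (simp_all add: Bochner_Integration.integrable_sum Bochner_Integration.integral_sum)
    also have "\<dots> \<le> C / real N + (1 / real N) * (\<Sum>i=1..N. \<delta>)"
      using km mC by (intro add_mono mult_left_mono sum_mono divide_right_mono) (simp_all add: less_imp_le)
    also have "\<dots> < 2 * \<delta>" using N by simp
    finally show ?thesis .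
  qed
  define k' where "k' x = a + (b - a) * K x" for x
  have eq: "(\<integral>x. \<bar>k' x - g x\<bar> \<partial>m) = (b - a) * (\<integral>x. \<bar>K x - h x\<bar> \<partial>m)" for m
  proof -
    have "(b - a) * h x = g x - a" for x using ab by (simp add: h_def)
    then have "k' x - g x = (b - a) * (K x - h x)" for x
      unfolding right_diff_distrib by (simp add: k'_def)
    then have "\<bar>k' x - g x\<bar> = (b - a) * \<bar>K x - h x\<bar>" for x
      using ab by (simp add: abs_mult)
    then show ?thesis by simp
  qed
  show ?thesis
  proof (rule that[of k'])
    show "continuous_on UNIV k'" unfolding k'_def using Kc by (intro continuous_intros)
    show "a \<le> k' x" for x using K0[of x] ab by (simp add: k'_def)
    show "k' x \<le> b" for x
    proof -
      have "(b - a) * K x \<le> (b - a) * 1" using K1[of x] ab by (intro mult_left_mono) auto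
      then show ?thesis by (simp add: k'_def)
    qed
    have pos: "0 < b - a" using ab by simp
    have "2 * \<delta> = d" by (simp add: \<delta>_def)
    then have \<epsilon>_eq: "\<epsilon> = (b - a) * (2 * \<delta>)" using pos by (simp add: d_def)
    show "(\<integral>x. \<bar>k' x - g x\<bar> \<partial>\<mu>) < \<epsilon>" "(\<integral>x. \<bar>k' x - g x\<bar> \<partial>\<nu>) < \<epsilon>"
      unfolding eq \<epsilon>_eq
      by (intro mult_strict_left_mono bnd \<mu> \<nu> C k\<mu> k\<nu> pos)+
  qed
qed

section \<open>Relative entropy and its variational formula\<close>

text \<open>The Radon-Nikodym derivative is finite almost everywhere, so its real part is still a
  density. As \<open>entropy_density\<close> is built from the same \<open>enn2real\<close>, the
  identity with \<open>ln\<close> holds at every point.\<close>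

lemma absolutely_continuous_densityE:
  assumes \<nu>: "\<nu> \<in> M1" and \<zeta>: "\<zeta> \<in> M1" and ac: "absolutely_continuous \<zeta> \<nu>"
  obtains h :: "'a::topological_space \<Rightarrow> real" where "h \<in> borel_measurable borel" "\<And>x. 0 \<le> h x"
    "\<nu> = density \<zeta> (\<lambda>x. ennreal (h x))" "\<And>x. entropy_density (exp 1) \<zeta> \<nu> x = ln (h x)"
proof -
  interpret \<zeta>: prob_space \<zeta> by (rule M1_prob[OF \<zeta>])
  interpret \<nu>: prob_space \<nu> by (rule M1_prob[OF \<nu>])
  have s: "sets \<nu> = sets \<zeta>" by (simp only: M1_sets[OF \<nu>] M1_sets[OF \<zeta>])
  define h where "h x = enn2real (RN_deriv \<zeta> \<nu> x)" for x
  have rm: "RN_deriv \<zeta> \<nu> \<in> borel_measurable borel"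
    using borel_measurable_RN_deriv[of \<zeta> \<nu>] unfolding measurable_cong_sets[OF M1_sets[OF \<zeta>] refl] .
  have rm': "RN_deriv \<zeta> \<nu> \<in> borel_measurable \<zeta>" by (rule borel_measurable_RN_deriv)
  have "AE x in \<zeta>. RN_deriv \<zeta> \<nu> x \<noteq> \<infinity>"
    by (rule \<zeta>.RN_deriv_finite[OF _ ac s]) (rule \<nu>.sigma_finite_measure_axioms)
  then have "density \<zeta> (RN_deriv \<zeta> \<nu>) = density \<zeta> (\<lambda>x. ennreal (h x))"
    using rm' by (intro density_cong) (auto simp: h_def less_top elim!: eventually_mono)
  then have \<nu>h: "\<nu> = density \<zeta> (\<lambda>x. ennreal (h x))" unfolding \<zeta>.density_RN_deriv[OF ac s] .
  have hm: "h \<in> borel_measurable borel" unfolding h_def using rm by measurable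
  have "entropy_density (exp 1) \<zeta> \<nu> x = ln (h x)" for x
    by (simp add: entropy_density_def h_def log_def)
  then show ?thesis by (intro that[OF hm _ \<nu>h]) (simp_all add: h_def)
qed

text \<open>Against \<zeta> the integrand is the positive part of -h ln h, and ln t \<le> t - 1 at t
  = 1/h bounds it by 1 - h \<le> 1. So the difference in \<open>rel_entropy\<close> is never of the
  form \<infinity> - \<infinity> for measures in \<open>M1\<close>.\<close>

lemma neg_part_entropy_le:
  assumes \<zeta>: "\<zeta> \<in> M1" and [measurable]: "h \<in> borel_measurable borel" and h0: "\<And>x. 0 \<le> h x"
    and \<nu>: "\<nu> = density \<zeta> (\<lambda>x. ennreal (h x))"
  shows "(\<integral>\<^sup>+x. ennreal (- ln (h x)) \<partial>\<nu>) \<le> 1"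
proof -
  interpret \<zeta>: prob_space \<zeta> by (rule M1_prob[OF \<zeta>])
  have m[measurable]: "h \<in> borel_measurable \<zeta>" unfolding measurable_cong_sets[OF M1_sets[OF \<zeta>] refl] by simp
  have "(\<integral>\<^sup>+x. ennreal (- ln (h x)) \<partial>\<nu>) = (\<integral>\<^sup>+x. ennreal (h x) * ennreal (- ln (h x)) \<partial>\<zeta>)"
    unfolding \<nu> by (rule nn_integral_density) measurable
  also have "\<dots> \<le> (\<integral>\<^sup>+x. 1 \<partial>\<zeta>)"
  proof (rule nn_integral_mono)
    fix x
    have "h x * (- ln (h x)) \<le> 1"
    proof (cases "h x = 0")
      case False
      then have p: "h x > 0" using h0[of x] by linarith
      have "- ln (h x) = ln (1 / h x)" using p by (simp add: ln_div)
      also have "\<dots> \<le> 1 / h x - 1" using p by (intro ln_le_minus_one) simp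
      finally have "h x * (- ln (h x)) \<le> h x * (1 / h x - 1)" using p by (intro mult_left_mono) auto
      also have "\<dots> \<le> 1" using p by (simp add: right_diff_distrib)
      finally show ?thesis .
    qed simp
    then have "ennreal (h x * (- ln (h x))) \<le> ennreal 1" by (rule ennreal_leI)
    then show "ennreal (h x) * ennreal (- ln (h x)) \<le> 1"
      using h0[of x] by (simp only: ennreal_mult'[symmetric] ennreal_1)
  qed
  also have "\<dots> = 1" by (simp add: \<zeta>.emeasure_space_1)
  finally show ?thesis .
qed

lemma rel_entropy_finiteE:
  fixes \<nu> \<zeta> :: "'a::topological_space measure"
  assumes \<nu>: "\<nu> \<in> M1" and \<zeta>: "\<zeta> \<in> M1" and fin: "rel_entropy \<nu> \<zeta> \<noteq> \<infinity>"
  obtains h where "h \<in> borel_measurable borel" "\<And>x. 0 \<le> h x"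
    "\<nu> = density \<zeta> (\<lambda>x. ennreal (h x))" "integrable \<nu> (\<lambda>x. ln (h x))"
    "rel_entropy \<nu> \<zeta> = ereal (\<integral>x. ln (h x) \<partial>\<nu>)"
proof -
  have ac: "absolutely_continuous \<zeta> \<nu>"
  proof (rule ccontr)
    assume "\<not> absolutely_continuous \<zeta> \<nu>"
    then have "rel_entropy \<nu> \<zeta> = \<infinity>" by (simp add: rel_entropy_def)
    then show False using fin by simp
  qed
  obtain h :: "'a \<Rightarrow> real" where h: "h \<in> borel_measurable borel" "\<And>x. 0 \<le> h x"
    "\<nu> = density \<zeta> (\<lambda>x. ennreal (h x))" "\<And>x. entropy_density (exp 1) \<zeta> \<nu> x = ln (h x)"
    using absolutely_continuous_densityE[OF \<nu> \<zeta> ac] by blast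
  have m: "h \<in> borel_measurable \<nu>" unfolding measurable_cong_sets[OF M1_sets[OF \<nu>] refl] by (rule h)
  define p where "p = (\<integral>\<^sup>+x. ennreal (ln (h x)) \<partial>\<nu>)"
  define q where "q = (\<integral>\<^sup>+x. ennreal (- ln (h x)) \<partial>\<nu>)"
  have H: "rel_entropy \<nu> \<zeta> = enn2ereal p - enn2ereal q"
    using ac by (simp add: rel_entropy_def p_def q_def h(4))
  have q: "q \<noteq> \<infinity>" using neg_part_entropy_le[OF \<zeta> h(1-3)] unfolding q_def
    by (metis ennreal_one_less_top infinity_ennreal_def leD)
  have p: "p \<noteq> \<infinity>"
  proof
    assume "p = \<infinity>"
    then have "rel_entropy \<nu> \<zeta> = \<infinity>" using q unfolding H by (cases q) (auto simp: infinity_ennreal_def)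
    then show False using fin by simp
  qed
  have int: "integrable \<nu> (\<lambda>x. ln (h x))"
    unfolding real_integrable_def using p q m by (auto simp: p_def q_def)
  have "rel_entropy \<nu> \<zeta> = ereal (\<integral>x. ln (h x) \<partial>\<nu>)"
    unfolding H real_lebesgue_integral_def[OF int] p_def[symmetric] q_def[symmetric]
    using p q by (cases p; cases q) auto
  then show ?thesis using h int by (intro that) auto
qed

lemma integral_density_M1:
  fixes g h :: "'a::topological_space \<Rightarrow> real"
  assumes \<zeta>: "\<zeta> \<in> M1" and h: "h \<in> borel_measurable borel" "\<And>x. 0 \<le> h x"
    and \<nu>: "\<nu> = density \<zeta> (\<lambda>x. ennreal (h x))" and g: "g \<in> borel_measurable borel"
  shows "integrable \<nu> g \<longleftrightarrow> integrable \<zeta> (\<lambda>x. h x * g x)"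
    and "(\<integral>x. g x \<partial>\<nu>) = (\<integral>x. h x * g x \<partial>\<zeta>)"
proof -
  have "g \<in> borel_measurable \<zeta>" "h \<in> borel_measurable \<zeta>"
    unfolding measurable_cong_sets[OF M1_sets[OF \<zeta>] refl] by (fact g, fact h)
  then show "integrable \<nu> g \<longleftrightarrow> integrable \<zeta> (\<lambda>x. h x * g x)"
    "(\<integral>x. g x \<partial>\<nu>) = (\<integral>x. h x * g x \<partial>\<zeta>)"
    unfolding \<nu> using h(2) integrable_density[of g \<zeta> h] integral_density[of g \<zeta> h] by simp_all
qed

text \<open>With Z the exponential moment and h the density, the claim is that g = f - ln Z - ln h
  has \<nu>-integral at most 0. From ln t \<le> t - 1 one gets h g \<le> e^f / Z - h, and both terms
  on the right integrate to 1 under \<zeta>.\<close>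

theorem donsker_varadhan_le:
  fixes \<nu> \<zeta> :: "'a::topological_space measure"
  assumes \<nu>: "\<nu> \<in> M1" and \<zeta>: "\<zeta> \<in> M1" and f: "f \<in> Cb"
  shows "ereal ((\<integral>x. f x \<partial>\<nu>) - ln (\<integral>x. exp (f x) \<partial>\<zeta>)) \<le> rel_entropy \<nu> \<zeta>"
proof (cases "rel_entropy \<nu> \<zeta> = \<infinity>")
  case False
  obtain h where h: "h \<in> borel_measurable borel" "\<And>x. 0 \<le> h x"
    "\<nu> = density \<zeta> (\<lambda>x. ennreal (h x))" and int: "integrable \<nu> (\<lambda>x. ln (h x))"
    and H: "rel_entropy \<nu> \<zeta> = ereal (\<integral>x. ln (h x) \<partial>\<nu>)"
    using rel_entropy_finiteE[OF \<nu> \<zeta> False] by metis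
  interpret \<zeta>: prob_space \<zeta> by (rule M1_prob[OF \<zeta>])
  interpret \<nu>: prob_space \<nu> by (rule M1_prob[OF \<nu>])
  define Z where "Z = (\<integral>x. exp (f x) \<partial>\<zeta>)"
  have Z: "Z > 0" unfolding Z_def by (rule integral_exp_pos[OF f \<zeta>])
  have fm: "f \<in> borel_measurable borel" by (rule Cb_measurable[OF f])
  note [measurable] = h(1) fm
  have fi: "integrable \<nu> f" by (rule Cb_integrable_M1[OF f \<nu>])
  have ei: "integrable \<zeta> (\<lambda>x. exp (f x))" by (rule Cb_integrable_M1[OF Cb_exp[OF f] \<zeta>])
  define g where "g x = f x - ln Z - ln (h x)" for x
  have gi: "integrable \<nu> g" unfolding g_def
    by (intro Bochner_Integration.integrable_diff fi int \<nu>.integrable_const)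
  have gm: "g \<in> borel_measurable borel" unfolding g_def by measurable
  have "(\<integral>x. g x \<partial>\<nu>) = (\<integral>x. h x * g x \<partial>\<zeta>)" by (rule integral_density_M1(2)[OF \<zeta> h gm])
  also have "\<dots> \<le> (\<integral>x. exp (f x) / Z - h x \<partial>\<zeta>)"
  proof (rule integral_mono)
    show "integrable \<zeta> (\<lambda>x. h x * g x)" using gi integral_density_M1(1)[OF \<zeta> h gm] by simp
    have "integrable \<zeta> h" using integral_density_M1(1)[OF \<zeta> h, of "\<lambda>_. 1"] by simp
    then show "integrable \<zeta> (\<lambda>x. exp (f x) / Z - h x)" using ei by (intro Bochner_Integration.integrable_diff) auto
    fix x
    show "h x * g x \<le> exp (f x) / Z - h x"
    proof (cases "h x = 0")
      case True then show ?thesis using Z by simp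
    next
      case False
      then have p: "h x > 0" using h(2)[of x] by linarith
      have "g x = ln (exp (f x) / (Z * h x))" using p Z by (simp add: g_def ln_div ln_mult)
      also have "\<dots> \<le> exp (f x) / (Z * h x) - 1" using p Z by (intro ln_le_minus_one) simp
      finally have "h x * g x \<le> h x * (exp (f x) / (Z * h x) - 1)" using p by (intro mult_left_mono) auto
      also have "\<dots> = exp (f x) / Z - h x" using p by (simp add: right_diff_distrib)
      finally show ?thesis .
    qed
  qed
  also have "\<dots> = (\<integral>x. exp (f x) / Z \<partial>\<zeta>) - (\<integral>x. h x \<partial>\<zeta>)"
    using ei integral_density_M1(1)[OF \<zeta> h, of "\<lambda>_. 1"] by (intro Bochner_Integration.integral_diff) auto
  also have "\<dots> = 0"
    using integral_density_M1(2)[OF \<zeta> h, of "\<lambda>_. 1"] Z by (simp add: Z_def[symmetric] \<nu>.prob_space)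
  finally have "(\<integral>x. g x \<partial>\<nu>) \<le> 0" .
  moreover have "(\<integral>x. g x \<partial>\<nu>) = (\<integral>x. f x \<partial>\<nu>) - ln Z - (\<integral>x. ln (h x) \<partial>\<nu>)"
    unfolding g_def using fi int by (simp add: \<nu>.prob_space)
  ultimately show ?thesis unfolding H Z_def by simp
qed simp

lemma rel_entropy_nonneg:
  fixes \<nu> \<zeta> :: "'a::topological_space measure"
  assumes "\<nu> \<in> M1" "\<zeta> \<in> M1" shows "0 \<le> rel_entropy \<nu> \<zeta>"
proof -
  interpret prob_space \<zeta> by (rule M1_prob[OF assms(2)])
  show ?thesis using donsker_varadhan_le[OF assms Cb_const[of 0]] by (simp add: prob_space zero_ereal_def[symmetric])
qed

text \<open>Null sets and truncated log-densities have to be tested with discontinuous functions.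
  The inequality passes to them by approximation in mean under \<nu> and \<zeta> simultaneously,
  within fixed bounds.\<close>

lemma donsker_varadhan_bounded_measurable:
  fixes \<nu> \<zeta> :: "'a::polish_space measure"
  assumes \<nu>: "\<nu> \<in> M1" and \<zeta>: "\<zeta> \<in> M1"
    and le: "\<And>f. f \<in> Cb \<Longrightarrow> (\<integral>x. f x \<partial>\<nu>) \<le> c + ln (\<integral>x. exp (f x) \<partial>\<zeta>)"
    and g: "g \<in> borel_measurable borel" and B: "\<And>x. \<bar>g x\<bar> \<le> B"
  shows "(\<integral>x. g x \<partial>\<nu>) \<le> c + ln (\<integral>x. exp (g x) \<partial>\<zeta>)"
proof -
  interpret \<zeta>: prob_space \<zeta> by (rule M1_prob[OF \<zeta>])
  interpret \<nu>: prob_space \<nu> by (rule M1_prob[OF \<nu>])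
  have gm: "g \<in> borel_measurable \<nu>" "g \<in> borel_measurable \<zeta>"
    unfolding measurable_cong_sets[OF M1_sets[OF \<zeta>] refl] measurable_cong_sets[OF M1_sets[OF \<nu>] refl]
    by (fact g)+
  have gi: "integrable \<nu> g" by (rule bounded_integrable[OF \<nu>.finite_measure_axioms gm(1) B])
  have gb: "- B \<le> g x" "g x \<le> B" for x using B[of x] by linarith+
  have ei: "integrable \<zeta> (\<lambda>x. exp (g x))"
    using gm gb by (intro bounded_integrable[where B="exp B"]) (auto intro: \<zeta>.finite_measure_axioms)
  define Z where "Z = (\<integral>x. exp (g x) \<partial>\<zeta>)"
  have Z: "Z > 0"
  proof -
    have "exp (-B) \<le> Z" unfolding Z_def using ei gb by (intro \<zeta>.integral_ge_const) auto
    then show ?thesis using exp_gt_zero[of "-B"] by linarith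
  qed
  have "B \<ge> 0" using B[of undefined] by linarith
  \<comment> \<open>Enlarged by 1 so that the interval from -C to C is nondegenerate even for B = 0,
    as \<open>approx_continuous\<close> requires.\<close>
  define C where "C = B + 1"
  have gC: "- C \<le> g x" "g x \<le> C" for x using gb[of x] by (auto simp: C_def)
  have *: "(\<integral>x. g x \<partial>\<nu>) \<le> c + ln (Z + exp C * \<delta>) + \<delta>" if \<delta>: "\<delta> > 0" for \<delta>
  proof -
    obtain k where k: "continuous_on UNIV k" "\<And>x. - C \<le> k x" "\<And>x. k x \<le> C"
      "(\<integral>x. \<bar>k x - g x\<bar> \<partial>\<nu>) < \<delta>" "(\<integral>x. \<bar>k x - g x\<bar> \<partial>\<zeta>) < \<delta>"
      using approx_continuous[OF \<nu>.finite_measure_axioms M1_sets[OF \<nu>] \<zeta>.finite_measure_axioms M1_sets[OF \<zeta>] g gC _ \<delta>]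
        \<open>B \<ge> 0\<close> by (auto simp: C_def)
    have kC: "k \<in> Cb" using k by (intro CbI[where B=C]) (auto simp: abs_le_iff minus_le_iff)
    have ki: "integrable \<nu> k" "integrable \<zeta> k" by (intro Cb_integrable_M1 kC \<nu> \<zeta>)+
    have gi': "integrable \<zeta> g" by (rule bounded_integrable[OF \<zeta>.finite_measure_axioms gm(2) B])
    have eki: "integrable \<zeta> (\<lambda>x. exp (k x))" by (intro Cb_integrable_M1 Cb_exp kC \<zeta>)
    have "(\<integral>x. g x \<partial>\<nu>) - (\<integral>x. k x \<partial>\<nu>) = (\<integral>x. g x - k x \<partial>\<nu>)" using gi ki by simp
    also have "\<dots> \<le> (\<integral>x. \<bar>k x - g x\<bar> \<partial>\<nu>)" using gi ki by (intro integral_mono) auto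
    finally have 1: "(\<integral>x. g x \<partial>\<nu>) \<le> (\<integral>x. k x \<partial>\<nu>) + \<delta>" using k(4) by linarith
    have "(\<integral>x. exp (k x) \<partial>\<zeta>) - Z = (\<integral>x. exp (k x) - exp (g x) \<partial>\<zeta>)" using eki ei by (simp add: Z_def)
    also have "\<dots> \<le> (\<integral>x. exp C * \<bar>k x - g x\<bar> \<partial>\<zeta>)"
    proof (rule integral_mono)
      fix x
      \<comment> \<open>The tangent bound 1 - e^t \<le> -t turns the error of k in mean into an
        error of its exponential moment. Only this direction matters, as ln is increasing.\<close>
      have "exp (k x) - exp (g x) = exp (k x) * (1 - exp (g x - k x))" by (simp add: right_diff_distrib exp_diff)
      also have "\<dots> \<le> exp (k x) * \<bar>k x - g x\<bar>"
      proof (intro mult_left_mono)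
        show "1 - exp (g x - k x) \<le> \<bar>k x - g x\<bar>" using exp_ge_add_one_self[of "g x - k x"] by linarith
      qed simp
      also have "\<dots> \<le> exp C * \<bar>k x - g x\<bar>" using k(3) by (intro mult_right_mono) auto
      finally show "exp (k x) - exp (g x) \<le> exp C * \<bar>k x - g x\<bar>" .
    qed (use eki ei ki gi' in auto)
    also have "\<dots> \<le> exp C * \<delta>" using k(5) by simp
    finally have "(\<integral>x. exp (k x) \<partial>\<zeta>) \<le> Z + exp C * \<delta>" by linarith
    then have "ln (\<integral>x. exp (k x) \<partial>\<zeta>) \<le> ln (Z + exp C * \<delta>)"
      using integral_exp_pos[OF kC \<zeta>] by (subst ln_le_cancel_iff) auto
    then show ?thesis using le[OF kC] 1 by linarith
  qed
  have "(\<lambda>n. c + ln (Z + exp C * inverse (real (Suc n))) + inverse (real (Suc n)))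
      \<longlonglongrightarrow> c + ln (Z + exp C * 0) + 0"
    using Z by (intro tendsto_intros LIMSEQ_inverse_real_of_nat) auto
  then have "(\<integral>x. g x \<partial>\<nu>) \<le> c + ln (Z + exp C * 0) + 0"
    by (rule LIMSEQ_le_const) (use * in \<open>auto simp del: of_nat_Suc\<close>)
  then show ?thesis by (simp add: Z_def)
qed

text \<open>Converse of the variational inequality. Large multiples of the indicator of a
  \<zeta>-null set give absolute continuity; truncations of ln h, whose exponentials have
  \<zeta>-integral close to 1, give the bound in the limit.\<close>

theorem rel_entropy_leI:
  fixes \<nu> \<zeta> :: "'a::polish_space measure"
  assumes \<nu>: "\<nu> \<in> M1" and \<zeta>: "\<zeta> \<in> M1"
    and le: "\<And>f. f \<in> Cb \<Longrightarrow> (\<integral>x. f x \<partial>\<nu>) \<le> c + ln (\<integral>x. exp (f x) \<partial>\<zeta>)"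
  shows "rel_entropy \<nu> \<zeta> \<le> ereal c"
proof -
  interpret \<zeta>: prob_space \<zeta> by (rule M1_prob[OF \<zeta>])
  interpret \<nu>: prob_space \<nu> by (rule M1_prob[OF \<nu>])
  note bdd = donsker_varadhan_bounded_measurable[OF \<nu> \<zeta> le]
  have "c \<ge> 0" using le[OF Cb_const[of 0]] by (simp add: \<zeta>.prob_space)
  have ac: "absolutely_continuous \<zeta> \<nu>"
    unfolding absolutely_continuous_def
  proof
    fix A assume A: "A \<in> null_sets \<zeta>"
    then have Ab: "A \<in> sets borel" using M1_sets[OF \<zeta>] by (auto simp: null_sets_def)
    then have A\<nu>: "A \<in> sets \<nu>" using M1_sets[OF \<nu>] by simp
    have "measure \<nu> A = 0"
    proof (rule ccontr)
      assume "measure \<nu> A \<noteq> 0"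
      then have p: "measure \<nu> A > 0" by (simp add: zero_less_measure_iff)
      \<comment> \<open>The function t times the indicator has exponential moment 1 under \<zeta>,
        so t \<nu>(A) \<le> c; this t makes the left side c + 1.\<close>
      define t where "t = (c + 1) / measure \<nu> A"
      have t: "t > 0" using p \<open>c \<ge> 0\<close> by (simp add: t_def)
      have ae: "AE x in \<zeta>. exp (t * indicator A x) = (1::real)"
        using AE_not_in[OF A] by eventually_elim simp
      have "(\<integral>x. t * indicator A x \<partial>\<nu>) \<le> c + ln (\<integral>x. exp (t * indicator A x) \<partial>\<zeta>)"
        using Ab t by (intro bdd[where B=t]) (auto simp: indicator_def)
      also have "(\<integral>x. exp (t * indicator A x) \<partial>\<zeta>) = (\<integral>x. 1 \<partial>\<zeta>)"
        using ae A by (intro integral_cong_AE) (auto simp: null_sets_def)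
      finally have "t * measure \<nu> A \<le> c" using A\<nu> by (simp add: \<zeta>.prob_space)
      then show False using p by (simp add: t_def)
    qed
    then show "A \<in> null_sets \<nu>" using A\<nu> by (auto simp: null_sets_def \<nu>.emeasure_eq_measure)
  qed
  obtain h :: "'a \<Rightarrow> real" where h: "h \<in> borel_measurable borel" "\<And>x. 0 \<le> h x"
    "\<nu> = density \<zeta> (\<lambda>x. ennreal (h x))" "\<And>x. entropy_density (exp 1) \<zeta> \<nu> x = ln (h x)"
    using absolutely_continuous_densityE[OF \<nu> \<zeta> ac] by blast
  note [measurable] = h(1)
  have hi: "integrable \<zeta> h" "(\<integral>x. h x \<partial>\<zeta>) = 1"
    using integral_density_M1[OF \<zeta> h(1-3), of "\<lambda>_. 1"] by (simp_all add: \<nu>.prob_space)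
  have hm[measurable]: "h \<in> borel_measurable \<nu>"
    unfolding measurable_cong_sets[OF M1_sets[OF \<nu>] refl] by (rule h)
  have pos: "AE x in \<nu>. h x > 0"
  proof -
    have "AE x in \<zeta>. 0 < ennreal (h x) \<longrightarrow> h x > 0" by (simp add: ennreal_less_zero_iff)
    moreover have "(\<lambda>x. ennreal (h x)) \<in> borel_measurable \<zeta>"
      unfolding measurable_cong_sets[OF M1_sets[OF \<zeta>] refl] by measurable
    ultimately show ?thesis by (subst h(3)) (simp add: AE_density)
  qed
  define N where "N n = real (Suc n)" for n
  have N: "N n \<ge> 1" for n by (simp add: N_def)
  \<comment> \<open>Clipping h to the interval from 1/N to N makes the logarithm bounded. Raising
    the small values adds at most 1/N to the exponential moment, which is the error term in
    \<open>gle\<close>.\<close>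
  define g where "g n x = ln (max (1 / N n) (min (N n) (h x)))" for n x
  have clip: "1 / N n \<le> max (1 / N n) (min (N n) y)" "max (1 / N n) (min (N n) y) \<le> N n" for n y
  proof -
    have "1 / N n \<le> 1" using N[of n] by simp
    then have "1 / N n \<le> N n" using N[of n] by linarith
    then show "max (1 / N n) (min (N n) y) \<le> N n" by simp
  qed simp
  have lnN: "ln (1 / N n) = - ln (N n)" for n using N[of n] by (simp add: ln_div)
  have lnN0: "0 \<le> ln (N n)" for n using N[of n] by simp
  have clip0: "0 < max (1 / N n) (min (N n) y)" for n y
  proof -
    have "0 < 1 / N n" using N[of n] by simp
    then show ?thesis using clip(1)[of n y] by linarith
  qed
  have gb: "\<bar>g n x\<bar> \<le> ln (N n)" for n x
  proof -
    have "ln (1 / N n) \<le> g n x" unfolding g_def using clip(1) clip0 N[of n] by (subst ln_le_cancel_iff) auto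
    moreover have "g n x \<le> ln (N n)" unfolding g_def using clip(2) clip0 N[of n] by (subst ln_le_cancel_iff) auto
    ultimately show ?thesis using lnN[of n] by linarith
  qed
  have gm: "g n \<in> borel_measurable borel" for n unfolding g_def by measurable
  have g\<nu>: "g n \<in> borel_measurable \<nu>" for n
    unfolding measurable_cong_sets[OF M1_sets[OF \<nu>] refl] by (rule gm)
  have gi: "integrable \<nu> (g n)" for n
    by (rule bounded_integrable[OF \<nu>.finite_measure_axioms g\<nu> gb])
  have gle: "(\<integral>x. g n x \<partial>\<nu>) \<le> c + 1 / N n" for n
  proof -
    have *: "exp (g n x) = max (1 / N n) (min (N n) (h x))" for x
      unfolding g_def using clip0 by simp
    have "(\<integral>x. exp (g n x) \<partial>\<zeta>) \<le> (\<integral>x. 1 / N n + h x \<partial>\<zeta>)"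
    proof (rule integral_mono)
      have "(\<lambda>x. exp (g n x)) \<in> borel_measurable \<zeta>"
        unfolding measurable_cong_sets[OF M1_sets[OF \<zeta>] refl] using gm by measurable
      then show "integrable \<zeta> (\<lambda>x. exp (g n x))"
      proof (rule bounded_integrable[OF \<zeta>.finite_measure_axioms])
        show "\<bar>exp (g n x)\<bar> \<le> N n" for x unfolding * using clip clip0[of n "h x"] by simp
      qed
      show "exp (g n x) \<le> 1 / N n + h x" for x
      proof -
        have "0 \<le> 1 / N n" using N[of n] by simp
        then show ?thesis unfolding * using h(2)[of x] min.cobounded2[of "N n" "h x"]
          by (intro max.boundedI) linarith+
      qed
    qed (use hi in auto)
    also have "\<dots> = 1 + 1 / N n" using hi by (simp add: \<zeta>.prob_space)
    finally have le1: "(\<integral>x. exp (g n x) \<partial>\<zeta>) \<le> 1 + 1 / N n" .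
    have p: "0 < (\<integral>x. exp (g n x) \<partial>\<zeta>)"
    proof -
      have m: "(\<lambda>x. exp (g n x)) \<in> borel_measurable \<zeta>"
        unfolding measurable_cong_sets[OF M1_sets[OF \<zeta>] refl] using gm by measurable
      have i: "integrable \<zeta> (\<lambda>x. exp (g n x))"
      proof (rule bounded_integrable[OF \<zeta>.finite_measure_axioms m])
        show "\<bar>exp (g n x)\<bar> \<le> N n" for x unfolding * using clip clip0[of n "h x"] by simp
      qed
      have "1 / N n \<le> (\<integral>x. exp (g n x) \<partial>\<zeta>)"
        using i clip unfolding * by (intro \<zeta>.integral_ge_const) auto
      moreover have "0 < 1 / N n" using N[of n] by simp
      ultimately show ?thesis by linarith
    qed
    have "(\<integral>x. g n x \<partial>\<nu>) \<le> c + ln (\<integral>x. exp (g n x) \<partial>\<zeta>)" by (rule bdd[OF _ gm gb])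
    also have "ln (\<integral>x. exp (g n x) \<partial>\<zeta>) \<le> (\<integral>x. exp (g n x) \<partial>\<zeta>) - 1" using p by (rule ln_le_minus_one)
    also have "\<dots> \<le> 1 / N n" using le1 by simp
    finally show ?thesis by simp
  qed
  have Nlim: "(\<lambda>n. 1 / N n) \<longlonglongrightarrow> 0"
    using LIMSEQ_inverse_real_of_nat by (simp add: N_def inverse_eq_divide)
  have glim: "(\<lambda>n. g n x) \<longlonglongrightarrow> ln (h x)" if "h x > 0" for x
  proof -
    have "\<forall>\<^sub>F n in sequentially. 1 / N n < h x" using Nlim that by (rule order_tendstoD)
    moreover have "\<forall>\<^sub>F n in sequentially. h x < N n"
      using filterlim_at_top_dense[THEN iffD1, OF filterlim_real_sequentially, rule_format, of "h x"]
      by eventually_elim (simp add: N_def)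
    ultimately have "\<forall>\<^sub>F n in sequentially. g n x = ln (h x)"
      by eventually_elim (simp add: g_def)
    then show ?thesis by (rule tendsto_eventually)
  qed
  \<comment> \<open>The clipping interval contains 1, so clipping moves ln h towards 0; this
    provides the dominating function.\<close>
  have gabs: "\<bar>g n x\<bar> \<le> \<bar>ln (h x)\<bar>" if "h x > 0" for n x
  proof -
    consider "h x < 1 / N n" | "1 / N n \<le> h x" "h x \<le> N n" | "N n < h x" by linarith
    then show ?thesis
    proof cases
      case 1
      then have "max (1 / N n) (min (N n) (h x)) = 1 / N n" by simp
      moreover have "ln (h x) \<le> ln (1 / N n)" using 1 that N[of n] by (subst ln_le_cancel_iff) auto
      ultimately show ?thesis unfolding g_def using lnN[of n] lnN0[of n] by simp
    next
      case 2 then show ?thesis by (simp add: g_def)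
    next
      case 3
      then have "max (1 / N n) (min (N n) (h x)) = N n" using clip[of n "h x"] by linarith
      moreover have "ln (N n) \<le> ln (h x)" using 3 N[of n] that by (subst ln_le_cancel_iff) auto
      ultimately show ?thesis unfolding g_def using lnN0[of n] by simp
    qed
  qed
  define q where "q = (\<integral>\<^sup>+x. ennreal (- ln (h x)) \<partial>\<nu>)"
  have q: "q \<le> 1" unfolding q_def by (rule neg_part_entropy_le[OF \<zeta> h(1-3)])
  \<comment> \<open>Integrability of ln h is not known yet. The negative parts of the truncations
    are bounded by that of ln h, hence by 1, so the bound c + 1/N on the integrals bounds the
    positive parts by c + 2 uniformly, and Fatou's lemma passes this on to ln h.\<close>
  have gq: "(\<integral>\<^sup>+x. ennreal (g n x) \<partial>\<nu>) \<le> ennreal (c + 2)" for n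
  proof -
    have "(\<integral>\<^sup>+x. ennreal (- g n x) \<partial>\<nu>) \<le> q" unfolding q_def
    proof (rule nn_integral_mono_AE, use pos in eventually_elim)
      case (elim x)
      show "ennreal (- g n x) \<le> ennreal (- ln (h x))"
      proof (cases "h x \<ge> 1")
        case True
        have "1 / N n \<le> 1" using N[of n] by simp
        then have "1 \<le> max (1 / N n) (min (N n) (h x))" using True N[of n] by simp
        then have "0 \<le> g n x" unfolding g_def by simp
        then show ?thesis by (simp add: ennreal_neg)
      next
        case False
        then have "ln (h x) \<le> 0" using elim by simp
        then have "- g n x \<le> - ln (h x)" using gabs[OF elim, of n] by linarith
        then show ?thesis by (rule ennreal_leI)
      qed
    qed
    then have n1: "(\<integral>\<^sup>+x. ennreal (- g n x) \<partial>\<nu>) \<le> 1" using q by (rule order_trans)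
    have eq: "(\<integral>x. g n x \<partial>\<nu>) = enn2real (\<integral>\<^sup>+x. ennreal (g n x) \<partial>\<nu>) - enn2real (\<integral>\<^sup>+x. ennreal (- g n x) \<partial>\<nu>)"
      by (rule real_lebesgue_integral_def[OF gi])
    have "enn2real (\<integral>\<^sup>+x. ennreal (- g n x) \<partial>\<nu>) \<le> 1"
      using n1 by (simp add: enn2real_leI)
    moreover have "1 / N n \<le> 1" using N[of n] by simp
    ultimately have "enn2real (\<integral>\<^sup>+x. ennreal (g n x) \<partial>\<nu>) \<le> c + 2" using eq gle[of n] by linarith
    moreover have "(\<integral>\<^sup>+x. ennreal (g n x) \<partial>\<nu>) \<noteq> \<infinity>" using gi[of n] by (simp add: real_integrable_def)
    ultimately show ?thesis
      by (metis ennreal_enn2real ennreal_leI infinity_ennreal_def top.not_eq_extremum)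
  qed
  have p: "(\<integral>\<^sup>+x. ennreal (ln (h x)) \<partial>\<nu>) \<le> ennreal (c + 2)"
  proof -
    have "(\<integral>\<^sup>+x. ennreal (ln (h x)) \<partial>\<nu>) = (\<integral>\<^sup>+x. liminf (\<lambda>n. ennreal (g n x)) \<partial>\<nu>)"
    proof (rule nn_integral_cong_AE, use pos in eventually_elim)
      case (elim x)
      have "(\<lambda>n. ennreal (g n x)) \<longlonglongrightarrow> ennreal (ln (h x))"
        by (intro tendsto_ennrealI glim elim)
      then show ?case by (simp add: lim_imp_Liminf)
    qed
    also have "\<dots> \<le> liminf (\<lambda>n. \<integral>\<^sup>+x. ennreal (g n x) \<partial>\<nu>)"
      using g\<nu> by (intro nn_integral_liminf) simp
    also have "\<dots> \<le> ennreal (c + 2)"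
      using gq by (intro Liminf_le) auto
    finally show ?thesis .
  qed
  have lm[measurable]: "(\<lambda>x. ln (h x)) \<in> borel_measurable \<nu>" by measurable
  have "(\<integral>\<^sup>+x. ennreal (ln (h x)) \<partial>\<nu>) \<noteq> \<infinity>" "q \<noteq> \<infinity>"
    using p q by (auto simp: top_unique)
  then have int: "integrable \<nu> (\<lambda>x. ln (h x))"
    unfolding real_integrable_def q_def using lm by simp
  have "(\<lambda>n. \<integral>x. g n x \<partial>\<nu>) \<longlonglongrightarrow> (\<integral>x. ln (h x) \<partial>\<nu>)"
  proof (rule integral_dominated_convergence[where w="\<lambda>x. \<bar>ln (h x)\<bar>"])
    show "AE x in \<nu>. (\<lambda>n. g n x) \<longlonglongrightarrow> ln (h x)" using pos by eventually_elim (rule glim)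
    show "AE x in \<nu>. norm (g n x) \<le> \<bar>ln (h x)\<bar>" for n using pos by eventually_elim (use gabs in simp)
  qed (use int g\<nu> in simp_all)
  moreover have "(\<lambda>n. c + 1 / N n) \<longlonglongrightarrow> c + 0" by (intro tendsto_intros Nlim)
  ultimately have le': "(\<integral>x. ln (h x) \<partial>\<nu>) \<le> c + 0"
    by (rule LIMSEQ_le) (use gle in auto)
  have "rel_entropy \<nu> \<zeta> = ereal (\<integral>x. ln (h x) \<partial>\<nu>)"
  proof -
    have "rel_entropy \<nu> \<zeta> = enn2ereal (\<integral>\<^sup>+x. ennreal (ln (h x)) \<partial>\<nu>) - enn2ereal q"
      using ac by (simp add: rel_entropy_def q_def h(4))
    also have "\<dots> = ereal (\<integral>x. ln (h x) \<partial>\<nu>)"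
      unfolding real_lebesgue_integral_def[OF int] q_def[symmetric]
      using \<open>(\<integral>\<^sup>+x. ennreal (ln (h x)) \<partial>\<nu>) \<noteq> \<infinity>\<close> \<open>q \<noteq> \<infinity>\<close>
      by (cases "\<integral>\<^sup>+x. ennreal (ln (h x)) \<partial>\<nu>"; cases q) auto
    finally show ?thesis .
  qed
  then show ?thesis using le' by simp
qed

section \<open>Functionals dominated by an exponential moment are measures\<close>

text \<open>This is e^(-u) \<ge> 1 - u multiplied by e^u. It controls an exponential moment by a
  first moment in \<open>small\<close>.\<close>

lemma exp_le_one_plus: "exp (u::real) \<le> 1 + u * exp u"
proof -
  have "exp u * (1 - u) \<le> exp u * exp (- u)"
    using exp_ge_add_one_self[of "-u"] by (intro mult_left_mono) auto
  then show ?thesis by (simp add: right_diff_distrib mult.commute flip: exp_add)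
qed

text \<open>Turns the one-sided nonlinear bound on a linear functional into exact relations: scaling
  the test function by t leaves the constant c unchanged.\<close>

lemma bounded_multiples_nonpos:
  fixes y c :: real assumes "\<And>t. t > 0 \<Longrightarrow> t * y \<le> c" shows "y \<le> 0"
proof (rule ccontr)
  assume "\<not> y \<le> 0"
  then have y: "y > 0" by simp
  have "(\<bar>c\<bar> + 1) / y * y \<le> c" using y by (intro assms) simp
  then show False using y by simp
qed

text \<open>The assumption \<open>bound\<close> is the variational inequality of relative entropy,
  imposed on a functional that a priori could be a merely finitely additive mean.\<close>

locale entropic_functional =
  fixes \<zeta> :: "'a::polish_space measure" and L :: "('a \<Rightarrow> real) \<Rightarrow> real" and c :: real
  assumes \<zeta>: "\<zeta> \<in> M1"
    and add: "\<And>f g. f \<in> Cb \<Longrightarrow> g \<in> Cb \<Longrightarrow> L (\<lambda>x. f x + g x) = L f + L g"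
    and scale: "\<And>a f. f \<in> Cb \<Longrightarrow> L (\<lambda>x. a * f x) = a * L f"
    and bound: "\<And>f. f \<in> Cb \<Longrightarrow> L f \<le> c + ln (\<integral>x. exp (f x) \<partial>\<zeta>)"
begin

sublocale \<zeta>: prob_space \<zeta> by (rule M1_prob[OF \<zeta>])

lemma measurable_\<zeta>: "f \<in> borel_measurable borel \<Longrightarrow> f \<in> borel_measurable \<zeta>"
  unfolding measurable_cong_sets[OF M1_sets[OF \<zeta>] refl] .

lemma diff: "f \<in> Cb \<Longrightarrow> g \<in> Cb \<Longrightarrow> L (\<lambda>x. f x - g x) = L f - L g"
  using add[of f "\<lambda>x. (-1) * g x"] scale[of g "-1"] Cb_scale[of g "-1"] by simp

lemma sum: "finite S \<Longrightarrow> (\<And>i. i \<in> S \<Longrightarrow> f i \<in> Cb) \<Longrightarrow> L (\<lambda>x. \<Sum>i\<in>S. f i x) = (\<Sum>i\<in>S. L (f i))"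
proof (induction S rule: finite_induct)
  case empty then show ?case using scale[OF Cb_const[of 0], of 0] by simp
next
  case (insert i S)
  then show ?case using add[of "f i" "\<lambda>x. \<Sum>i\<in>S. f i x"] Cb_sum[of S f] by simp
qed

text \<open>Test with -t f: its exponential moment is at most 1, so -t L f \<le> c for every t >
  0.\<close>

lemma nonneg:
  assumes f: "f \<in> Cb" and "\<And>x. 0 \<le> f x" shows "0 \<le> L f"
proof -
  have "- L f \<le> 0"
  proof (rule bounded_multiples_nonpos)
    fix t :: real assume t: "t > 0"
    have f': "(\<lambda>x. (-t) * f x) \<in> Cb" by (rule Cb_scale[OF f])
    have "t * - L f = L (\<lambda>x. (-t) * f x)" using scale[OF f, of "- t"] by simp
    also have "\<dots> \<le> c + ln (\<integral>x. exp ((-t) * f x) \<partial>\<zeta>)" by (rule bound[OF f'])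
    also have "(\<integral>x. exp ((-t) * f x) \<partial>\<zeta>) \<le> (\<integral>x. 1 \<partial>\<zeta>)"
    proof (rule integral_mono)
      show "exp ((-t) * f x) \<le> 1" for x using t assms(2)[of x] by simp
    qed (use Cb_integrable_M1[OF Cb_exp[OF f'] \<zeta>] in auto)
    then have "ln (\<integral>x. exp ((-t) * f x) \<partial>\<zeta>) \<le> 0"
      using integral_exp_pos[OF f' \<zeta>] by (simp add: \<zeta>.prob_space)
    finally show "t * - L f \<le> c" by simp
  qed
  then show ?thesis by simp
qed

text \<open>For a constant t the logarithm of the moment is exactly t. So t (L 1 - 1) \<le> c for
  all real t, of either sign.\<close>

lemma const: "L (\<lambda>_. a) = a"
proof -
  have *: "t * (L (\<lambda>_. 1) - 1) \<le> c" for t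
    using bound[OF Cb_const[of t]] scale[OF Cb_const[of 1], of t]
    by (simp add: \<zeta>.prob_space right_diff_distrib)
  have "L (\<lambda>_. 1) - 1 \<le> 0" by (rule bounded_multiples_nonpos[OF *])
  moreover have "- (L (\<lambda>_. 1) - 1) \<le> 0"
    by (rule bounded_multiples_nonpos[where c=c]) (use *[of "- t" for t] in \<open>simp add: right_diff_distrib\<close>)
  ultimately have "L (\<lambda>_. 1) = 1" by linarith
  then show ?thesis using scale[OF Cb_const[of 1], of a] by simp
qed

lemma mono: "f \<in> Cb \<Longrightarrow> g \<in> Cb \<Longrightarrow> (\<And>x. f x \<le> g x) \<Longrightarrow> L f \<le> L g"
  using nonneg[of "\<lambda>x. g x - f x"] diff[of g f] Cb_diff[of g f] by simp

lemma abs_diff_le: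
  assumes f: "f \<in> Cb" and g: "g \<in> Cb" shows "\<bar>L f - L g\<bar> \<le> L (\<lambda>x. \<bar>f x - g x\<bar>)"
proof -
  have d: "(\<lambda>x. f x - g x) \<in> Cb" "(\<lambda>x. g x - f x) \<in> Cb" by (intro Cb_diff f g)+
  have a: "(\<lambda>x. \<bar>f x - g x\<bar>) \<in> Cb" by (rule Cb_abs[OF d(1)])
  have "L (\<lambda>x. f x - g x) \<le> L (\<lambda>x. \<bar>f x - g x\<bar>)" "L (\<lambda>x. g x - f x) \<le> L (\<lambda>x. \<bar>f x - g x\<bar>)"
    by (intro mono d a; simp)+
  then show ?thesis using diff[OF f g] diff[OF g f] by simp
qed

lemma c_nonneg: "0 \<le> c"
  using bound[OF Cb_const[of 0]] const[of 0] by (simp add: \<zeta>.prob_space)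

text \<open>The exponential moment bound makes \<open>L\<close> uniformly continuous in mean on $[0,1]$-valued
  functions. So \<open>L\<close> extends to indicator functions by approximation in $L^1(\zeta)$, and the extension
  is countably additive because it is small on sets of small \<open>\<zeta>\<close>-measure.\<close>

lemma small:
  assumes \<epsilon>: "\<epsilon> > 0"
  obtains \<delta> where "\<delta> > 0"
    "\<And>f. f \<in> Cb \<Longrightarrow> (\<And>x. 0 \<le> f x) \<Longrightarrow> (\<And>x. f x \<le> 1) \<Longrightarrow> (\<integral>x. f x \<partial>\<zeta>) < \<delta> \<Longrightarrow> L f < \<epsilon>"
proof -
  define e where "e = \<epsilon> / 2"
  have e: "e > 0" "e < \<epsilon>" using \<epsilon> by (simp_all add: e_def)
  have c1: "c + 1 > 0" using c_nonneg by linarith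
  \<comment> \<open>This t gives (c + 1) / t = e, and \<delta> makes t e^t \<delta> equal to 1, so
    the exponential moment of t f stays below 2 and its logarithm below 1.\<close>
  define t where "t = (c + 1) / e"
  have t: "t > 0" using e c1 by (simp add: t_def)
  define \<delta> where "\<delta> = 1 / (t * exp t)"
  have \<delta>: "\<delta> > 0" using t by (simp add: \<delta>_def)
  show ?thesis
  proof (rule that[OF \<delta>])
    fix f :: "'a \<Rightarrow> real"
    assume f: "f \<in> Cb" and f0: "\<And>x. 0 \<le> f x" and f1: "\<And>x. f x \<le> 1" and fd: "(\<integral>x. f x \<partial>\<zeta>) < \<delta>"
    have f': "(\<lambda>x. t * f x) \<in> Cb" by (rule Cb_scale[OF f])
    have "(\<integral>x. exp (t * f x) \<partial>\<zeta>) \<le> (\<integral>x. 1 + (t * exp t) * f x \<partial>\<zeta>)"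
    proof (rule integral_mono)
      show "exp (t * f x) \<le> 1 + (t * exp t) * f x" for x
      proof -
        have "t * f x * exp (t * f x) \<le> t * f x * exp t"
          using t f0[of x] f1[of x] by (intro mult_left_mono) (auto simp: mult_left_le)
        then show ?thesis using exp_le_one_plus[of "t * f x"] by (simp add: mult_ac)
      qed
    qed (use Cb_integrable_M1[OF Cb_exp[OF f'] \<zeta>] Cb_integrable_M1[OF f \<zeta>] in auto)
    also have "\<dots> = 1 + (t * exp t) * (\<integral>x. f x \<partial>\<zeta>)"
      using Cb_integrable_M1[OF f \<zeta>] by (simp add: \<zeta>.prob_space)
    also have "\<dots> < 1 + (t * exp t) * \<delta>" using fd t by simp
    also have "\<dots> = 2" using t by (simp add: \<delta>_def)
    finally have "ln (\<integral>x. exp (t * f x) \<partial>\<zeta>) < 1"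
      using ln_le_minus_one[OF integral_exp_pos[OF f' \<zeta>]] by linarith
    then have "t * L f < c + 1" using bound[OF f'] scale[OF f, of t] by simp
    then have "L f < (c + 1) / t" using t by (simp add: pos_less_divide_eq mult.commute)
    also have "\<dots> = e" using e c1 by (simp add: t_def)
    finally show "L f < \<epsilon>" using e by simp
  qed
qed

definition unit :: "('a \<Rightarrow> real) \<Rightarrow> bool" where
  "unit f \<longleftrightarrow> f \<in> Cb \<and> (\<forall>x. 0 \<le> f x \<and> f x \<le> 1)"

lemma unitD: "unit f \<Longrightarrow> f \<in> Cb" "unit f \<Longrightarrow> 0 \<le> f x" "unit f \<Longrightarrow> f x \<le> 1"
  by (auto simp: unit_def)

lemma unit_abs_diff: "unit f \<Longrightarrow> unit g \<Longrightarrow> unit (\<lambda>x. \<bar>f x - g x\<bar>)"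
  unfolding unit_def
proof (intro conjI allI)
  fix x assume "f \<in> Cb \<and> (\<forall>x. 0 \<le> f x \<and> f x \<le> 1)" "g \<in> Cb \<and> (\<forall>x. 0 \<le> g x \<and> g x \<le> 1)"
  then have "0 \<le> f x" "f x \<le> 1" "0 \<le> g x" "g x \<le> 1" by blast+
  then show "\<bar>f x - g x\<bar> \<le> 1" by linarith
qed (auto intro!: Cb_abs Cb_diff)

lemma dist_small:
  assumes \<epsilon>: "\<epsilon> > 0"
  obtains \<delta> where "\<delta> > 0"
    "\<And>f g. unit f \<Longrightarrow> unit g \<Longrightarrow> (\<integral>x. \<bar>f x - g x\<bar> \<partial>\<zeta>) < \<delta> \<Longrightarrow> \<bar>L f - L g\<bar> < \<epsilon>"
proof -
  obtain \<delta> where \<delta>: "\<delta> > 0" "\<And>f. f \<in> Cb \<Longrightarrow> (\<And>x. 0 \<le> f x) \<Longrightarrow> (\<And>x. f x \<le> 1) \<Longrightarrow> (\<integral>x. f x \<partial>\<zeta>) < \<delta> \<Longrightarrow> L f < \<epsilon>"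
    using small[OF \<epsilon>] by blast
  show ?thesis
  proof (rule that[OF \<delta>(1)])
    fix f g assume fg: "unit f" "unit g" "(\<integral>x. \<bar>f x - g x\<bar> \<partial>\<zeta>) < \<delta>"
    note u = unit_abs_diff[OF fg(1,2)]
    have "L (\<lambda>x. \<bar>f x - g x\<bar>) < \<epsilon>" by (rule \<delta>(2)[OF unitD(1)[OF u] unitD(2)[OF u] unitD(3)[OF u] fg(3)])
    then show "\<bar>L f - L g\<bar> < \<epsilon>" using abs_diff_le[OF unitD(1)[OF fg(1)] unitD(1)[OF fg(2)]] by linarith
  qed
qed

lemma L1_triangle:
  fixes f g h :: "'a \<Rightarrow> real"
  assumes m: "f \<in> borel_measurable borel" "g \<in> borel_measurable borel" "h \<in> borel_measurable borel"
    and b: "\<And>x. \<bar>f x\<bar> \<le> 1" "\<And>x. \<bar>g x\<bar> \<le> 1" "\<And>x. \<bar>h x\<bar> \<le> 1"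
  shows "(\<integral>x. \<bar>f x - h x\<bar> \<partial>\<zeta>) \<le> (\<integral>x. \<bar>f x - g x\<bar> \<partial>\<zeta>) + (\<integral>x. \<bar>g x - h x\<bar> \<partial>\<zeta>)"
proof -
  have i: "integrable \<zeta> f" "integrable \<zeta> g" "integrable \<zeta> h"
    by (rule bounded_integrable[OF \<zeta>.finite_measure_axioms measurable_\<zeta>], fact, fact)+
  have "(\<integral>x. \<bar>f x - h x\<bar> \<partial>\<zeta>) \<le> (\<integral>x. \<bar>f x - g x\<bar> + \<bar>g x - h x\<bar> \<partial>\<zeta>)"
    using i by (intro integral_mono) auto
  then show ?thesis using i by simp
qed

lemma unit_measurable: "unit f \<Longrightarrow> f \<in> borel_measurable borel"
  by (simp add: unit_def Cb_measurable)

lemma unit_abs: "unit f \<Longrightarrow> \<bar>f x\<bar> \<le> 1"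
  by (simp add: unit_def)

text \<open>An arbitrary choice for every A and j; by \<open>v_lim\<close> the limit of the L-values
  does not depend on it.\<close>

definition approx_ind :: "'a set \<Rightarrow> nat \<Rightarrow> 'a \<Rightarrow> real" where
  "approx_ind A j = (SOME k. unit k \<and> (\<integral>x. \<bar>k x - indicator A x\<bar> \<partial>\<zeta>) < inverse (real (Suc j)))"

lemma approx_ind:
  assumes A: "A \<in> sets borel"
  shows "unit (approx_ind A j)" "(\<integral>x. \<bar>approx_ind A j x - indicator A x\<bar> \<partial>\<zeta>) < inverse (real (Suc j))"
proof -
  obtain k where k: "continuous_on UNIV k" "\<And>x. 0 \<le> k x" "\<And>x. k x \<le> (1::real)"
      "(\<integral>x. \<bar>k x - indicator A x\<bar> \<partial>\<zeta>) < inverse (real (Suc j))"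
    using approx_indicator[OF \<zeta>.finite_measure_axioms M1_sets[OF \<zeta>] \<zeta>.finite_measure_axioms M1_sets[OF \<zeta>] A, of "inverse (real (Suc j))"]
    by auto
  have "k \<in> Cb" using k by (intro CbI[where B=1]) (auto simp: abs_of_nonneg)
  then have "\<exists>k. unit k \<and> (\<integral>x. \<bar>k x - indicator A x\<bar> \<partial>\<zeta>) < inverse (real (Suc j))"
    using k by (auto simp: unit_def)
  then have "unit (approx_ind A j) \<and> (\<integral>x. \<bar>approx_ind A j x - indicator A x\<bar> \<partial>\<zeta>) < inverse (real (Suc j))"
    unfolding approx_ind_def by (rule someI_ex)
  then show "unit (approx_ind A j)" "(\<integral>x. \<bar>approx_ind A j x - indicator A x\<bar> \<partial>\<zeta>) < inverse (real (Suc j))" by auto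
qed

lemma approx_ind_lim:
  assumes "A \<in> sets borel"
  shows "(\<lambda>j. \<integral>x. \<bar>approx_ind A j x - indicator A x\<bar> \<partial>\<zeta>) \<longlonglongrightarrow> 0"
  by (rule tendsto_sandwich[OF _ _ tendsto_const LIMSEQ_inverse_real_of_nat])
    (auto intro!: always_eventually less_imp_le approx_ind(2)[OF assms] simp del: of_nat_Suc)

definition v :: "'a set \<Rightarrow> real" where "v A = lim (\<lambda>j. L (approx_ind A j))"

text \<open>Two sequences approximating the same indicator in mean approximate each other, so by
  \<open>dist_small\<close> their L-values merge. With \<open>approx_ind\<close> in both places this
  is the Cauchy property that makes \<open>v\<close> a true limit.\<close>

lemma v_lim:
  assumes A: "A \<in> sets borel" and f: "\<And>j. unit (f j)"
    and lim: "(\<lambda>j. \<integral>x. \<bar>f j x - indicator A x\<bar> \<partial>\<zeta>) \<longlonglongrightarrow> 0"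
  shows "(\<lambda>j. L (f j)) \<longlonglongrightarrow> v A"
proof -
  have close: "\<exists>N. \<forall>i\<ge>N. \<forall>j\<ge>N. \<bar>L (g i) - L (k j)\<bar> < \<epsilon>"
    if g: "\<And>j. unit (g j)" "(\<lambda>j. \<integral>x. \<bar>g j x - indicator A x\<bar> \<partial>\<zeta>) \<longlonglongrightarrow> 0"
      and k: "\<And>j. unit (k j)" "(\<lambda>j. \<integral>x. \<bar>k j x - indicator A x\<bar> \<partial>\<zeta>) \<longlonglongrightarrow> 0"
      and \<epsilon>: "\<epsilon> > 0" for g k \<epsilon>
  proof -
    obtain \<delta> where \<delta>: "\<delta> > 0" "\<And>f g. unit f \<Longrightarrow> unit g \<Longrightarrow> (\<integral>x. \<bar>f x - g x\<bar> \<partial>\<zeta>) < \<delta> \<Longrightarrow> \<bar>L f - L g\<bar> < \<epsilon>"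
      using dist_small[OF \<epsilon>] by blast
    have "\<forall>\<^sub>F j in sequentially. (\<integral>x. \<bar>g j x - indicator A x\<bar> \<partial>\<zeta>) < \<delta>/2"
      using order_tendstoD(2)[OF g(2), of "\<delta>/2"] \<delta>(1) by simp
    moreover have "\<forall>\<^sub>F j in sequentially. (\<integral>x. \<bar>k j x - indicator A x\<bar> \<partial>\<zeta>) < \<delta>/2"
      using order_tendstoD(2)[OF k(2), of "\<delta>/2"] \<delta>(1) by simp
    ultimately have "\<forall>\<^sub>F j in sequentially. (\<integral>x. \<bar>g j x - indicator A x\<bar> \<partial>\<zeta>) < \<delta>/2 \<and> (\<integral>x. \<bar>k j x - indicator A x\<bar> \<partial>\<zeta>) < \<delta>/2"
      by (rule eventually_conj)
    then obtain N where N: "\<And>j. j \<ge> N \<Longrightarrow> (\<integral>x. \<bar>g j x - indicator A x\<bar> \<partial>\<zeta>) < \<delta>/2 \<and> (\<integral>x. \<bar>k j x - indicator A x\<bar> \<partial>\<zeta>) < \<delta>/2"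
      unfolding eventually_sequentially by blast
    have "\<bar>L (g i) - L (k j)\<bar> < \<epsilon>" if ij: "i \<ge> N" "j \<ge> N" for i j
    proof (rule \<delta>(2)[OF g(1) k(1)])
      have "(\<integral>x. \<bar>g i x - k j x\<bar> \<partial>\<zeta>) \<le> (\<integral>x. \<bar>g i x - indicator A x\<bar> \<partial>\<zeta>) + (\<integral>x. \<bar>indicator A x - k j x\<bar> \<partial>\<zeta>)"
        by (rule L1_triangle)
          (simp_all add: A unit_measurable[OF g(1)] unit_measurable[OF k(1)] unit_abs[OF g(1)] unit_abs[OF k(1)] borel_measurable_indicator[OF A])
      also have "(\<integral>x. \<bar>indicator A x - k j x\<bar> \<partial>\<zeta>) = (\<integral>x. \<bar>k j x - indicator A x\<bar> \<partial>\<zeta>)"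
        by (simp add: abs_minus_commute)
      finally show "(\<integral>x. \<bar>g i x - k j x\<bar> \<partial>\<zeta>) < \<delta>" using N[OF ij(1)] N[OF ij(2)] by linarith
    qed
    then show ?thesis by blast
  qed
  have "Cauchy (\<lambda>j. L (approx_ind A j))"
    unfolding Cauchy_def dist_real_def
    using close[of "approx_ind A" "approx_ind A", OF approx_ind(1)[OF A] approx_ind_lim[OF A] approx_ind(1)[OF A] approx_ind_lim[OF A]]
    by blast
  then have v: "(\<lambda>j. L (approx_ind A j)) \<longlonglongrightarrow> v A"
    unfolding v_def by (simp add: Cauchy_convergent_iff convergent_LIMSEQ_iff)
  have "(\<lambda>j. L (f j) - L (approx_ind A j)) \<longlonglongrightarrow> 0"
    unfolding LIMSEQ_def dist_real_def
    using close[of f "approx_ind A", OF f lim approx_ind(1)[OF A] approx_ind_lim[OF A]]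
    by (metis diff_zero)
  from tendsto_add[OF this v] show ?thesis by simp
qed

lemma v_nonneg: "A \<in> sets borel \<Longrightarrow> 0 \<le> v A"
  by (rule LIMSEQ_le_const[OF v_lim[OF _ approx_ind(1) approx_ind_lim]])
    (auto intro!: nonneg unitD[OF approx_ind(1)])

lemma v_const:
  assumes "\<And>x. indicator A x = (a::real)" "0 \<le> a" "a \<le> 1" "A \<in> sets borel" shows "v A = a"
proof -
  have "(\<lambda>j::nat. L (\<lambda>_. a)) \<longlonglongrightarrow> v A"
    using assms by (intro v_lim) (auto simp: unit_def Cb_const)
  then show ?thesis by (simp add: const LIMSEQ_const_iff)
qed

text \<open>Absolute continuity in \<epsilon>-\<delta> form. Through it, continuity at the empty set
  is inherited from the countably additive \<zeta>.\<close>

lemma v_small: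
  assumes \<epsilon>: "\<epsilon> > 0"
  obtains \<delta> where "\<delta> > 0" "\<And>A. A \<in> sets borel \<Longrightarrow> measure \<zeta> A < \<delta> \<Longrightarrow> v A \<le> \<epsilon>"
proof -
  obtain \<delta> where \<delta>: "\<delta> > 0" "\<And>f. f \<in> Cb \<Longrightarrow> (\<And>x. 0 \<le> f x) \<Longrightarrow> (\<And>x. f x \<le> 1) \<Longrightarrow> (\<integral>x. f x \<partial>\<zeta>) < \<delta> \<Longrightarrow> L f < \<epsilon>"
    using small[OF \<epsilon>] by blast
  show ?thesis
  proof (rule that[OF \<delta>(1)])
    fix A :: "'a set" assume A: "A \<in> sets borel" and m: "measure \<zeta> A < \<delta>"
    have As: "A \<in> sets \<zeta>" using A M1_sets[OF \<zeta>] by simp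
    have *: "(\<integral>x. approx_ind A j x \<partial>\<zeta>) \<le> (\<integral>x. \<bar>approx_ind A j x - indicator A x\<bar> \<partial>\<zeta>) + measure \<zeta> A" for j
    proof -
      have i: "integrable \<zeta> (approx_ind A j)" "integrable \<zeta> (indicator A :: 'a \<Rightarrow> real)"
        using As by (auto intro!: Cb_integrable_M1 unitD approx_ind A \<zeta> simp: less_top[symmetric])
      have "(\<integral>x. approx_ind A j x \<partial>\<zeta>) \<le> (\<integral>x. \<bar>approx_ind A j x - indicator A x\<bar> + indicator A x \<partial>\<zeta>)"
        using i by (intro integral_mono) auto
      then show ?thesis using i As by simp
    qed
    have "(\<lambda>j. (\<integral>x. \<bar>approx_ind A j x - indicator A x\<bar> \<partial>\<zeta>) + measure \<zeta> A) \<longlonglongrightarrow> 0 + measure \<zeta> A"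
      by (intro tendsto_intros approx_ind_lim A)
    then have "\<forall>\<^sub>F j in sequentially. (\<integral>x. \<bar>approx_ind A j x - indicator A x\<bar> \<partial>\<zeta>) + measure \<zeta> A < \<delta>"
      using m by (intro order_tendstoD(2)) auto
    then have "\<forall>\<^sub>F j in sequentially. L (approx_ind A j) \<le> \<epsilon>"
    proof eventually_elim
      case (elim j)
      then have "(\<integral>x. approx_ind A j x \<partial>\<zeta>) < \<delta>" using *[of j] by linarith
      then show ?case using \<delta>(2)[OF unitD(1-3)[OF approx_ind(1)[OF A]]] by (simp add: less_imp_le)
    qed
    then show "v A \<le> \<epsilon>"
      by (rule tendsto_upperbound[OF v_lim[OF A approx_ind(1)[OF A] approx_ind_lim[OF A]]]) simp
  qed
qed

text \<open>The sum a + b of approximants may exceed 1. It is split into s = min 1 (a + b) and the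
  overshoot r, both with values in [0,1]: s approximates the indicator of the union, and r tends to
  0 in mean because A and B are disjoint.\<close>

lemma v_add:
  assumes A: "A \<in> sets borel" and B: "B \<in> sets borel" and AB: "A \<inter> B = {}"
  shows "v (A \<union> B) = v A + v B"
proof -
  define a where "a j = approx_ind A j" for j
  define b where "b j = approx_ind B j" for j
  define r where "r j x = max 0 (a j x + b j x - 1)" for j x
  define s where "s j x = a j x + b j x - r j x" for j x
  note a = approx_ind[OF A, folded a_def] and b = approx_ind[OF B, folded b_def]
  have s_min: "s j x = min 1 (a j x + b j x)" for j x unfolding s_def r_def by linarith
  have aC: "(\<lambda>x. a j x + b j x) \<in> Cb" for j by (intro Cb_add unitD a b)
  have rC: "r j \<in> Cb" for j
  proof -
    have "continuous_on UNIV (\<lambda>y::real. max 0 (y - 1))" by (intro continuous_intros)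
    from Cb_comp[OF aC this] show ?thesis unfolding r_def .
  qed
  have sC: "s j \<in> Cb" for j unfolding s_def by (rule Cb_diff[OF aC rC])
  have ab: "0 \<le> a j x" "a j x \<le> 1" "0 \<le> b j x" "b j x \<le> 1" for j x
    using unitD(2,3)[OF a(1)] unitD(2,3)[OF b(1)] by blast+
  have ru: "unit (r j)" for j unfolding unit_def
  proof (intro conjI allI rC)
    show "0 \<le> r j x" "r j x \<le> 1" for x using ab[of j x] unfolding r_def by linarith+
  qed
  have su: "unit (s j)" for j unfolding unit_def
  proof (intro conjI allI sC)
    show "0 \<le> s j x" "s j x \<le> 1" for x using ab[of j x] unfolding s_min by linarith+
  qed
  define e where "e j = (\<integral>x. \<bar>a j x - indicator A x\<bar> \<partial>\<zeta>) + (\<integral>x. \<bar>b j x - indicator B x\<bar> \<partial>\<zeta>)" for j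
  have e: "e \<longlonglongrightarrow> 0" unfolding e_def a_def b_def
    using tendsto_add[OF approx_ind_lim[OF A] approx_ind_lim[OF B]] by simp
  have As: "A \<in> sets \<zeta>" "B \<in> sets \<zeta>" using A B M1_sets[OF \<zeta>] by auto
  have i: "integrable \<zeta> (a j)" "integrable \<zeta> (b j)" "integrable \<zeta> (r j)" "integrable \<zeta> (s j)"
      "integrable \<zeta> (indicator A :: 'a \<Rightarrow> real)" "integrable \<zeta> (indicator B :: 'a \<Rightarrow> real)" "integrable \<zeta> (indicator (A \<union> B) :: 'a \<Rightarrow> real)" for j
    using As by (auto intro!: Cb_integrable_M1 unitD a b ru su \<zeta> simp: less_top[symmetric])
  have pw: "\<bar>s j x - indicator (A \<union> B) x\<bar> \<le> \<bar>a j x - indicator A x\<bar> + \<bar>b j x - indicator B x\<bar>"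
    "r j x \<le> \<bar>a j x - indicator A x\<bar> + \<bar>b j x - indicator B x\<bar>" for j x
    using ab[of j x] AB unfolding s_min r_def
    by (cases "x \<in> A"; cases "x \<in> B"; force)+
  have 1: "(\<integral>x. \<bar>s j x - indicator (A \<union> B) x\<bar> \<partial>\<zeta>) \<le> e j" for j
  proof -
    have "(\<integral>x. \<bar>s j x - indicator (A \<union> B) x\<bar> \<partial>\<zeta>) \<le> (\<integral>x. \<bar>a j x - indicator A x\<bar> + \<bar>b j x - indicator B x\<bar> \<partial>\<zeta>)"
      by (intro integral_mono pw integrable_abs Bochner_Integration.integrable_add Bochner_Integration.integrable_diff i)
    then show ?thesis unfolding e_def using i by simp
  qed
  have 2: "(\<integral>x. r j x \<partial>\<zeta>) \<le> e j" for j
  proof -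
    have "(\<integral>x. r j x \<partial>\<zeta>) \<le> (\<integral>x. \<bar>a j x - indicator A x\<bar> + \<bar>b j x - indicator B x\<bar> \<partial>\<zeta>)"
      by (intro integral_mono pw integrable_abs Bochner_Integration.integrable_add Bochner_Integration.integrable_diff i)
    then show ?thesis unfolding e_def using i by simp
  qed
  have ls: "(\<lambda>j. L (s j)) \<longlonglongrightarrow> v (A \<union> B)"
  proof (rule v_lim)
    show "(\<lambda>j. \<integral>x. \<bar>s j x - indicator (A \<union> B) x\<bar> \<partial>\<zeta>) \<longlonglongrightarrow> 0"
      by (rule tendsto_sandwich[OF _ _ tendsto_const e]) (auto intro!: always_eventually 1)
  qed (use A B su in auto)
  have "(\<lambda>j. L (r j)) \<longlonglongrightarrow> v {}"
  proof (rule v_lim)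
    show "(\<lambda>j. \<integral>x. \<bar>r j x - indicator {} x\<bar> \<partial>\<zeta>) \<longlonglongrightarrow> 0"
      by (rule tendsto_sandwich[OF _ _ tendsto_const e])
        (use 2 unitD(2)[OF ru] in \<open>auto intro!: always_eventually simp: abs_of_nonneg\<close>)
  qed (use ru in auto)
  moreover have "v {} = 0" by (rule v_const) auto
  ultimately have lr: "(\<lambda>j. L (r j)) \<longlonglongrightarrow> 0" by simp
  have "L (a j) + L (b j) = L (s j) + L (r j)" for j
  proof -
    have "L (a j) + L (b j) = L (\<lambda>x. a j x + b j x)" by (rule add[symmetric]) (intro unitD a b)+
    also have "(\<lambda>x. a j x + b j x) = (\<lambda>x. s j x + r j x)" by (simp add: s_def)
    also have "L \<dots> = L (s j) + L (r j)" by (rule add) (intro unitD su rC)+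
    finally show ?thesis .
  qed
  then have "(\<lambda>j. L (a j) + L (b j)) \<longlonglongrightarrow> v (A \<union> B) + 0" using tendsto_add[OF ls lr] by simp
  moreover have "(\<lambda>j. L (a j) + L (b j)) \<longlonglongrightarrow> v A + v B"
    unfolding a_def b_def by (intro tendsto_add v_lim approx_ind approx_ind_lim A B)
  ultimately show ?thesis using LIMSEQ_unique by fastforce
qed

section \<open>The representing measure\<close>

definition \<nu> :: "'a measure" where "\<nu> = measure_of UNIV (sets borel) (\<lambda>A. ennreal (v A))"

lemma v_countably_additive: "countably_additive (sets borel) (\<lambda>A. ennreal (v A))"
proof (rule sets.empty_continuous_imp_countably_additive)
  show "positive (sets borel) (\<lambda>A. ennreal (v A))"
    unfolding positive_def using v_const[of "{}" 0] by simp
  show "additive (sets borel) (\<lambda>A. ennreal (v A))"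
    unfolding additive_def by (auto simp: v_add v_nonneg simp flip: ennreal_plus)
  fix A :: "nat \<Rightarrow> 'a set" assume A: "range A \<subseteq> sets borel" "decseq A" "(\<Inter>i. A i) = {}"
  have Ai: "A i \<in> sets borel" for i using A(1) by auto
  have "(\<lambda>i. measure \<zeta> (A i)) \<longlonglongrightarrow> measure \<zeta> (\<Inter>i. A i)"
    using A M1_sets[OF \<zeta>] by (intro \<zeta>.finite_Lim_measure_decseq) auto
  then have m: "(\<lambda>i. measure \<zeta> (A i)) \<longlonglongrightarrow> 0" by (simp add: A(3))
  have "(\<lambda>i. v (A i)) \<longlonglongrightarrow> 0"
  proof (rule LIMSEQ_I)
    fix r :: real assume "r > 0"
    then obtain \<delta> where \<delta>: "\<delta> > 0" "\<And>A. A \<in> sets borel \<Longrightarrow> measure \<zeta> A < \<delta> \<Longrightarrow> v A \<le> r / 2"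
      using v_small[of "r/2"] by auto
    obtain N where N: "\<And>i. i \<ge> N \<Longrightarrow> measure \<zeta> (A i) < \<delta>"
      using order_tendstoD(2)[OF m \<delta>(1)] unfolding eventually_sequentially by auto
    have "norm (v (A i) - 0) < r" if "i \<ge> N" for i
      using \<delta>(2)[OF Ai N[OF that]] v_nonneg[OF Ai[of i]] \<open>r > 0\<close> by simp
    then show "\<exists>no. \<forall>i\<ge>no. norm (v (A i) - 0) < r" by blast
  qed
  then show "(\<lambda>i. ennreal (v (A i))) \<longlonglongrightarrow> 0" using tendsto_ennrealI by fastforce
qed simp

lemma sets_\<nu>: "sets \<nu> = sets borel"
  unfolding \<nu>_def by (metis sets.sets_measure_of_eq space_borel)

lemma emeasure_\<nu>:
  assumes A: "A \<in> sets borel" shows "emeasure \<nu> A = ennreal (v A)"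
  unfolding \<nu>_def
proof (rule emeasure_measure_of_sigma)
  show "sigma_algebra UNIV (sets (borel :: 'a measure))" using sets.sigma_algebra_axioms[of "borel :: 'a measure"] by simp
  show "positive (sets borel) (\<lambda>A. ennreal (v A))"
    unfolding positive_def using v_const[of "{}" 0] by simp
qed (rule v_countably_additive, rule A)

lemma \<nu>_M1: "\<nu> \<in> M1"
proof -
  have "space \<nu> = UNIV" using sets_eq_imp_space_eq[OF sets_\<nu>] by simp
  then have "emeasure \<nu> (space \<nu>) = 1" using v_const[of UNIV 1] by (simp add: emeasure_\<nu>)
  then show ?thesis unfolding M1_def using sets_\<nu> by (auto intro: prob_spaceI)
qed

sublocale \<nu>: prob_space \<nu> by (rule M1_prob[OF \<nu>_M1])

lemma measure_\<nu>: "A \<in> sets borel \<Longrightarrow> measure \<nu> A = v A"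
  by (simp add: measure_def emeasure_\<nu> v_nonneg)

lemma unit_sum:
  assumes "N > 0" "\<And>i. i \<in> {1..N} \<Longrightarrow> unit (k i)"
  shows "unit (\<lambda>x. (1 / real N) * (\<Sum>i=1..N. k i x))"
  unfolding unit_def
proof (intro conjI allI)
  show "(\<lambda>x. (1 / real N) * (\<Sum>i=1..N. k i x)) \<in> Cb"
    by (intro Cb_scale Cb_sum unitD assms) auto
  show "0 \<le> (1 / real N) * (\<Sum>i=1..N. k i x)" for x
    by (rule mult_nonneg_nonneg[OF _ sum_nonneg]) (simp_all add: unitD(2)[OF assms(2)])
  have "(\<Sum>i=1..N. k i x) \<le> (\<Sum>i=1..N. 1)" for x by (intro sum_mono unitD(3) assms(2))
  then show "(1 / real N) * (\<Sum>i=1..N. k i x) \<le> 1" for x using assms(1) by (simp add: divide_le_eq)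
qed

text \<open>f is within 1/N of its layer sum S, but S is discontinuous and outside the domain of L.
  Replacing the layers by their approximants gives K j: \<open>dist_small\<close> keeps L f within
  \<epsilon> of L (K j), and L (K j) tends to the \<nu>-integral of S by
  \<open>v_lim\<close>.\<close>

lemma L_unit:
  assumes f: "unit f" shows "L f = (\<integral>x. f x \<partial>\<nu>)"
proof -
  have fm: "f \<in> borel_measurable borel" by (rule unit_measurable[OF f])
  have "\<bar>L f - (\<integral>x. f x \<partial>\<nu>)\<bar> \<le> 2 * \<epsilon>" if \<epsilon>: "\<epsilon> > 0" for \<epsilon>
  proof -
    obtain \<delta> where \<delta>: "\<delta> > 0" "\<And>f g. unit f \<Longrightarrow> unit g \<Longrightarrow> (\<integral>x. \<bar>f x - g x\<bar> \<partial>\<zeta>) < \<delta> \<Longrightarrow> \<bar>L f - L g\<bar> < \<epsilon>"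
      using dist_small[OF \<epsilon>] by blast
    \<comment> \<open>The same n fixes the number \<open>Suc n\<close> of layers and the index from
      which on their approximants are accurate enough; each of the two errors is below
      \<delta>/2.\<close>
    obtain n where n: "inverse (real (Suc n)) < min (\<delta>/2) \<epsilon>"
      using reals_Archimedean[of "min (\<delta>/2) \<epsilon>"] \<delta>(1) \<epsilon> by auto
    define N where "N = Suc n"
    have N: "N > 0" "1 / real N < \<delta> / 2" "1 / real N < \<epsilon>" using n by (auto simp: N_def inverse_eq_divide)
    define A where "A i = {x. real i / real N \<le> f x}" for i
    have A: "A i \<in> sets borel" for i unfolding A_def using fm by measurable
    have Am: "A i \<in> sets \<nu>" "A i \<in> sets \<zeta>" for i using A sets_\<nu> M1_sets[OF \<zeta>] by auto
    define K where "K j x = (1 / real N) * (\<Sum>i=1..N. approx_ind (A i) j x)" for j x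
    define S where "S x = (1 / real N) * (\<Sum>i=1..N. indicator (A i) x :: real)" for x
    have Ku: "unit (K j)" for j unfolding K_def by (intro unit_sum N approx_ind A)
    have fS: "\<bar>f x - S x\<bar> \<le> 1 / real N" for x
      using layer_approx[OF unitD(2,3)[OF f] N(1), of x] by (simp add: S_def A_def indicator_def of_bool_def)
    have Sm: "S \<in> borel_measurable borel" unfolding S_def using A by measurable
    have Sb: "\<bar>S x\<bar> \<le> 1" for x
    proof -
      have "(\<Sum>i=1..N. indicator (A i) x :: real) \<le> (\<Sum>i=1..N. 1)" by (intro sum_mono) (auto simp: indicator_def)
      moreover have "0 \<le> (\<Sum>i=1..N. indicator (A i) x :: real)" by (intro sum_nonneg) auto
      ultimately show ?thesis using N(1) by (simp add: S_def divide_le_eq abs_of_nonneg)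
    qed
    have i\<zeta>: "integrable \<zeta> (approx_ind (A i) j)" "integrable \<zeta> (indicator (A i) :: 'a \<Rightarrow> real)" for i j
      using Am by (auto intro!: Cb_integrable_M1 unitD approx_ind A \<zeta> simp: less_top[symmetric])
    have "(\<integral>x. \<bar>f x - K j x\<bar> \<partial>\<zeta>) < \<delta>" if j: "j \<ge> n" for j
    proof -
      have "(\<integral>x. \<bar>f x - K j x\<bar> \<partial>\<zeta>) \<le> (\<integral>x. \<bar>f x - S x\<bar> \<partial>\<zeta>) + (\<integral>x. \<bar>S x - K j x\<bar> \<partial>\<zeta>)"
        by (intro L1_triangle fm Sm unit_measurable Ku unit_abs f Sb)
      also have "(\<integral>x. \<bar>f x - S x\<bar> \<partial>\<zeta>) \<le> (\<integral>x. 1 / real N \<partial>\<zeta>)"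
        using fS fm Sm Sb unit_abs[OF f]
        by (intro integral_mono integrable_abs Bochner_Integration.integrable_diff)
          (auto intro!: bounded_integrable[OF \<zeta>.finite_measure_axioms measurable_\<zeta>])
      also have "(\<integral>x. 1 / real N \<partial>\<zeta>) = 1 / real N" by (simp add: \<zeta>.prob_space)
      also have "(\<integral>x. \<bar>S x - K j x\<bar> \<partial>\<zeta>) \<le> (\<integral>x. (1 / real N) * (\<Sum>i=1..N. \<bar>approx_ind (A i) j x - indicator (A i) x\<bar>) \<partial>\<zeta>)"
      proof (rule integral_mono)
        show "integrable \<zeta> (\<lambda>x. \<bar>S x - K j x\<bar>)" unfolding S_def K_def
          by (intro integrable_abs Bochner_Integration.integrable_diff integrable_mult_right Bochner_Integration.integrable_sum i\<zeta>)
        show "integrable \<zeta> (\<lambda>x. (1 / real N) * (\<Sum>i=1..N. \<bar>approx_ind (A i) j x - indicator (A i) x\<bar>))"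
          by (intro integrable_abs Bochner_Integration.integrable_diff integrable_mult_right Bochner_Integration.integrable_sum i\<zeta>)
        show "\<bar>S x - K j x\<bar> \<le> (1 / real N) * (\<Sum>i=1..N. \<bar>approx_ind (A i) j x - indicator (A i) x\<bar>)" for x
        proof -
          have "S x - K j x = (1 / real N) * (\<Sum>i=1..N. indicator (A i) x - approx_ind (A i) j x)"
            unfolding S_def K_def by (simp add: sum_subtractf diff_divide_distrib)
          then have "\<bar>S x - K j x\<bar> = (1 / real N) * \<bar>\<Sum>i=1..N. indicator (A i) x - approx_ind (A i) j x\<bar>"
            by (simp add: abs_mult)
          also have "\<dots> \<le> (1 / real N) * (\<Sum>i=1..N. \<bar>indicator (A i) x - approx_ind (A i) j x\<bar>)"
            by (intro mult_left_mono sum_abs) auto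
          finally show ?thesis by (simp add: abs_minus_commute)
        qed
      qed
      also have "\<dots> = (1 / real N) * (\<Sum>i=1..N. \<integral>x. \<bar>approx_ind (A i) j x - indicator (A i) x\<bar> \<partial>\<zeta>)"
        using i\<zeta> by (simp add: Bochner_Integration.integral_sum)
      also have "\<dots> \<le> (1 / real N) * (\<Sum>i=1..N. inverse (real (Suc j)))"
        by (rule mult_left_mono[OF sum_mono]) (simp_all add: less_imp_le[OF approx_ind(2)[OF A]] del: of_nat_Suc)
      also have "\<dots> = inverse (real (Suc j))" using N(1) by simp
      also have "\<dots> \<le> inverse (real (Suc n))" using j by (simp add: le_imp_inverse_le)
      also have "\<dots> < \<delta> / 2" using n by simp
      finally show ?thesis using N(2) by linarith
    qed
    then have LK: "\<bar>L f - L (K j)\<bar> \<le> \<epsilon>" if "j \<ge> n" for j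
      using \<delta>(2)[OF f Ku] that by (simp add: less_imp_le)
    have "L (K j) = (1 / real N) * (\<Sum>i=1..N. L (approx_ind (A i) j))" for j
    proof -
      have "L (K j) = (1 / real N) * L (\<lambda>x. \<Sum>i=1..N. approx_ind (A i) j x)"
        unfolding K_def by (intro scale Cb_sum unitD(1) approx_ind(1) A) auto
      also have "L (\<lambda>x. \<Sum>i=1..N. approx_ind (A i) j x) = (\<Sum>i=1..N. L (approx_ind (A i) j))"
        by (intro sum unitD(1) approx_ind(1) A) auto
      finally show ?thesis .
    qed
    moreover have "(\<lambda>j. (1 / real N) * (\<Sum>i=1..N. L (approx_ind (A i) j))) \<longlonglongrightarrow> (1 / real N) * (\<Sum>i=1..N. v (A i))"
      by (intro tendsto_intros v_lim approx_ind approx_ind_lim A)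
    moreover have i\<nu>: "integrable \<nu> (indicator (A i) :: 'a \<Rightarrow> real)" for i
      using Am by (simp add: less_top[symmetric])
    then have "(\<integral>x. S x \<partial>\<nu>) = (1 / real N) * (\<Sum>i=1..N. v (A i))"
      unfolding S_def using Am by (simp add: Bochner_Integration.integral_sum measure_\<nu> A)
    ultimately have "(\<lambda>j. L (K j)) \<longlonglongrightarrow> (\<integral>x. S x \<partial>\<nu>)" by simp
    then have "(\<lambda>j. \<bar>L f - L (K j)\<bar>) \<longlonglongrightarrow> \<bar>L f - (\<integral>x. S x \<partial>\<nu>)\<bar>" by (intro tendsto_intros)
    then have 1: "\<bar>L f - (\<integral>x. S x \<partial>\<nu>)\<bar> \<le> \<epsilon>" by (rule LIMSEQ_le_const2) (use LK in blast)
    have fi: "integrable \<nu> f" by (intro Cb_integrable_M1 unitD f \<nu>_M1)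
    have Si: "integrable \<nu> S" unfolding S_def
      by (intro integrable_mult_right Bochner_Integration.integrable_sum i\<nu>)
    have "\<bar>(\<integral>x. f x \<partial>\<nu>) - (\<integral>x. S x \<partial>\<nu>)\<bar> = \<bar>\<integral>x. f x - S x \<partial>\<nu>\<bar>" using fi Si by simp
    also have "\<dots> \<le> (\<integral>x. \<bar>f x - S x\<bar> \<partial>\<nu>)" using integral_norm_bound[of \<nu> "\<lambda>x. f x - S x"] by simp
    also have "\<dots> \<le> (\<integral>x. 1 / real N \<partial>\<nu>)" using fi Si fS by (intro integral_mono) auto
    also have "\<dots> = 1 / real N" by (simp add: \<nu>.prob_space)
    finally show ?thesis using 1 N(3) by linarith
  qed
  then have "\<bar>L f - (\<integral>x. f x \<partial>\<nu>)\<bar> \<le> 0 + e" if "e > 0" for e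
    using that by (metis add_0 half_gt_zero_iff mult_2 field_sum_of_halves)
  then have "\<bar>L f - (\<integral>x. f x \<partial>\<nu>)\<bar> \<le> 0" by (rule field_le_epsilon)
  then show ?thesis by simp
qed

text \<open>An affine map takes f into [0,1], and L commutes with it by linearity and
  \<open>const\<close>.\<close>

lemma representation:
  assumes f: "f \<in> Cb" shows "L f = (\<integral>x. f x \<partial>\<nu>)"
proof -
  from CbE[OF f] obtain B where B: "B > 0" "\<And>x. \<bar>f x\<bar> \<le> B" by blast
  have Bx: "- B \<le> f x" "f x \<le> B" for x using B(2)[of x] by linarith+
  define g where "g x = (1 / (2 * B)) * (f x + B)" for x
  have fB: "(\<lambda>x. f x + B) \<in> Cb" by (intro Cb_add f Cb_const)
  have "unit g" unfolding unit_def
  proof (intro conjI allI)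
    show "g \<in> Cb" unfolding g_def by (rule Cb_scale[OF fB])
    show "0 \<le> g x" for x using B(1) Bx(1)[of x] by (simp add: g_def)
    show "g x \<le> 1" for x using B(1) Bx(2)[of x] by (simp add: g_def)
  qed
  then have "L g = (\<integral>x. g x \<partial>\<nu>)" by (rule L_unit)
  moreover have "L g = (1 / (2 * B)) * (L f + B)"
    unfolding g_def scale[OF fB] add[OF f Cb_const] const ..
  moreover have "(\<integral>x. g x \<partial>\<nu>) = (1 / (2 * B)) * ((\<integral>x. f x \<partial>\<nu>) + B)"
    unfolding g_def using Cb_integrable_M1[OF f \<nu>_M1] by (simp add: \<nu>.prob_space)
  ultimately show ?thesis using B(1) by simp
qed

theorem representing_measure:
  "\<exists>\<nu>\<in>M1. (\<forall>f\<in>Cb. L f = (\<integral>x. f x \<partial>\<nu>)) \<and> rel_entropy \<nu> \<zeta> \<le> ereal c"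
proof (intro bexI[OF _ \<nu>_M1] conjI ballI)
  show "rel_entropy \<nu> \<zeta> \<le> ereal c"
    by (rule rel_entropy_leI[OF \<nu>_M1 \<zeta>]) (use bound representation in simp)
qed (rule representation)

end

section \<open>The weak topology inside the space of functionals\<close>

text \<open>The value 0 outside \<open>Cb\<close> keeps every coordinate bounded.\<close>

definition emb :: "'a::topological_space measure \<Rightarrow> ('a \<Rightarrow> real) \<Rightarrow> real" where
  "emb \<mu> = (\<lambda>f. if f \<in> Cb then \<integral>x. f x \<partial>\<mu> else 0)"

lemma emb_apply: "f \<in> Cb \<Longrightarrow> emb \<mu> f = (\<integral>x. f x \<partial>\<mu>)"
  by (simp add: emb_def)

lemma open_coordinate: "open U \<Longrightarrow> open {\<Lambda>::'i \<Rightarrow> 'b::topological_space. \<Lambda> i \<in> U}"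
  using product_topology_basis'[of "{()}" "\<lambda>_. U" "\<lambda>_. i"] by simp

text \<open>The weak topology is the initial topology of \<open>emb\<close>: its generators are the
  preimages of open sets under the coordinates in \<open>Cb\<close>, and all other coordinates are
  constantly 0.\<close>

lemma openin_weak_topology_iff:
  fixes U :: "'a::topological_space measure set"
  shows "openin weak_topology U \<longleftrightarrow> (\<exists>V. open V \<and> U = {\<mu>\<in>M1. emb \<mu> \<in> V})"
proof
  assume "openin weak_topology U"
  then have "generate_topology_on {{\<mu> \<in> M1. (\<integral>x. f x \<partial>\<mu>) \<in> U} | (f :: 'a \<Rightarrow> real) U.
        continuous_on UNIV f \<and> bounded (range f) \<and> open U} U"
    unfolding weak_topology_def by (rule openin_topology_generated_by)
  then show "\<exists>V. open V \<and> U = {\<mu>\<in>M1. emb \<mu> \<in> V}"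
  proof induction
    case Empty
    show ?case by (rule exI[of _ "{}"]) simp
  next
    case (Int a b)
    then obtain V W where "open V" "a = {\<mu>\<in>M1. emb \<mu> \<in> V}" "open W" "b = {\<mu>\<in>M1. emb \<mu> \<in> W}" by blast
    then show ?case by (intro exI[of _ "V \<inter> W"]) auto
  next
    case (UN K)
    then have "\<forall>k\<in>K. \<exists>V. open V \<and> k = {\<mu>\<in>M1. emb \<mu> \<in> V}" by blast
    then obtain V where V: "\<And>k. k \<in> K \<Longrightarrow> open (V k) \<and> k = {\<mu>\<in>M1. emb \<mu> \<in> V k}" by metis
    have "\<Union>K = {\<mu>\<in>M1. emb \<mu> \<in> (\<Union>k\<in>K. V k)}"
    proof (intro set_eqI iffI)
      fix \<mu> assume "\<mu> \<in> \<Union>K"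
      then obtain k where k: "k \<in> K" "\<mu> \<in> k" by blast
      then have "\<mu> \<in> {\<mu>\<in>M1. emb \<mu> \<in> V k}" using V by blast
      then show "\<mu> \<in> {\<mu>\<in>M1. emb \<mu> \<in> (\<Union>k\<in>K. V k)}" using k by blast
    next
      fix \<mu> assume "\<mu> \<in> {\<mu>\<in>M1. emb \<mu> \<in> (\<Union>k\<in>K. V k)}"
      then obtain k where k: "k \<in> K" "\<mu> \<in> {\<mu>\<in>M1. emb \<mu> \<in> V k}" by blast
      then have "\<mu> \<in> k" using V by blast
      then show "\<mu> \<in> \<Union>K" using k by blast
    qed
    then show ?case using V by (intro exI[of _ "\<Union>k\<in>K. V k"]) blast
  next
    case (Basis s)
    then obtain f :: "'a \<Rightarrow> real" and U where s: "s = {\<mu> \<in> M1. (\<integral>x. f x \<partial>\<mu>) \<in> U}" and f: "f \<in> Cb" and U: "open U"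
      unfolding Cb_def by blast
    show ?case using f U by (intro exI[of _ "{\<Lambda>. \<Lambda> f \<in> U}"]) (simp add: s emb_apply open_coordinate)
  qed
next
  have cm: "continuous_map weak_topology euclidean (\<lambda>\<mu>. emb \<mu> f)" for f :: "'a \<Rightarrow> real"
  proof (cases "f \<in> Cb")
    case True
    show ?thesis unfolding continuous_map_def topspace_weak_topology
    proof (intro conjI allI impI)
      fix U :: "real set" assume "openin euclidean U"
      then show "openin weak_topology {\<mu> \<in> M1. emb \<mu> f \<in> U}"
        unfolding weak_topology_def using True
        by (intro topology_generated_by_Basis) (auto simp: emb_apply Cb_def)
    qed simp
  qed (simp add: emb_def)
  have "continuous_map weak_topology (product_topology (\<lambda>_. euclidean) UNIV) (emb :: 'a measure \<Rightarrow> _)"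
    unfolding continuous_map_componentwise_UNIV using cm by blast
  then have "continuous_map weak_topology euclidean (emb :: 'a measure \<Rightarrow> _)"
    by (simp add: euclidean_product_topology)
  moreover assume "\<exists>V. open V \<and> U = {\<mu>\<in>M1. emb \<mu> \<in> V}"
  ultimately show "openin weak_topology U"
    unfolding continuous_map_def topspace_weak_topology by auto
qed

lemma openin_weak_topologyI: "open V \<Longrightarrow> openin weak_topology {\<mu>\<in>M1. emb \<mu> \<in> V}"
  using openin_weak_topology_iff by blast

lemma closedin_weak_topology_iff:
  fixes F :: "'a::topological_space measure set"
  shows "closedin weak_topology F \<longleftrightarrow> (\<exists>C. closed C \<and> F = {\<mu>\<in>M1. emb \<mu> \<in> C})"
proof
  assume "closedin weak_topology F"
  then have F: "F \<subseteq> M1" "openin weak_topology (M1 - F)"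
    by (simp_all add: closedin_def topspace_weak_topology)
  then obtain V where "open V" "M1 - F = {\<mu>\<in>M1. emb \<mu> \<in> V}" using openin_weak_topology_iff by blast
  then show "\<exists>C. closed C \<and> F = {\<mu>\<in>M1. emb \<mu> \<in> C}" using F by (intro exI[of _ "- V"]) auto
next
  assume "\<exists>C. closed C \<and> F = {\<mu>\<in>M1. emb \<mu> \<in> C}"
  then obtain C where C: "closed C" "F = {\<mu>\<in>M1. emb \<mu> \<in> C}" by blast
  have "M1 - F = {\<mu>\<in>M1. emb \<mu> \<in> - C}" using C by auto
  then show "closedin weak_topology F" unfolding closedin_def topspace_weak_topology
    using C openin_weak_topologyI[of "- C"] by auto
qed

lemma openin_integral_less:
  fixes f :: "'a::topological_space \<Rightarrow> real"
  assumes "f \<in> Cb" shows "openin weak_topology {\<mu>\<in>M1. (\<integral>x. f x \<partial>\<mu>) < r}"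
    "openin weak_topology {\<mu>\<in>M1. r < (\<integral>x. f x \<partial>\<mu>)}"
  using openin_weak_topologyI[OF open_coordinate[OF open_lessThan[of r]], of f]
    openin_weak_topologyI[OF open_coordinate[OF open_greaterThan[of r]], of f] assms
  by (simp_all add: emb_apply)

text \<open>An indicator is approximated in mean under both measures at once, and the approximant
  has equal integrals. Injectivity makes each fibre of \<open>emb\<close> a single measure, so that
  a bound on \<open>K\<close> over a fibre is a bound at one point.\<close>

lemma emb_inj:
  fixes \<mu> \<nu> :: "'a::polish_space measure"
  assumes \<mu>: "\<mu> \<in> M1" and \<nu>: "\<nu> \<in> M1" and eq: "emb \<mu> = emb \<nu>"
  shows "\<mu> = \<nu>"
proof (rule measure_eqI)
  show "sets \<mu> = sets \<nu>" by (simp only: M1_sets[OF \<mu>] M1_sets[OF \<nu>])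
  fix A assume "A \<in> sets \<mu>"
  then have A: "A \<in> sets borel" "A \<in> sets \<mu>" "A \<in> sets \<nu>" by (simp_all only: M1_sets[OF \<mu>] M1_sets[OF \<nu>])
  interpret \<mu>: prob_space \<mu> by (rule M1_prob[OF \<mu>])
  interpret \<nu>: prob_space \<nu> by (rule M1_prob[OF \<nu>])
  have "\<bar>measure \<mu> A - measure \<nu> A\<bar> \<le> 0 + e" if e: "e > 0" for e
  proof -
    obtain k where k: "continuous_on UNIV k" "\<And>x. 0 \<le> k x" "\<And>x. k x \<le> (1::real)"
      "(\<integral>x. \<bar>k x - indicator A x\<bar> \<partial>\<mu>) < e/2" "(\<integral>x. \<bar>k x - indicator A x\<bar> \<partial>\<nu>) < e/2"
      using approx_indicator[OF \<mu>.finite_measure_axioms M1_sets[OF \<mu>] \<nu>.finite_measure_axioms M1_sets[OF \<nu>] A(1), of "e/2"] e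
      by auto
    have kC: "k \<in> Cb" using k by (intro CbI[where B=1]) (auto simp: abs_of_nonneg)
    have *: "\<bar>(\<integral>x. k x \<partial>m) - measure m A\<bar> \<le> (\<integral>x. \<bar>k x - indicator A x\<bar> \<partial>m)" if m: "m \<in> M1" for m
    proof -
      interpret m: prob_space m by (rule M1_prob[OF m])
      have Am: "A \<in> sets m" using A M1_sets[OF m] by simp
      have i: "integrable m k" "integrable m (indicator A :: 'a \<Rightarrow> real)"
        using Am by (auto intro!: Cb_integrable_M1 kC m simp: less_top[symmetric])
      have "(\<integral>x. k x \<partial>m) - measure m A = (\<integral>x. k x - indicator A x \<partial>m)" using i Am by simp
      then show ?thesis using integral_norm_bound[of m "\<lambda>x. k x - indicator A x"] by simp
    qed
    have "(\<integral>x. k x \<partial>\<mu>) = (\<integral>x. k x \<partial>\<nu>)" using fun_cong[OF eq, of k] kC by (simp add: emb_apply)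
    then show ?thesis using *[OF \<mu>] *[OF \<nu>] k(4,5) by linarith
  qed
  then have "\<bar>measure \<mu> A - measure \<nu> A\<bar> \<le> 0" by (rule field_le_epsilon)
  then show "emeasure \<mu> A = emeasure \<nu> A" by (simp add: \<mu>.emeasure_eq_measure \<nu>.emeasure_eq_measure)
qed

text \<open>The supremum-norm bound places the functionals in a product of compact intervals.
  Positivity and normalization come later, from the exponential bound.\<close>

definition linear_functionals :: "(('a::topological_space \<Rightarrow> real) \<Rightarrow> real) set" where
  "linear_functionals = {\<Lambda>. (\<forall>f\<in>Cb. \<forall>g\<in>Cb. \<Lambda> (\<lambda>x. f x + g x) = \<Lambda> f + \<Lambda> g) \<and>
     (\<forall>f\<in>Cb. \<forall>a. \<Lambda> (\<lambda>x. a * f x) = a * \<Lambda> f) \<and>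
     (\<forall>f. \<bar>\<Lambda> f\<bar> \<le> (if f \<in> Cb then SUP x. \<bar>f x\<bar> else 0))}"

text \<open>Each linearity equation involves finitely many coordinates and is therefore a closed
  condition on the product of intervals, which is compact by Tychonoff's theorem.\<close>

lemma compact_linear_functionals: "compact (linear_functionals :: (('a::topological_space \<Rightarrow> real) \<Rightarrow> real) set)"
proof -
  define b :: "('a \<Rightarrow> real) \<Rightarrow> real" where "b f = (if f \<in> Cb then SUP x. \<bar>f x\<bar> else 0)" for f
  define P where "P = (\<Pi>\<^sub>E f\<in>UNIV. {- b f..b f})"
  have "compactin (product_topology (\<lambda>_. euclidean) UNIV) P"
    unfolding P_def compactin_PiE by (simp add: compactin_euclidean_iff)
  then have P: "compact P" by (simp add: euclidean_product_topology compactin_euclidean_iff)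
  have c: "continuous_on UNIV (\<lambda>\<Lambda>::('a \<Rightarrow> real) \<Rightarrow> real. \<Lambda> f)" for f by simp
  have "closed {\<Lambda>::('a \<Rightarrow> real) \<Rightarrow> real. \<forall>f\<in>Cb. \<forall>g\<in>Cb. \<Lambda> (\<lambda>x. f x + g x) = \<Lambda> f + \<Lambda> g}"
    unfolding Ball_def
    by (intro closed_Collect_all closed_Collect_imp open_Collect_const closed_Collect_eq continuous_on_add c)
  moreover have "closed {\<Lambda>::('a \<Rightarrow> real) \<Rightarrow> real. \<forall>f\<in>Cb. \<forall>a. \<Lambda> (\<lambda>x. a * f x) = a * \<Lambda> f}"
    unfolding Ball_def
    by (intro closed_Collect_all closed_Collect_imp open_Collect_const closed_Collect_eq continuous_on_mult continuous_on_const c)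
  ultimately have "compact (P \<inter> ({\<Lambda>. \<forall>f\<in>Cb. \<forall>g\<in>Cb. \<Lambda> (\<lambda>x. f x + g x) = \<Lambda> f + \<Lambda> g} \<inter> {\<Lambda>. \<forall>f\<in>Cb. \<forall>a. \<Lambda> (\<lambda>x. a * f x) = a * \<Lambda> f}))"
    using P by (intro compact_Int_closed closed_Int)
  also have "(P \<inter> ({\<Lambda>. \<forall>f\<in>Cb. \<forall>g\<in>Cb. \<Lambda> (\<lambda>x. f x + g x) = \<Lambda> f + \<Lambda> g} \<inter> {\<Lambda>. \<forall>f\<in>Cb. \<forall>a. \<Lambda> (\<lambda>x. a * f x) = a * \<Lambda> f})) = linear_functionals"
    unfolding linear_functionals_def P_def b_def[symmetric] by (auto simp: PiE_def Pi_def abs_le_iff minus_le_iff)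
  finally show ?thesis .
qed

lemma emb_linear_functionals:
  assumes \<mu>: "\<mu> \<in> M1" shows "emb \<mu> \<in> linear_functionals"
proof -
  interpret prob_space \<mu> by (rule M1_prob[OF \<mu>])
  have "\<bar>emb \<mu> f\<bar> \<le> (if f \<in> Cb then SUP x. \<bar>f x\<bar> else 0)" for f
  proof (cases "f \<in> Cb")
    case True
    from CbE[OF True] obtain B where "B > 0" "\<And>x. \<bar>f x\<bar> \<le> B" by blast
    then have "bdd_above (range (\<lambda>x. \<bar>f x\<bar>))" by (intro bdd_aboveI[of _ B]) auto
    then have le: "\<bar>f x\<bar> \<le> (SUP x. \<bar>f x\<bar>)" for x by (rule cSUP_upper[OF UNIV_I])
    have "\<bar>\<integral>x. f x \<partial>\<mu>\<bar> \<le> (\<integral>x. \<bar>f x\<bar> \<partial>\<mu>)" using integral_norm_bound[of \<mu> f] by simp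
    also have "\<dots> \<le> (\<integral>x. (SUP x. \<bar>f x\<bar>) \<partial>\<mu>)"
      using Cb_integrable_M1[OF True \<mu>] le by (intro integral_mono) auto
    also have "\<dots> = (SUP x. \<bar>f x\<bar>)" by (simp add: prob_space)
    finally show ?thesis using True by (simp add: emb_apply)
  qed (simp add: emb_def)
  then show ?thesis unfolding linear_functionals_def
    by (simp add: emb_apply Cb_add Cb_scale Cb_integrable_M1 \<mu>)
qed

lemma compactin_weak_topologyI:
  fixes S :: "'a::topological_space measure set"
  assumes S: "S \<subseteq> M1" and c: "compact (emb ` S)"
  shows "compactin weak_topology S"
  unfolding compactin_def topspace_weak_topology
proof (intro conjI S allI impI)
  fix \<U> :: "'a measure set set" assume U: "(\<forall>U\<in>\<U>. openin weak_topology U) \<and> S \<subseteq> \<Union>\<U>"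
  have "\<exists>V. open V \<and> (\<forall>\<mu>. \<mu> \<in> U \<longleftrightarrow> \<mu> \<in> M1 \<and> emb \<mu> \<in> V)" if "U \<in> \<U>" for U
  proof -
    have "openin weak_topology U" using U that by simp
    then obtain V where "open V" "U = {\<mu>\<in>M1. emb \<mu> \<in> V}" unfolding openin_weak_topology_iff by metis
    then show ?thesis by (intro exI[of _ V] conjI) simp_all
  qed
  then obtain V where Vo: "\<And>U. U \<in> \<U> \<Longrightarrow> open (V U)"
    and V: "\<And>U \<mu>. U \<in> \<U> \<Longrightarrow> \<mu> \<in> U \<longleftrightarrow> \<mu> \<in> M1 \<and> emb \<mu> \<in> V U" by metis
  have "emb ` S \<subseteq> (\<Union>U\<in>\<U>. V U)"
  proof
    fix y assume "y \<in> emb ` S"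
    then obtain \<mu> where \<mu>: "\<mu> \<in> S" "y = emb \<mu>" by blast
    then obtain U' where U': "U' \<in> \<U>" "\<mu> \<in> U'" using U by blast
    then show "y \<in> (\<Union>U\<in>\<U>. V U)" using \<mu> V[OF U'(1)] by blast
  qed
  then obtain \<F> where F: "\<F> \<subseteq> \<U>" "finite \<F>" "emb ` S \<subseteq> (\<Union>U\<in>\<F>. V U)"
    using compactE_image[of "emb ` S" \<U> V, OF c Vo] by blast
  have "S \<subseteq> \<Union>\<F>"
  proof
    fix \<mu> assume \<mu>: "\<mu> \<in> S"
    then obtain U' where U': "U' \<in> \<F>" "emb \<mu> \<in> V U'" using F by blast
    then have "\<mu> \<in> U'" using V[of U'] F(1) S \<mu> by blast
    then show "\<mu> \<in> \<Union>\<F>" using U' by blast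
  qed
  then show "\<exists>\<F>. finite \<F> \<and> \<F> \<subseteq> \<U> \<and> S \<subseteq> \<Union>\<F>" using F by blast
qed

text \<open>Regularity of a product of real lines passes to the initial topology. It reconciles two
  demands: covers need open sets, whereas the LDP bounds from above only through closed sets on
  which the rate is large.\<close>

lemma weak_topology_regular:
  fixes V :: "'a::topological_space measure set"
  assumes V: "openin weak_topology V" and \<zeta>: "\<zeta> \<in> V"
  obtains U C where "openin weak_topology U" "closedin weak_topology C" "\<zeta> \<in> U" "U \<subseteq> C" "C \<subseteq> V"
proof -
  obtain O' where O: "open O'" "V = {\<mu>\<in>M1. emb \<mu> \<in> O'}" using V openin_weak_topology_iff by blast
  have "regular_space (product_topology (\<lambda>_::'a \<Rightarrow> real. euclidean :: real topology) UNIV)"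
    unfolding regular_space_product_topology by (simp add: regular_space_euclidean)
  then have "regular_space (euclidean :: (('a \<Rightarrow> real) \<Rightarrow> real) topology)"
    by (simp add: euclidean_product_topology)
  then have "neighbourhood_base_of (closedin euclidean) (euclidean :: (('a \<Rightarrow> real) \<Rightarrow> real) topology)"
    by (simp add: neighbourhood_base_of_closedin)
  moreover have "emb \<zeta> \<in> O'" using O \<zeta> by blast
  ultimately obtain U C where "open U" "closed C" "emb \<zeta> \<in> U" "U \<subseteq> C" "C \<subseteq> O'"
    unfolding neighbourhood_base_of using O(1) by (metis closed_closedin open_openin)
  moreover have "openin weak_topology {\<mu>\<in>M1. emb \<mu> \<in> U}" by (rule openin_weak_topologyI) fact
  moreover have "closedin weak_topology {\<mu>\<in>M1. emb \<mu> \<in> C}" using closedin_weak_topology_iff \<open>closed C\<close> by blast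
  ultimately show ?thesis using O(2) \<zeta>
    by (intro that[of "{\<mu>\<in>M1. emb \<mu> \<in> U}" "{\<mu>\<in>M1. emb \<mu> \<in> C}"]) auto
qed

section \<open>Borel sets of a topology, and the LDP in exponential form\<close>

lemma sets_borel_of: "sets (borel_of T) = sigma_sets (topspace T) {U. openin T U}"
  unfolding borel_of_def by (rule sets_measure_of) (auto dest: openin_subset)

lemma space_borel_of: "space (borel_of T) = topspace T"
  unfolding borel_of_def by (rule space_measure_of) (auto dest: openin_subset)

lemma openin_borel_of: "openin T U \<Longrightarrow> U \<in> sets (borel_of T)"
  unfolding sets_borel_of by (rule sigma_sets.Basic) simp

lemma closedin_borel_of: 
  assumes "closedin T F" shows "F \<in> sets (borel_of T)"
proof -
  have "F = space (borel_of T) - (topspace T - F)"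
    using closedin_subset[OF assms] by (auto simp: space_borel_of)
  moreover have "topspace T - F \<in> sets (borel_of T)" using assms by (intro openin_borel_of) (simp add: closedin_def)
  ultimately show ?thesis by (metis sets.compl_sets)
qed

text \<open>This and the next three lemmas translate between scaled logarithms and exponential
  bounds, so that all estimates can be made on probabilities, which are added and multiplied,
  instead of extended reals.\<close>

lemma log_prob_ge:
  assumes "n \<ge> 1" "exp (- real n * r) \<le> p"
  shows "ereal (- r) \<le> ereal (1 / real n) * log_prob p"
proof -
  have p: "p > 0" using assms(2) exp_gt_zero[of "- real n * r"] by linarith
  have "- real n * r \<le> ln p" using assms(2) p by (simp add: ln_ge_iff)
  then have "- r \<le> ln p / real n" using assms(1) by (simp add: pos_le_divide_eq mult.commute)
  then show ?thesis using p by (simp add: log_prob_def)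
qed

lemma log_prob_le:
  assumes "n \<ge> 1" "p \<le> exp (- real n * a)" "p \<ge> 0"
  shows "ereal (1 / real n) * log_prob p \<le> ereal (- a)"
proof (cases "p = 0")
  case True then show ?thesis using assms(1) by (simp add: log_prob_def)
next
  case False
  then have p: "p > 0" using assms by simp
  then have "ln p \<le> - real n * a" using assms(2) by (metis exp_gt_zero ln_exp ln_le_cancel_iff)
  then have "ln p / real n \<le> - a" using assms(1) by (simp add: pos_divide_le_eq mult.commute)
  then show ?thesis using p by (simp add: log_prob_def)
qed

lemma log_prob_gtD:
  assumes "n \<ge> 1" "ereal (- r) < ereal (1 / real n) * log_prob p" "p \<ge> 0"
  shows "exp (- real n * r) \<le> p"
proof (rule ccontr)
  assume "\<not> ?thesis"
  then have "ereal (1 / real n) * log_prob p \<le> ereal (- r)" using assms by (intro log_prob_le) auto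
  then show False using assms by (simp add: not_le[symmetric])
qed

lemma log_prob_ltD:
  assumes "n \<ge> 1" "ereal (1 / real n) * log_prob p < ereal (- a)"
  shows "p \<le> exp (- real n * a)"
proof (rule ccontr)
  assume "\<not> ?thesis"
  then have "ereal (- a) \<le> ereal (1 / real n) * log_prob p" using assms by (intro log_prob_ge) auto
  then show False using assms by (simp add: not_le[symmetric])
qed

lemma ereal_less_flip: "x < ereal r \<longleftrightarrow> ereal (- r) < - x" "ereal r < x \<longleftrightarrow> - x < ereal (- r)"
  by (cases x; simp)+

lemma LDP_bounds:
  assumes "LDP T P I" "A \<in> sets (borel_of T)"
  shows "- (INF x\<in>T interior_of A. I x) \<le> liminf (\<lambda>n. ereal (1 / real n) * log_prob (measure (P n) A))"
    "limsup (\<lambda>n. ereal (1 / real n) * log_prob (measure (P n) A)) \<le> - (INF x\<in>T closure_of A. I x)"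
  using assms unfolding LDP_def by blast+

lemma LDP_lower_exp:
  assumes L: "LDP T P I" and V: "openin T V" and x: "x \<in> V" "I x < ereal r"
  shows "\<forall>\<^sub>F n in sequentially. exp (- real n * r) \<le> measure (P n) V"
proof -
  have "(INF x\<in>V. I x) < ereal r" using x by (auto simp: INF_less_iff)
  then have "ereal (- r) < - (INF x\<in>V. I x)" by (rule ereal_less_flip(1)[THEN iffD1])
  also have "\<dots> \<le> liminf (\<lambda>n. ereal (1 / real n) * log_prob (measure (P n) V))"
    using LDP_bounds(1)[OF L openin_borel_of[OF V]] unfolding interior_of_openin[OF V] .
  finally have "\<forall>\<^sub>F n in sequentially. ereal (- r) < ereal (1 / real n) * log_prob (measure (P n) V)"
    by (rule less_LiminfD)
  then show ?thesis using eventually_ge_at_top[of 1]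
    by eventually_elim (rule log_prob_gtD, auto)
qed

lemma LDP_upper_exp:
  assumes L: "LDP T P I" and F: "closedin T F" and b: "\<And>x. x \<in> F \<Longrightarrow> ereal b \<le> I x" and a: "a < b"
  shows "\<forall>\<^sub>F n in sequentially. measure (P n) F \<le> exp (- real n * a)"
proof -
  have "ereal b \<le> (INF x\<in>F. I x)" using b by (intro INF_greatest)
  then have *: "ereal a < (INF x\<in>F. I x)" using a by (metis ereal_less_eq(3) less_ereal.simps(1) order_less_le_trans)
  have "limsup (\<lambda>n. ereal (1 / real n) * log_prob (measure (P n) F)) \<le> - (INF x\<in>F. I x)"
    using LDP_bounds(2)[OF L closedin_borel_of[OF F]] unfolding closure_of_closedin[OF F] .
  also have "\<dots> < ereal (- a)" using * by (rule ereal_less_flip(2)[THEN iffD1])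
  finally have "\<forall>\<^sub>F n in sequentially. ereal (1 / real n) * log_prob (measure (P n) F) < ereal (- a)"
    by (rule Limsup_lessD)
  then show ?thesis using eventually_ge_at_top[of 1]
    by eventually_elim (rule log_prob_ltD, auto)
qed

text \<open>Interior and closure reduce a Borel set to open and closed sets by monotonicity; the
  infima reduce to single points and to uniform lower bounds on the rate. Negative b is left out of
  the upper bound because the trivial estimate by 1 covers that range.\<close>

lemma LDP_expI:
  assumes P: "\<And>n. n \<ge> 1 \<Longrightarrow> prob_space (P n)" "\<And>n. n \<ge> 1 \<Longrightarrow> sets (P n) = sets (borel_of T)"
    and I: "\<And>x. x \<in> topspace T \<Longrightarrow> 0 \<le> I x" "lsc_on T I"
    and lower: "\<And>G x r. openin T G \<Longrightarrow> x \<in> G \<Longrightarrow> I x < ereal r \<Longrightarrow>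
      \<forall>\<^sub>F n in sequentially. exp (- real n * r) \<le> measure (P n) G"
    and upper: "\<And>F a b. closedin T F \<Longrightarrow> (\<And>x. x \<in> F \<Longrightarrow> ereal a < I x) \<Longrightarrow> 0 \<le> b \<Longrightarrow> b < a \<Longrightarrow>
      \<forall>\<^sub>F n in sequentially. measure (P n) F \<le> exp (- real n * b)"
  shows "LDP T P I"
  unfolding LDP_def
proof (intro conjI allI impI ballI P I)
  fix A assume A: "A \<in> sets (borel_of T)"
  have mono: "measure (P n) B \<le> measure (P n) B'"
    if "n \<ge> 1" "B \<subseteq> B'" "B' \<in> sets (borel_of T)" for n B B'
    using finite_measure.finite_measure_mono[OF prob_space.finite_measure[OF P(1)[OF that(1)]] that(2)]
    unfolding P(2)[OF that(1)] using that(3) by blast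
  define l where "l n = ereal (1 / real n) * log_prob (measure (P n) A)" for n
  have "- (INF x\<in>T interior_of A. I x) \<le> liminf l"
  proof (rule ccontr)
    assume "\<not> ?thesis"
    then have "liminf l < - (INF x\<in>T interior_of A. I x)" by simp
    then obtain s where s: "liminf l < ereal s" "ereal s < - (INF x\<in>T interior_of A. I x)"
      using ereal_dense2 by blast
    have "(INF x\<in>T interior_of A. I x) < ereal (- s)"
      using s(2) by (simp add: ereal_less_flip(1))
    then obtain x where x: "x \<in> T interior_of A" "I x < ereal (- s)" by (auto simp: INF_less_iff)
    have "\<forall>\<^sub>F n in sequentially. exp (- real n * (- s)) \<le> measure (P n) (T interior_of A)"
      by (rule lower[OF openin_interior_of x])
    then have "\<forall>\<^sub>F n in sequentially. ereal s \<le> l n" using eventually_ge_at_top[of 1]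
    proof eventually_elim
      case (elim n)
      then have "exp (- real n * (- s)) \<le> measure (P n) A"
        using mono[OF elim(2) interior_of_subset[of T A] A] by linarith
      from log_prob_ge[OF elim(2) this] show ?case by (simp add: l_def)
    qed
    then have "ereal s \<le> liminf l" by (rule Liminf_bounded)
    then show False using s(1) by simp
  qed
  then show "- (INF x\<in>T interior_of A. I x) \<le> liminf (\<lambda>n. ereal (1 / real n) * log_prob (measure (P n) A))"
    unfolding l_def .
  have As: "A \<subseteq> topspace T" using sets.sets_into_space[OF A] by (simp add: space_borel_of)
  have "limsup l \<le> - (INF x\<in>T closure_of A. I x)"
  proof (rule ccontr)
    assume "\<not> ?thesis"
    then have "- (INF x\<in>T closure_of A. I x) < limsup l" by simp
    then obtain s where s: "- (INF x\<in>T closure_of A. I x) < ereal s" "ereal s < limsup l"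
      using ereal_dense2 by blast
    \<comment> \<open>An intermediate value: -s' is a strict lower bound for the rate on the
      closure, and b = -s lies strictly below it.\<close>
    then obtain s' where s': "- (INF x\<in>T closure_of A. I x) < ereal s'" "ereal s' < ereal s"
      using ereal_dense2 by blast
    have up: "\<forall>\<^sub>F n in sequentially. l n \<le> ereal (- b)"
      if "\<forall>\<^sub>F n in sequentially. measure (P n) (T closure_of A) \<le> exp (- real n * b)" for b
      using that eventually_ge_at_top[of 1]
    proof eventually_elim
      case (elim n)
      have "measure (P n) A \<le> exp (- real n * b)"
        using mono[OF elim(2) closure_of_subset[OF As] closedin_borel_of[OF closedin_closure_of]] elim(1) by linarith
      from log_prob_le[OF elim(2) this] show ?case by (simp add: l_def)
    qed
    have "\<forall>\<^sub>F n in sequentially. l n \<le> ereal s"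
    proof (cases "s \<ge> 0")
      case True
      have "\<forall>\<^sub>F n in sequentially. measure (P n) (T closure_of A) \<le> exp (- real n * 0)"
        using eventually_ge_at_top[of 1] by eventually_elim (simp add: P prob_space.prob_le_1)
      from up[OF this] show ?thesis by eventually_elim (use True in \<open>auto elim: order_trans\<close>)
    next
      case False
      have "ereal (- s') < (INF x\<in>T closure_of A. I x)"
        using s'(1) by (simp add: ereal_less_flip(2))
      then have "ereal (- s') < I x" if "x \<in> T closure_of A" for x
        using that by (meson INF_lower order_less_le_trans)
      then have "\<forall>\<^sub>F n in sequentially. measure (P n) (T closure_of A) \<le> exp (- real n * (- s))"
        using s'(2) False by (intro upper[where a="- s'"]) auto
      from up[OF this] show ?thesis by simp
    qed
    then have "limsup l \<le> ereal s" by (rule Limsup_bounded)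
    then show False using s(2) by simp
  qed
  then show "limsup (\<lambda>n. ereal (1 / real n) * log_prob (measure (P n) A)) \<le> - (INF x\<in>T closure_of A. I x)"
    unfolding l_def .
qed

section \<open>Resampling from a fixed sample\<close>

lemma weighted_empirical_cong:
  assumes "\<And>i. i \<in> {1..n} \<Longrightarrow> w i = w' i" "\<And>i. i \<in> {1..n} \<Longrightarrow> x i = x' i"
  shows "weighted_empirical n w x = weighted_empirical n w' x'"
proof (rule measure_eqI)
  show "sets (weighted_empirical n w x) = sets (weighted_empirical n w' x')" by (simp add: weighted_empirical_def)
  fix B assume "B \<in> sets (weighted_empirical n w x)"
  then have "B \<in> sets borel" by (simp add: weighted_empirical_def)
  then show "emeasure (weighted_empirical n w x) B = emeasure (weighted_empirical n w' x') B"
    unfolding emeasure_weighted_empirical[OF \<open>B \<in> sets borel\<close>] using assms by (intro sum.cong) auto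
qed

lemma weighted_empirical_max_0: "weighted_empirical n w x = weighted_empirical n (\<lambda>i. max 0 (w i)) x"
proof (rule measure_eqI)
  show "sets (weighted_empirical n w x) = sets (weighted_empirical n (\<lambda>i. max 0 (w i)) x)" by (simp add: weighted_empirical_def)
  fix B assume "B \<in> sets (weighted_empirical n w x)"
  then have B: "B \<in> sets borel" by (simp add: weighted_empirical_def)
  have "ennreal (w i / real n) = ennreal (max 0 (w i) / real n)" for i
    by (cases "w i \<ge> 0") (simp_all add: ennreal_neg divide_nonpos_nonneg max_def)
  then show "emeasure (weighted_empirical n w x) B = emeasure (weighted_empirical n (\<lambda>i. max 0 (w i)) x) B"
    unfolding emeasure_weighted_empirical[OF B] by simp
qed

lemma weighted_empirical_M1_iff:
  assumes n: "n \<ge> 1"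
  shows "weighted_empirical n w x \<in> M1 \<longleftrightarrow> (\<Sum>i=1..n. max 0 (w i)) = real n"
proof -
  have "emeasure (weighted_empirical n w x) (space (weighted_empirical n w x))
      = emeasure (weighted_empirical n (\<lambda>i. max 0 (w i)) x) UNIV"
    by (subst weighted_empirical_max_0) (simp add: weighted_empirical_def)
  also have "\<dots> = (\<Sum>i=1..n. ennreal (max 0 (w i) / real n))" by (simp add: emeasure_weighted_empirical)
  also have "\<dots> = ennreal ((\<Sum>i=1..n. max 0 (w i)) / real n)"
    by (simp add: sum_divide_distrib)
  finally have e: "emeasure (weighted_empirical n w x) (space (weighted_empirical n w x)) = ennreal ((\<Sum>i=1..n. max 0 (w i)) / real n)" .
  have "weighted_empirical n w x \<in> M1 \<longleftrightarrow> prob_space (weighted_empirical n w x)"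
    by (simp add: M1_def weighted_empirical_def)
  also have "\<dots> \<longleftrightarrow> ennreal ((\<Sum>i=1..n. max 0 (w i)) / real n) = 1"
    using prob_space.emeasure_space_1 prob_spaceI e by metis
  also have "\<dots> \<longleftrightarrow> (\<Sum>i=1..n. max 0 (w i)) / real n = 1" by (simp add: ennreal_eq_1)
  also have "\<dots> \<longleftrightarrow> (\<Sum>i=1..n. max 0 (w i)) = real n" using n by (auto simp: nonzero_divide_eq_eq)
  finally show ?thesis .
qed

lemma integral_weighted_empirical:
  fixes f :: "'a::topological_space \<Rightarrow> real"
  assumes f: "f \<in> borel_measurable borel"
  shows "(\<integral>y. f y \<partial>(weighted_empirical n w x)) = (\<Sum>i=1..n. max 0 (w i) / real n * f (x i))"
proof -
  have "(\<integral>y. f y \<partial>(weighted_empirical n w x)) = (\<integral>y. f y \<partial>(weighted_empirical n (\<lambda>i. max 0 (w i)) x))"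
    by (subst weighted_empirical_max_0) rule
  also have "\<dots> = (\<integral>i. f (x i) \<partial>(point_measure {1..n} (\<lambda>i. ennreal (max 0 (w i) / real n))))"
    unfolding weighted_empirical_def using f
    by (intro integral_distr) (simp_all add: measurable_point_measure_eq1)
  also have "\<dots> = (\<Sum>i=1..n. (max 0 (w i) / real n) *\<^sub>R f (x i))"
    by (rule lebesgue_integral_point_measure_finite) auto
  finally show ?thesis by simp
qed

text \<open>As a function of weights and points, the measure composed with \<open>emb\<close> is
  continuous, and the set D of weight vectors of total positive part n, where the value lies in
  \<open>M1\<close>, is closed. So preimages of open sets within D are Borel, and induction over
  \<open>sigma_sets\<close> reaches all Borel sets.\<close>

lemma measurable_weighted_empirical:
  fixes x :: "nat \<Rightarrow> 'w \<Rightarrow> 'a::polish_space"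
  assumes n: "n \<ge> 1"
    and w: "\<And>i. i \<in> {1..n} \<Longrightarrow> w i \<in> borel_measurable M"
    and x: "\<And>i. i \<in> {1..n} \<Longrightarrow> x i \<in> borel_measurable M"
    and A: "A \<in> sets (borel_of weak_topology)"
  shows "{\<omega>\<in>space M. weighted_empirical n (\<lambda>i. w i \<omega>) (\<lambda>i. x i \<omega>) \<in> A} \<in> sets M"
proof -
  define T where "T p = weighted_empirical n (fst p) (snd p)" for p :: "(nat \<Rightarrow> real) \<times> (nat \<Rightarrow> 'a)"
  define D where "D = {p :: (nat \<Rightarrow> real) \<times> (nat \<Rightarrow> 'a). (\<Sum>i=1..n. max 0 (fst p i)) = real n}"
  have cf: "continuous_on UNIV (\<lambda>p::(nat \<Rightarrow> real) \<times> (nat \<Rightarrow> 'a). fst p i)" for i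
    by (rule continuous_on_compose2[OF continuous_on_product_coordinates continuous_on_fst[OF continuous_on_id]]) simp
  have cs: "continuous_on UNIV (\<lambda>p::(nat \<Rightarrow> real) \<times> (nat \<Rightarrow> 'a). snd p i)" for i
    by (rule continuous_on_compose2[OF continuous_on_product_coordinates continuous_on_snd[OF continuous_on_id]]) simp
  have "closed D" unfolding D_def
    by (intro closed_Collect_eq continuous_intros cf)
  have D: "T p \<in> M1 \<longleftrightarrow> p \<in> D" for p unfolding T_def D_def by (simp add: weighted_empirical_M1_iff[OF n])
  have cont: "continuous_on UNIV (\<lambda>p. emb (T p))"
  proof (rule continuous_on_coordinatewise_then_product)
    fix f :: "'a \<Rightarrow> real"
    show "continuous_on UNIV (\<lambda>p. emb (T p) f)"
    proof (cases "f \<in> Cb")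
      case True
      have "emb (T p) f = (\<Sum>i=1..n. max 0 (fst p i) / real n * f (snd p i))" for p
        unfolding T_def using True by (simp add: emb_apply integral_weighted_empirical Cb_measurable)
      moreover have "continuous_on UNIV (\<lambda>p::(nat \<Rightarrow> real) \<times> (nat \<Rightarrow> 'a). f (snd p i))" for i
        by (rule continuous_on_compose2[OF Cb_cont[OF True] cs]) simp
      ultimately show ?thesis using n by (simp, intro continuous_intros cf) auto
    qed (simp add: emb_def)
  qed
  have B: "{p\<in>D. T p \<in> A} \<in> sets borel"
    using A unfolding sets_borel_of topspace_weak_topology
  proof induction
    case (Basic a)
    then obtain V where V: "open V" "a = {\<mu>\<in>M1. emb \<mu> \<in> V}" unfolding mem_Collect_eq openin_weak_topology_iff by metis
    have "open ((\<lambda>p. emb (T p)) -` V)" using cont V(1) by (simp add: continuous_on_open_vimage)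
    then have *: "D \<inter> (\<lambda>p. emb (T p)) -` V \<in> sets borel"
      by (rule sets.Int[OF borel_closed[OF \<open>closed D\<close>] borel_open])
    have eq: "{p\<in>D. T p \<in> a} = D \<inter> (\<lambda>p. emb (T p)) -` V"
      unfolding V(2) mem_Collect_eq D by blast
    show ?case unfolding eq by (rule *)
  next
    case (Compl a)
    have eq: "{p\<in>D. T p \<in> M1 - a} = D - {p\<in>D. T p \<in> a}" unfolding Diff_iff D by blast
    show ?case unfolding eq by (rule sets.Diff[OF borel_closed[OF \<open>closed D\<close>] Compl.IH])
  next
    case (Union a)
    have eq: "{p\<in>D. T p \<in> (\<Union>i. a i)} = (\<Union>i. {p\<in>D. T p \<in> a i})" by blast
    show ?case unfolding eq by (rule sets.countable_UN) (use Union.IH in blast)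
  qed simp
  have AM: "A \<subseteq> M1" using sets.sets_into_space[OF A] by (simp add: space_borel_of topspace_weak_topology)
  \<comment> \<open>Coordinates outside 1..n are set to fixed values, since nothing is assumed about
    the variables there.\<close>
  define F where "F \<omega> = ((\<lambda>i. if i \<in> {1..n} then w i \<omega> else 0), (\<lambda>i. if i \<in> {1..n} then x i \<omega> else undefined))" for \<omega>
  have F: "F \<in> borel_measurable M" unfolding F_def
  proof (intro borel_measurable_Pair measurable_coordinatewise_then_product)
    show "(\<lambda>\<omega>. if i \<in> {1..n} then w i \<omega> else 0) \<in> borel_measurable M" for i
      using w[of i] by (cases "i \<in> {1..n}") auto
    show "(\<lambda>\<omega>. if i \<in> {1..n} then x i \<omega> else undefined) \<in> borel_measurable M" for i
      using x[of i] by (cases "i \<in> {1..n}") auto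
  qed
  have TF: "weighted_empirical n (\<lambda>i. w i \<omega>) (\<lambda>i. x i \<omega>) = T (F \<omega>)" for \<omega>
    unfolding T_def F_def by (rule weighted_empirical_cong) auto
  have "{\<omega>\<in>space M. weighted_empirical n (\<lambda>i. w i \<omega>) (\<lambda>i. x i \<omega>) \<in> A} = F -` {p\<in>D. T p \<in> A} \<inter> space M"
    unfolding TF using AM D by blast
  also have "\<dots> \<in> sets M" by (rule measurable_sets[OF F B])
  finally show ?thesis .
qed

section \<open>The urn scheme and its exponential moments\<close>

definition urns :: "nat \<Rightarrow> nat \<Rightarrow> (nat \<Rightarrow> nat) pmf" where
  "urns n m = Pi_pmf {..<m} 0 (\<lambda>_. pmf_of_set {1..n})"

definition counts :: "nat \<Rightarrow> nat \<Rightarrow> (nat \<Rightarrow> nat) \<Rightarrow> nat \<Rightarrow> nat" where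
  "counts n m u = (\<lambda>i\<in>{1..n}. card {k\<in>{..<m}. u k = i})"

text \<open>This is the empirical measure of the m draws x (u k), k < m, as
  \<open>integral_resample\<close> shows; it is written with occupation numbers to match the weights
  W.\<close>

definition resample :: "nat \<Rightarrow> nat \<Rightarrow> (nat \<Rightarrow> nat) \<Rightarrow> (nat \<Rightarrow> 'a::topological_space) \<Rightarrow> 'a measure" where
  "resample n m u x = weighted_empirical n (\<lambda>i. real n / real m * real (counts n m u i)) x"

definition empirical :: "nat \<Rightarrow> (nat \<Rightarrow> 'a::topological_space) \<Rightarrow> 'a measure" where
  "empirical n x = weighted_empirical n (\<lambda>i. 1) x"

lemma mult_unif_pmf_counts: "mult_unif_pmf n m = map_pmf (counts n m) (urns n m)"
  unfolding mult_unif_pmf_def urns_def counts_def ..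

lemma set_urns:
  assumes "n \<ge> 1" "u \<in> set_pmf (urns n m)" "k < m" shows "u k \<in> {1..n}"
  using assms set_Pi_pmf_subset'[of "{..<m}" 0 "\<lambda>_. pmf_of_set {1..n}"]
  by (auto simp: urns_def PiE_dflt_def)

lemma finite_urns:
  assumes "n \<ge> 1" shows "finite (set_pmf (urns n m))"
proof -
  have "set_pmf (urns n m) \<subseteq> PiE_dflt {..<m} 0 (\<lambda>_. {1..n})"
    using assms set_Pi_pmf_subset'[of "{..<m}" 0 "\<lambda>_. pmf_of_set {1..n}"] by (simp add: urns_def o_def)
  moreover have "finite (PiE_dflt {..<m} (0::nat) (\<lambda>_. {1..n}))" by (intro finite_PiE_dflt) auto
  ultimately show ?thesis by (rule finite_subset)
qed

lemma sum_counts: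
  fixes g :: "nat \<Rightarrow> real"
  assumes "\<And>k. k < m \<Longrightarrow> u k \<in> {1..n}"
  shows "(\<Sum>i=1..n. real (counts n m u i) * g i) = (\<Sum>k<m. g (u k))"
proof -
  have "(\<Sum>k<m. g (u k)) = (\<Sum>i=1..n. \<Sum>k\<in>{k\<in>{..<m}. u k = i}. g (u k))"
    using assms by (intro sum.group[symmetric]) auto
  also have "\<dots> = (\<Sum>i=1..n. real (counts n m u i) * g i)"
    by (intro sum.cong refl) (simp add: counts_def)
  finally show ?thesis ..
qed

lemma resample_M1:
  assumes n: "n \<ge> 1" and m: "m \<ge> 1" and u: "\<And>k. k < m \<Longrightarrow> u k \<in> {1..n}"
  shows "resample n m u x \<in> M1"
proof -
  have "(\<Sum>i=1..n. max 0 (real n / real m * real (counts n m u i))) = (real n / real m) * (\<Sum>i=1..n. real (counts n m u i) * 1)"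
    by (simp add: sum_distrib_left max_absorb2)
  also have "(\<Sum>i=1..n. real (counts n m u i) * 1) = real m"
  proof (subst sum_counts)
    show "u k \<in> {1..n}" if "k < m" for k by (rule u[OF that])
  qed simp
  also have "real n / real m * real m = real n" using m by simp
  finally show ?thesis unfolding resample_def weighted_empirical_M1_iff[OF n] .
qed

lemma integral_resample:
  fixes f :: "'a::topological_space \<Rightarrow> real"
  assumes n: "n \<ge> 1" and m: "m \<ge> 1" and u: "\<And>k. k < m \<Longrightarrow> u k \<in> {1..n}"
    and f: "f \<in> borel_measurable borel"
  shows "real m * (\<integral>y. f y \<partial>(resample n m u x)) = (\<Sum>k<m. f (x (u k)))"
proof -
  have "real m * (\<integral>y. f y \<partial>(resample n m u x)) = (\<Sum>i=1..n. real (counts n m u i) * f (x i))"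
    unfolding resample_def integral_weighted_empirical[OF f] sum_distrib_left
    using n m by (intro sum.cong refl) (simp add: max_absorb2)
  also have "\<dots> = (\<Sum>k<m. f (x (u k)))" by (rule sum_counts[OF u])
  finally show ?thesis .
qed

lemma integral_resample_urns:
  fixes f :: "'a::topological_space \<Rightarrow> real"
  assumes n: "n \<ge> 1" and m: "m \<ge> 1" and u: "u \<in> set_pmf (urns n m)" and f: "f \<in> Cb"
  shows "(\<Sum>k<m. f (x (u k))) = real m * (\<integral>y. f y \<partial>(resample n m u x))"
  by (rule integral_resample[OF n m set_urns[OF n u] Cb_measurable[OF f], symmetric])

lemma empirical_M1: "n \<ge> 1 \<Longrightarrow> empirical n x \<in> M1"
  unfolding empirical_def by (simp add: weighted_empirical_M1_iff)

text \<open>The balls are independent under \<open>Pi_pmf\<close>, so the expectation of the product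
  factorizes, and x at a uniform urn has the empirical measure as its law.\<close>

lemma expectation_urns_exp:
  fixes f :: "'a::topological_space \<Rightarrow> real"
  assumes n: "n \<ge> 1" and f: "f \<in> borel_measurable borel"
  shows "measure_pmf.expectation (urns n m) (\<lambda>u. exp (\<Sum>k<m. f (x (u k)))) = (\<integral>y. exp (f y) \<partial>(empirical n x)) ^ m"
proof -
  have "measure_pmf.expectation (urns n m) (\<lambda>u. exp (\<Sum>k<m. f (x (u k))))
      = measure_pmf.expectation (urns n m) (\<lambda>u. \<Prod>k<m. exp (f (x (u k))))"
    by (simp add: exp_sum)
  also have "\<dots> = (\<Prod>k<m. measure_pmf.expectation (pmf_of_set {1..n}) (\<lambda>i. exp (f (x i))))"
    unfolding urns_def using n by (intro expectation_prod_Pi_pmf integrable_measure_pmf_finite) auto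
  also have "measure_pmf.expectation (pmf_of_set {1..n}) (\<lambda>i. exp (f (x i))) = (\<Sum>i=1..n. exp (f (x i))) / real n"
    using n by (subst integral_pmf_of_set) auto
  also have "\<dots> = (\<integral>y. exp (f y) \<partial>(empirical n x))"
    unfolding empirical_def using f by (subst integral_weighted_empirical) (auto simp: sum_divide_distrib)
  finally show ?thesis by simp
qed

text \<open>Chernoff bound, uniform over the sample: only the exponential moment under the empirical
  measure enters.\<close>

lemma resample_upper:
  fixes x :: "nat \<Rightarrow> 'a::topological_space"
  assumes n: "n \<ge> 1" and m: "m \<ge> 1" and f: "f \<in> Cb" and q: "(\<integral>y. exp (f y) \<partial>(empirical n x)) \<le> exp q"
  shows "measure_pmf.prob (urns n m) {u. p < (\<integral>y. f y \<partial>(resample n m u x))} \<le> exp (- real m * (p - q))"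
proof -
  have fm: "f \<in> borel_measurable borel" by (rule Cb_measurable[OF f])
  note int = integrable_measure_pmf_finite[OF finite_urns[OF n]]
  have "measure_pmf.prob (urns n m) {u. p < (\<integral>y. f y \<partial>(resample n m u x))}
      = measure_pmf.expectation (urns n m) (indicator {u. p < (\<integral>y. f y \<partial>(resample n m u x))})" by simp
  also have "\<dots> \<le> measure_pmf.expectation (urns n m) (\<lambda>u. exp (- real m * p) * exp (\<Sum>k<m. f (x (u k))))"
  proof (rule integral_mono_AE[OF int int], rule AE_pmfI)
    fix u assume u: "u \<in> set_pmf (urns n m)"
    have "exp (- real m * p) * exp (\<Sum>k<m. f (x (u k))) = exp (real m * ((\<integral>y. f y \<partial>(resample n m u x)) - p))"
      unfolding integral_resample_urns[OF n m u f]
      by (simp add: right_diff_distrib flip: exp_add)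
    also have "1 \<le> \<dots>" if "p < (\<integral>y. f y \<partial>(resample n m u x))" using that by simp
    finally show "indicator {u. p < (\<integral>y. f y \<partial>(resample n m u x))} u \<le> exp (- real m * p) * exp (\<Sum>k<m. f (x (u k)))"
      by (auto simp: indicator_def)
  qed
  also have "\<dots> = exp (- real m * p) * (\<integral>y. exp (f y) \<partial>(empirical n x)) ^ m"
    by (simp add: expectation_urns_exp[OF n fm])
  also have "\<dots> \<le> exp (- real m * p) * exp q ^ m"
    using integral_exp_pos[OF f empirical_M1[OF n], of x] q by (intro mult_left_mono power_mono) auto
  also have "\<dots> = exp (- real m * (p - q))"
    by (simp add: right_diff_distrib exp_of_nat_mult[symmetric] flip: exp_add)
  finally show ?thesis .
qed

text \<open>Exponential tilting by \<open>f\<close>. The deviations of the tilted sample are again controlled by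
  exponential moments under the empirical measure, so no law of large numbers is needed.\<close>

lemma resample_lower:
  fixes x :: "nat \<Rightarrow> 'a::topological_space" and c :: "('a \<Rightarrow> real) \<Rightarrow> real"
  assumes n: "n \<ge> 1" and m: "m \<ge> 1" and S: "finite S" "S \<subseteq> Cb" and f: "f \<in> S"
    and \<theta>: "\<theta> > 0" and \<beta>: "\<beta> \<ge> 0" and \<gamma>: "\<gamma> \<ge> 0"
    and up: "\<And>g s. g \<in> S \<Longrightarrow> s \<in> {1, -1} \<Longrightarrow>
      (\<integral>y. exp (f y + (s * \<theta> * (g y - c g) - \<theta> * \<epsilon>)) \<partial>(empirical n x)) \<le> \<beta>"
    and lo: "\<gamma> \<le> (\<integral>y. exp (f y) \<partial>(empirical n x))"
  shows "exp (- real m * (c f + \<epsilon>)) * (\<gamma> ^ m - 2 * real (card S) * \<beta> ^ m)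
    \<le> measure_pmf.prob (urns n m) {u. \<forall>g\<in>S. \<bar>(\<integral>y. g y \<partial>(resample n m u x)) - c g\<bar> < \<epsilon>}"
proof -
  define N where "N = {u. \<forall>g\<in>S. \<bar>(\<integral>y. g y \<partial>(resample n m u x)) - c g\<bar> < \<epsilon>}"
  define h where "h g s y = f y + (s * \<theta> * (g y - c g) - \<theta> * \<epsilon>)" for g s y
  have fC: "f \<in> Cb" using S f by blast
  have hC: "h g s \<in> Cb" if "g \<in> S" for g s unfolding h_def
    using that S fC by (intro Cb_add Cb_diff Cb_scale Cb_const) auto
  note int = integrable_measure_pmf_finite[OF finite_urns[OF n]]
  \<comment> \<open>If the draws are near the targets, the tilt is at most its target value plus
    \<epsilon>. Otherwise some g deviates by at least \<epsilon> with some sign s, and the tilt is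
    bounded by the exponential for h g s, whose exponent has the extra term m \<theta> (s (mean of g
    - c g) - \<epsilon>) \<ge> 0.\<close>
  have pw: "exp (\<Sum>k<m. f (x (u k))) \<le> exp (real m * (c f + \<epsilon>)) * indicator N u
      + (\<Sum>g\<in>S. \<Sum>s\<in>{1,-1}. exp (\<Sum>k<m. h g s (x (u k))))" if u: "u \<in> set_pmf (urns n m)" for u
  proof (cases "u \<in> N")
    case True
    then have "(\<integral>y. f y \<partial>(resample n m u x)) \<le> c f + \<epsilon>" using f by (auto simp: N_def abs_less_iff)
    then have "real m * (\<integral>y. f y \<partial>(resample n m u x)) \<le> real m * (c f + \<epsilon>)" by (intro mult_left_mono) auto
    then have "exp (\<Sum>k<m. f (x (u k))) \<le> exp (real m * (c f + \<epsilon>))"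
      unfolding integral_resample_urns[OF n m u fC] by simp
    moreover have "0 \<le> (\<Sum>g\<in>S. \<Sum>s\<in>{1,-1}. exp (\<Sum>k<m. h g s (x (u k))))" by (intro sum_nonneg) simp
    ultimately show ?thesis unfolding indicator_simps(1)[OF True] by linarith
  next
    case False
    then obtain g where g: "g \<in> S" "\<epsilon> \<le> \<bar>(\<integral>y. g y \<partial>(resample n m u x)) - c g\<bar>" 
      unfolding N_def mem_Collect_eq by (meson not_less)
    obtain s :: real where s: "s \<in> {1,-1}" "\<epsilon> \<le> s * ((\<integral>y. g y \<partial>(resample n m u x)) - c g)"
    proof (cases "(\<integral>y. g y \<partial>(resample n m u x)) - c g \<ge> 0")
      case True then show ?thesis using g(2) by (intro that[of 1]) auto
    next
      case False then show ?thesis using g(2) by (intro that[of "-1"]) auto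
    qed
    have gC: "g \<in> Cb" using g S by blast
    have "(\<Sum>k<m. h g s (x (u k))) = (\<Sum>k<m. f (x (u k))) + (s * \<theta> * ((\<Sum>k<m. g (x (u k))) - real m * c g) - real m * (\<theta> * \<epsilon>))"
      unfolding h_def by (simp add: sum.distrib sum_subtractf sum_distrib_left right_diff_distrib)
    also have "(\<Sum>k<m. g (x (u k))) = real m * (\<integral>y. g y \<partial>(resample n m u x))"
      by (rule integral_resample_urns[OF n m u gC])
    also have "s * \<theta> * (real m * (\<integral>y. g y \<partial>(resample n m u x)) - real m * c g) - real m * (\<theta> * \<epsilon>)
        = (real m * \<theta>) * (s * ((\<integral>y. g y \<partial>(resample n m u x)) - c g) - \<epsilon>)"
      by (simp add: algebra_simps)
    finally have "(\<Sum>k<m. f (x (u k))) \<le> (\<Sum>k<m. h g s (x (u k)))" using \<theta> s(2) by simp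
    then have "exp (\<Sum>k<m. f (x (u k))) \<le> exp (\<Sum>k<m. h g s (x (u k)))" by simp
    also have "\<dots> \<le> (\<Sum>s\<in>{1,-1}. exp (\<Sum>k<m. h g s (x (u k))))"
      using s(1) by (intro member_le_sum) auto
    also have "\<dots> \<le> (\<Sum>g\<in>S. \<Sum>s\<in>{1,-1}. exp (\<Sum>k<m. h g s (x (u k))))"
      using g(1) S(1) by (intro member_le_sum[where f="\<lambda>g. \<Sum>s\<in>{1,-1}. exp (\<Sum>k<m. h g s (x (u k)))"]) (auto intro: sum_nonneg)
    finally show ?thesis unfolding indicator_simps(2)[OF False] by linarith
  qed
  have "\<gamma> ^ m \<le> (\<integral>y. exp (f y) \<partial>(empirical n x)) ^ m" using \<gamma> lo by (intro power_mono)
  also have "\<dots> = measure_pmf.expectation (urns n m) (\<lambda>u. exp (\<Sum>k<m. f (x (u k))))"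
    by (rule expectation_urns_exp[OF n Cb_measurable[OF fC], symmetric])
  also have "\<dots> \<le> measure_pmf.expectation (urns n m) (\<lambda>u. exp (real m * (c f + \<epsilon>)) * indicator N u
      + (\<Sum>g\<in>S. \<Sum>s\<in>{1,-1}. exp (\<Sum>k<m. h g s (x (u k)))))"
    by (rule integral_mono_AE[OF int int], rule AE_pmfI) (rule pw)
  also have "\<dots> = exp (real m * (c f + \<epsilon>)) * measure_pmf.prob (urns n m) N
      + (\<Sum>g\<in>S. \<Sum>s\<in>{1,-1}. measure_pmf.expectation (urns n m) (\<lambda>u. exp (\<Sum>k<m. h g s (x (u k)))))"
    by (subst Bochner_Integration.integral_add[OF int int])
      (simp add: Bochner_Integration.integral_sum[OF int] Bochner_Integration.integral_add[OF int int])
  also have "(\<Sum>g\<in>S. \<Sum>s\<in>{1,-1}. measure_pmf.expectation (urns n m) (\<lambda>u. exp (\<Sum>k<m. h g s (x (u k)))))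
      \<le> (\<Sum>g\<in>S. \<Sum>s\<in>{1,-1::real}. \<beta> ^ m)"
  proof (intro sum_mono)
    fix g and s :: real assume gs: "g \<in> S" "s \<in> {1,-1}"
    have "measure_pmf.expectation (urns n m) (\<lambda>u. exp (\<Sum>k<m. h g s (x (u k)))) = (\<integral>y. exp (h g s y) \<partial>(empirical n x)) ^ m"
      by (rule expectation_urns_exp[OF n Cb_measurable[OF hC[OF gs(1)]]])
    also have "\<dots> \<le> \<beta> ^ m"
    proof (rule power_mono)
      show "(\<integral>y. exp (h g s y) \<partial>(empirical n x)) \<le> \<beta>" unfolding h_def by (rule up[OF gs])
      show "0 \<le> (\<integral>y. exp (h g s y) \<partial>(empirical n x))"
        by (rule less_imp_le[OF integral_exp_pos[OF hC[OF gs(1)] empirical_M1[OF n]]])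
    qed
    finally show "measure_pmf.expectation (urns n m) (\<lambda>u. exp (\<Sum>k<m. h g s (x (u k)))) \<le> \<beta> ^ m" .
  qed
  also have "(\<Sum>g\<in>S. \<Sum>s\<in>{1,-1::real}. \<beta> ^ m) = 2 * real (card S) * \<beta> ^ m" by simp
  finally have "\<gamma> ^ m - 2 * real (card S) * \<beta> ^ m \<le> exp (real m * (c f + \<epsilon>)) * measure_pmf.prob (urns n m) N" by simp
  then have "exp (- real m * (c f + \<epsilon>)) * (\<gamma> ^ m - 2 * real (card S) * \<beta> ^ m)
      \<le> exp (- real m * (c f + \<epsilon>)) * (exp (real m * (c f + \<epsilon>)) * measure_pmf.prob (urns n m) N)"
    by (intro mult_left_mono) auto
  also have "\<dots> = measure_pmf.prob (urns n m) N"
    by (simp add: mult.assoc[symmetric] flip: exp_add)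
  finally show ?thesis unfolding N_def .
qed

section \<open>The law of the weighted empirical measure\<close>

lemma measure_law_M1:
  fixes Y :: "'w \<Rightarrow> 'a::topological_space measure"
  assumes Y: "\<And>A. A \<in> sets (borel_of weak_topology) \<Longrightarrow> {\<omega>\<in>space M. Y \<omega> \<in> A} \<in> sets M"
    and A: "A \<in> sets (borel_of weak_topology)"
  shows "measure (law_M1 M Y) A = measure M {\<omega>\<in>space M. Y \<omega> \<in> A}"
proof -
  have eq: "Y -` B \<inter> space M = {\<omega>\<in>space M. Y \<omega> \<in> B}" for B by blast
  have "Y -` B \<inter> space M \<in> sets M" if "B \<in> sets (borel_of weak_topology)" for B
    unfolding eq by (rule Y[OF that])
  from emeasure_law_M1[of Y M, OF this A] show ?thesis by (simp add: measure_def eq)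
qed

lemma sets_law_M1: "sets (law_M1 M Y) = sets (borel_of weak_topology)"
  by (simp add: law_M1_def)

lemma space_law_M1: "space (law_M1 M (Y :: 'w \<Rightarrow> 'a::topological_space measure)) = M1"
  by (simp add: law_M1_def space_borel_of topspace_weak_topology)

lemma M1_in_borel_of: "(M1 :: 'a::topological_space measure set) \<in> sets (borel_of weak_topology)"
  using openin_borel_of[OF openin_topspace, of weak_topology] by (simp add: topspace_weak_topology)

section \<open>Conditioning on the sample\<close>

locale multinomial_weights = prob_space M for M :: "'w measure" +
  fixes m :: "nat \<Rightarrow> nat"
    and W :: "nat \<Rightarrow> nat \<Rightarrow> 'w \<Rightarrow> real"
    and X :: "nat \<Rightarrow> nat \<Rightarrow> 'w \<Rightarrow> 'a::polish_space"
  assumes m_pos: "\<And>n. n \<ge> 1 \<Longrightarrow> m n > 0"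
    and W_rv: "\<And>n i. n \<ge> 1 \<Longrightarrow> i \<in> {1..n} \<Longrightarrow> W n i \<in> borel_measurable M"
    and W_law: "\<And>n. n \<ge> 1 \<Longrightarrow>
      distr M (\<Pi>\<^sub>M i\<in>{1..n}. borel) (\<lambda>\<omega>. \<lambda>i\<in>{1..n}. real (m n) / real n * W n i \<omega>) =
      distr (measure_pmf (mult_unif_pmf n (m n))) (\<Pi>\<^sub>M i\<in>{1..n}. borel)
        (\<lambda>N. \<lambda>i\<in>{1..n}. real (N i))"
    and X_rv: "\<And>n i. n \<ge> 1 \<Longrightarrow> i \<in> {1..n} \<Longrightarrow> X n i \<in> borel_measurable M"
    and indep: "\<And>n. n \<ge> 1 \<Longrightarrow> indep_rv M
      (\<Pi>\<^sub>M i\<in>{1..n}. borel) (\<lambda>\<omega>. \<lambda>i\<in>{1..n}. X n i \<omega>)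
      (\<Pi>\<^sub>M i\<in>{1..n}. borel) (\<lambda>\<omega>. \<lambda>i\<in>{1..n}. W n i \<omega>)"
begin

definition L :: "nat \<Rightarrow> 'w \<Rightarrow> 'a measure" where
  "L n \<omega> = weighted_empirical n (\<lambda>i. W n i \<omega>) (\<lambda>i. X n i \<omega>)"

definition emp :: "nat \<Rightarrow> 'w \<Rightarrow> 'a measure" where
  "emp n \<omega> = weighted_empirical n (\<lambda>i. 1) (\<lambda>i. X n i \<omega>)"

text \<open>The conditional probability that the weighted measure lies in A given the sample,
  written down as an explicit function of the sample; \<open>prob_L\<close> is the
  justification.\<close>

definition Q :: "nat \<Rightarrow> 'a measure set \<Rightarrow> 'w \<Rightarrow> real" where
  "Q n A \<omega> = measure_pmf.prob (urns n (m n)) {u. resample n (m n) u (\<lambda>i. X n i \<omega>) \<in> A}"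

lemma emp_eq: "emp n \<omega> = empirical n (\<lambda>i. X n i \<omega>)"
  by (simp add: emp_def empirical_def)

lemma L_event: "n \<ge> 1 \<Longrightarrow> A \<in> sets (borel_of weak_topology) \<Longrightarrow> {\<omega>\<in>space M. L n \<omega> \<in> A} \<in> sets M"
  unfolding L_def by (rule measurable_weighted_empirical) (auto intro: W_rv X_rv)

lemma emp_event: "n \<ge> 1 \<Longrightarrow> A \<in> sets (borel_of weak_topology) \<Longrightarrow> {\<omega>\<in>space M. emp n \<omega> \<in> A} \<in> sets M"
  unfolding emp_def by (rule measurable_weighted_empirical) (auto intro: X_rv)

definition occ :: "nat \<Rightarrow> (nat \<Rightarrow> nat) pmf" where "occ n = mult_unif_pmf n (m n)"

definition occ_event :: "nat \<Rightarrow> (nat \<Rightarrow> nat) \<Rightarrow> 'w set" where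
  "occ_event n K = {\<omega>\<in>space M. \<forall>i\<in>{1..n}. W n i \<omega> = real n / real (m n) * real (K i)}"

definition reweighted :: "nat \<Rightarrow> (nat \<Rightarrow> nat) \<Rightarrow> (nat \<Rightarrow> 'a) \<Rightarrow> 'a measure" where
  "reweighted n K x = weighted_empirical n (\<lambda>i. real n / real (m n) * real (K i)) x"

lemma finite_occ: "n \<ge> 1 \<Longrightarrow> finite (set_pmf (occ n))"
  by (simp add: occ_def mult_unif_pmf_counts finite_urns)

text \<open>Occupation vectors are functions on all naturals, but the \<open>restrict\<close> in
  \<open>counts\<close> gives all of them the same value outside 1..n.\<close>

lemma occ_eqI:
  assumes "K \<in> set_pmf (occ n)" "K' \<in> set_pmf (occ n)" "\<And>i. i \<in> {1..n} \<Longrightarrow> K i = K' i"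
  shows "K = K'"
proof -
  obtain u u' where "K = counts n (m n) u" "K' = counts n (m n) u'"
    using assms(1,2) by (auto simp: occ_def mult_unif_pmf_counts)
  then show ?thesis using assms(3) unfolding counts_def by (intro ext) (metis restrict_apply)
qed

lemma occ_event_vimage:
  "occ_event n K = (\<lambda>\<omega>. \<lambda>i\<in>{1..n}. W n i \<omega>) -` (\<Pi>\<^sub>E i\<in>{1..n}. {real n / real (m n) * real (K i)}) \<inter> space M"
  unfolding occ_event_def by (auto simp: PiE_iff)

text \<open>The equality of laws is evaluated on a product of singletons, which is a measurable
  rectangle; within the support of the multinomial law it contains only K.\<close>

lemma prob_occ_event:
  assumes n: "n \<ge> 1" and K: "K \<in> set_pmf (occ n)"
  shows "prob (occ_event n K) = pmf (occ n) K"
proof -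
  define B where "B = (\<Pi>\<^sub>E i\<in>{1..n}. {real (K i)})"
  define F where "F = (\<lambda>\<omega>. \<lambda>i\<in>{1..n}. real (m n) / real n * W n i \<omega>)"
  define G where "G = (\<lambda>N::nat \<Rightarrow> nat. \<lambda>i\<in>{1..n}. real (N i))"
  have B: "B \<in> sets (\<Pi>\<^sub>M i\<in>{1..n}. borel)" unfolding B_def by (rule sets_PiM_I_finite) auto
  have F: "F \<in> measurable M (\<Pi>\<^sub>M i\<in>{1..n}. borel)" unfolding F_def
  proof (rule measurable_restrict)
    fix i assume "i \<in> {1..n}"
    note [measurable] = W_rv[OF n this]
    show "(\<lambda>\<omega>. real (m n) / real n * W n i \<omega>) \<in> borel_measurable M" by measurable
  qed
  have G: "G \<in> measurable (measure_pmf (occ n)) (\<Pi>\<^sub>M i\<in>{1..n}. borel)"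
    unfolding G_def by (simp add: space_PiM PiE_iff)
  have nm: "real n > 0" "real (m n) > 0" using n m_pos[OF n] by auto
  have *: "real (m n) / real n * w = k \<longleftrightarrow> w = real n / real (m n) * k" for w k
    using nm by (auto simp: field_simps)
  have "occ_event n K = F -` B \<inter> space M"
  proof -
    have "F \<omega> \<in> B \<longleftrightarrow> (\<forall>i\<in>{1..n}. real (m n) / real n * W n i \<omega> = real (K i))" for \<omega>
      unfolding F_def B_def PiE_iff by simp
    then show ?thesis unfolding occ_event_def * by blast
  qed
  then have "prob (occ_event n K) = measure (distr M (\<Pi>\<^sub>M i\<in>{1..n}. borel) F) B"
    by (simp only: measure_distr[OF F B])
  also have "\<dots> = measure (distr (measure_pmf (occ n)) (\<Pi>\<^sub>M i\<in>{1..n}. borel) G) B"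
    using W_law[OF n] unfolding F_def G_def occ_def by simp
  also have "\<dots> = measure_pmf.prob (occ n) (G -` B)"
    unfolding measure_distr[OF G B] by simp
  also have "\<dots> = measure_pmf.prob (occ n) {K}"
  proof (rule measure_pmf.finite_measure_eq_AE)
    show "AE K' in measure_pmf (occ n). K' \<in> G -` B \<longleftrightarrow> K' \<in> {K}"
    proof (rule AE_pmfI)
      fix K' assume K': "K' \<in> set_pmf (occ n)"
      have "K' \<in> G -` B \<longleftrightarrow> (\<forall>i\<in>{1..n}. K' i = K i)" by (auto simp: G_def B_def PiE_iff)
      also have "\<dots> \<longleftrightarrow> K' = K" using occ_eqI[OF K' K] by auto
      finally show "K' \<in> G -` B \<longleftrightarrow> K' \<in> {K}" by simp
    qed
  qed auto
  finally show ?thesis by (simp add: measure_pmf_single)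
qed

lemma occ_event_sets:
  assumes n: "n \<ge> 1" shows "occ_event n K \<in> sets M"
proof -
  have "(\<lambda>\<omega>. \<lambda>i\<in>{1..n}. W n i \<omega>) \<in> measurable M (\<Pi>\<^sub>M i\<in>{1..n}. borel)"
    by (rule measurable_restrict) (rule W_rv[OF n])
  then show ?thesis unfolding occ_event_vimage
    by (rule measurable_sets) (rule sets_PiM_I_finite, auto)
qed

text \<open>Once K is fixed, the event depends on the sample alone: it is the preimage of a set of
  the product space. It is therefore independent of the event that the weights are those given by
  K.\<close>

lemma reweighted_event:
  assumes n: "n \<ge> 1" and A: "A \<in> sets (borel_of weak_topology)"
  shows "{\<omega>\<in>space M. reweighted n K (\<lambda>i. X n i \<omega>) \<in> A} \<in> sets M"
    and "prob ({\<omega>\<in>space M. reweighted n K (\<lambda>i. X n i \<omega>) \<in> A} \<inter> occ_event n K)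
      = prob {\<omega>\<in>space M. reweighted n K (\<lambda>i. X n i \<omega>) \<in> A} * prob (occ_event n K)"
proof -
  define X' where "X' = (\<lambda>\<omega>. \<lambda>i\<in>{1..n}. X n i \<omega>)"
  define B where "B = {x\<in>space (\<Pi>\<^sub>M i\<in>{1..n}. (borel :: 'a measure)). reweighted n K x \<in> A}"
  have B: "B \<in> sets (\<Pi>\<^sub>M i\<in>{1..n}. borel)"
    unfolding B_def reweighted_def
    by (rule measurable_weighted_empirical[OF n _ _ A]) auto
  have "{\<omega>\<in>space M. reweighted n K (\<lambda>i. X n i \<omega>) \<in> A} = X' -` B \<inter> space M"
  proof -
    have "X' \<omega> \<in> space (\<Pi>\<^sub>M i\<in>{1..n}. (borel :: 'a measure))" for \<omega> by (simp add: X'_def space_PiM PiE_iff)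
    moreover have "reweighted n K (X' \<omega>) = reweighted n K (\<lambda>i. X n i \<omega>)" for \<omega>
      unfolding reweighted_def by (rule weighted_empirical_cong) (simp_all add: X'_def)
    ultimately show ?thesis unfolding B_def by auto
  qed
  then have X1: "{\<omega>\<in>space M. reweighted n K (\<lambda>i. X n i \<omega>) \<in> A} \<in> {X' -` A \<inter> space M | A. A \<in> sets (\<Pi>\<^sub>M i\<in>{1..n}. borel)}"
    using B by blast
  have W1: "occ_event n K \<in> {(\<lambda>\<omega>. \<lambda>i\<in>{1..n}. W n i \<omega>) -` B \<inter> space M | B. B \<in> sets (\<Pi>\<^sub>M i\<in>{1..n}. borel)}"
  proof -
    have "(\<Pi>\<^sub>E i\<in>{1..n}. {real n / real (m n) * real (K i)}) \<in> sets (\<Pi>\<^sub>M i\<in>{1..n}. borel)"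
      by (rule sets_PiM_I_finite) auto
    then show ?thesis unfolding occ_event_vimage by blast
  qed
  have ind: "indep_set {X' -` A \<inter> space M | A. A \<in> sets (\<Pi>\<^sub>M i\<in>{1..n}. borel)}
     {(\<lambda>\<omega>. \<lambda>i\<in>{1..n}. W n i \<omega>) -` B \<inter> space M | B. B \<in> sets (\<Pi>\<^sub>M i\<in>{1..n}. borel)}"
    using indep[OF n] unfolding indep_rv_def X'_def by blast
  show "{\<omega>\<in>space M. reweighted n K (\<lambda>i. X n i \<omega>) \<in> A} \<in> sets M"
    using indep_setD_ev1[OF ind] X1 by blast
  show "prob ({\<omega>\<in>space M. reweighted n K (\<lambda>i. X n i \<omega>) \<in> A} \<inter> occ_event n K)
      = prob {\<omega>\<in>space M. reweighted n K (\<lambda>i. X n i \<omega>) \<in> A} * prob (occ_event n K)"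
    by (rule indep_setD[OF ind X1 W1])
qed

lemma Q_eq_sum:
  assumes n: "n \<ge> 1"
  shows "Q n A \<omega> = (\<Sum>K\<in>set_pmf (occ n). pmf (occ n) K * indicator {K. reweighted n K (\<lambda>i. X n i \<omega>) \<in> A} K)"
proof -
  have "Q n A \<omega> = measure_pmf.prob (occ n) {K. reweighted n K (\<lambda>i. X n i \<omega>) \<in> A}"
    unfolding Q_def occ_def mult_unif_pmf_counts measure_map_pmf
    by (simp add: vimage_def resample_def reweighted_def)
  also have "\<dots> = measure_pmf.expectation (occ n) (indicator {K. reweighted n K (\<lambda>i. X n i \<omega>) \<in> A})" by simp
  also have "\<dots> = (\<Sum>K\<in>set_pmf (occ n). indicator {K. reweighted n K (\<lambda>i. X n i \<omega>) \<in> A} K * pmf (occ n) K)"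
    by (rule integral_measure_pmf_real[OF finite_occ[OF n]])
  finally show ?thesis by (simp add: mult.commute)
qed

lemma integrable_Q:
  assumes n: "n \<ge> 1" and A: "A \<in> sets (borel_of weak_topology)"
  shows "integrable M (Q n A)"
    and "expectation (Q n A) = (\<Sum>K\<in>set_pmf (occ n). pmf (occ n) K * prob {\<omega>\<in>space M. reweighted n K (\<lambda>i. X n i \<omega>) \<in> A})"
proof -
  define T where "T K = {\<omega>\<in>space M. reweighted n K (\<lambda>i. X n i \<omega>) \<in> A}" for K
  have T: "T K \<in> sets M" for K unfolding T_def by (rule reweighted_event[OF n A])
  have eq: "Q n A \<omega> = (\<Sum>K\<in>set_pmf (occ n). pmf (occ n) K * indicator (T K) \<omega>)" if "\<omega> \<in> space M" for \<omega>
    unfolding Q_eq_sum[OF n] using that by (intro sum.cong refl) (simp add: T_def indicator_def)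
  have i: "integrable M (\<lambda>\<omega>. pmf (occ n) K * indicator (T K) \<omega>)" for K
    using T by (intro integrable_mult_right) (simp add: less_top[symmetric])
  have "integrable M (\<lambda>\<omega>. \<Sum>K\<in>set_pmf (occ n). pmf (occ n) K * indicator (T K) \<omega>)"
    by (intro Bochner_Integration.integrable_sum i)
  then show "integrable M (Q n A)" by (subst Bochner_Integration.integrable_cong[OF refl eq])
  have "expectation (Q n A) = (\<integral>\<omega>. (\<Sum>K\<in>set_pmf (occ n). pmf (occ n) K * indicator (T K) \<omega>) \<partial>M)"
    by (intro Bochner_Integration.integral_cong refl eq)
  also have "\<dots> = (\<Sum>K\<in>set_pmf (occ n). pmf (occ n) K * prob (T K))"
    using i T by (simp add: Bochner_Integration.integral_sum)
  finally show "expectation (Q n A) = (\<Sum>K\<in>set_pmf (occ n). pmf (occ n) K * prob {\<omega>\<in>space M. reweighted n K (\<lambda>i. X n i \<omega>) \<in> A})"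
    unfolding T_def .
qed

text \<open>Fubini reduced to finite sums. Up to a null set the space is the disjoint union of the
  events \<open>occ_event n K\<close>; on each of them \<open>L n\<close> equals
  \<open>reweighted n K\<close>, and independence factorizes the probability.\<close>

theorem prob_L:
  assumes n: "n \<ge> 1" and A: "A \<in> sets (borel_of weak_topology)"
  shows "prob {\<omega>\<in>space M. L n \<omega> \<in> A} = expectation (Q n A)"
proof -
  define S where "S = {\<omega>\<in>space M. L n \<omega> \<in> A}"
  define T where "T K = {\<omega>\<in>space M. reweighted n K (\<lambda>i. X n i \<omega>) \<in> A}" for K
  have S: "S \<in> sets M" unfolding S_def by (rule L_event[OF n A])
  have E: "occ_event n K \<in> sets M" for K by (rule occ_event_sets[OF n])
  have fin: "finite (set_pmf (occ n))" by (rule finite_occ[OF n])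
  have nm: "real n / real (m n) \<noteq> 0" using n m_pos[OF n] by simp
  have disj: "disjoint_family_on (occ_event n) (set_pmf (occ n))"
    unfolding disjoint_family_on_def
  proof (intro ballI impI)
    fix K K' assume K: "K \<in> set_pmf (occ n)" "K' \<in> set_pmf (occ n)" "K \<noteq> K'"
    show "occ_event n K \<inter> occ_event n K' = {}"
    proof (rule ccontr)
      assume "occ_event n K \<inter> occ_event n K' \<noteq> {}"
      then obtain \<omega> where "\<omega> \<in> occ_event n K" "\<omega> \<in> occ_event n K'" by blast
      then have "real n / real (m n) * real (K i) = real n / real (m n) * real (K' i)" if "i \<in> {1..n}" for i
        using that unfolding occ_event_def by auto
      then have "K i = K' i" if "i \<in> {1..n}" for i using that nm by (metis mult_left_cancel of_nat_eq_iff)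
      then show False using occ_eqI[OF K(1,2)] K(3) by blast
    qed
  qed
  define U where "U = (\<Union>K\<in>set_pmf (occ n). occ_event n K)"
  have U: "U \<in> sets M" unfolding U_def using fin E by (intro sets.finite_UN) auto
  have "prob U = (\<Sum>K\<in>set_pmf (occ n). prob (occ_event n K))"
    unfolding U_def using E by (intro finite_measure_finite_Union[OF fin _ disj]) auto
  also have "\<dots> = (\<Sum>K\<in>set_pmf (occ n). pmf (occ n) K)" by (intro sum.cong refl prob_occ_event n)
  also have "\<dots> = 1" by (rule sum_pmf_eq_1[OF fin]) simp
  finally have "AE \<omega> in M. \<omega> \<in> U" using U by (simp add: prob_eq_1)
  then have "prob S = prob (S \<inter> U)" using S U by (intro finite_measure_eq_AE) (auto elim!: eventually_mono)
  also have "S \<inter> U = (\<Union>K\<in>set_pmf (occ n). T K \<inter> occ_event n K)"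
  proof -
    have "S \<inter> occ_event n K = T K \<inter> occ_event n K" for K
    proof -
      have "L n \<omega> = reweighted n K (\<lambda>i. X n i \<omega>)" if "\<omega> \<in> occ_event n K" for \<omega>
        using that unfolding L_def reweighted_def occ_event_def by (intro weighted_empirical_cong) auto
      then show ?thesis unfolding S_def T_def by auto
    qed
    then show ?thesis unfolding U_def by blast
  qed
  also have "prob \<dots> = (\<Sum>K\<in>set_pmf (occ n). prob (T K \<inter> occ_event n K))"
  proof (rule finite_measure_finite_Union[OF fin])
    show "disjoint_family_on (\<lambda>K. T K \<inter> occ_event n K) (set_pmf (occ n))"
      using disj unfolding disjoint_family_on_def by blast
    have "T K \<in> sets M" for K unfolding T_def by (rule reweighted_event[OF n A])
    then show "(\<lambda>K. T K \<inter> occ_event n K) ` set_pmf (occ n) \<subseteq> sets M" using E by blast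
  qed
  also have "\<dots> = (\<Sum>K\<in>set_pmf (occ n). pmf (occ n) K * prob (T K))"
    unfolding T_def by (intro sum.cong refl) (simp add: reweighted_event(2)[OF n A] prob_occ_event[OF n])
  also have "\<dots> = expectation (Q n A)" unfolding integrable_Q(2)[OF n A] T_def ..
  finally show ?thesis unfolding S_def .
qed

definition P :: "nat \<Rightarrow> 'a measure set \<Rightarrow> real" where "P n A = measure (law_M1 M (L n)) A"

definition PX :: "nat \<Rightarrow> 'a measure set \<Rightarrow> real" where "PX n A = measure (law_M1 M (emp n)) A"

lemma P_eq: "n \<ge> 1 \<Longrightarrow> A \<in> sets (borel_of weak_topology) \<Longrightarrow> P n A = expectation (Q n A)"
  unfolding P_def by (simp add: measure_law_M1 L_event prob_L)

lemma PX_eq: "n \<ge> 1 \<Longrightarrow> A \<in> sets (borel_of weak_topology) \<Longrightarrow> PX n A = prob {\<omega>\<in>space M. emp n \<omega> \<in> A}"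
  unfolding PX_def by (simp add: measure_law_M1 emp_event)

lemma Q_M1: "n \<ge> 1 \<Longrightarrow> Q n M1 \<omega> = 1"
proof -
  assume n: "n \<ge> 1"
  have "Q n M1 \<omega> = measure_pmf.prob (urns n (m n)) UNIV"
    unfolding Q_def
  proof (rule measure_pmf.finite_measure_eq_AE)
    show "AE u in measure_pmf (urns n (m n)). u \<in> {u. resample n (m n) u (\<lambda>i. X n i \<omega>) \<in> M1} \<longleftrightarrow> u \<in> UNIV"
      using m_pos[OF n] n by (intro AE_pmfI) (auto intro!: resample_M1 dest: set_urns[OF n])
  qed auto
  then show ?thesis by simp
qed

text \<open>The weights sum to n only almost surely, so \<open>L n\<close> may leave
  \<open>M1\<close> on a null set. The total mass is therefore computed through \<open>Q\<close>,
  where every draw in the support has total weight n.\<close>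

lemma prob_space_law_L:
  assumes n: "n \<ge> 1" shows "prob_space (law_M1 M (L n))"
proof -
  have "measure (law_M1 M (L n)) M1 = 1"
    using P_eq[OF n M1_in_borel_of] unfolding P_def by (simp add: Q_M1[OF n] prob_space cong: Bochner_Integration.integral_cong)
  then have "emeasure (law_M1 M (L n)) (space (law_M1 M (L n))) = 1"
    unfolding space_law_M1 measure_def
    by (cases "emeasure (law_M1 M (L n)) M1") auto
  then show ?thesis by (rule prob_spaceI)
qed

text \<open>Integrates a conditional bound that depends on the neighbourhood containing the sample
  measure; on the exceptional set F the conditional probability is estimated by 1.\<close>

lemma P_upper:
  assumes n: "n \<ge> 1" and A: "A \<in> sets (borel_of weak_topology)"
    and J: "finite J" and V: "\<And>j. j \<in> J \<Longrightarrow> V j \<in> sets (borel_of weak_topology)"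
    and F: "F \<in> sets (borel_of weak_topology)"
    and cover: "\<And>\<omega>. \<omega> \<in> space M \<Longrightarrow> emp n \<omega> \<in> (\<Union>j\<in>J. V j) \<union> F"
    and bound: "\<And>j \<omega>. j \<in> J \<Longrightarrow> \<omega> \<in> space M \<Longrightarrow> emp n \<omega> \<in> V j \<Longrightarrow> Q n A \<omega> \<le> c j"
    and c: "\<And>j. j \<in> J \<Longrightarrow> 0 \<le> c j"
  shows "P n A \<le> (\<Sum>j\<in>J. c j * PX n (V j)) + PX n F"
proof -
  define E where "E B = {\<omega>\<in>space M. emp n \<omega> \<in> B}" for B
  have E: "B \<in> sets (borel_of weak_topology) \<Longrightarrow> E B \<in> sets M" for B
    unfolding E_def by (rule emp_event[OF n])
  have i: "integrable M (indicator (E B) :: 'w \<Rightarrow> real)" if "B \<in> sets (borel_of weak_topology)" for B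
    using E[OF that] by (simp add: less_top[symmetric])
  have Q1: "Q n A \<omega> \<le> 1" for \<omega> unfolding Q_def by simp
  have "P n A = expectation (Q n A)" by (rule P_eq[OF n A])
  also have "\<dots> \<le> expectation (\<lambda>\<omega>. (\<Sum>j\<in>J. c j * indicator (E (V j)) \<omega>) + indicator (E F) \<omega>)"
  proof (rule integral_mono)
    show "integrable M (Q n A)" by (rule integrable_Q[OF n A])
    show "integrable M (\<lambda>\<omega>. (\<Sum>j\<in>J. c j * indicator (E (V j)) \<omega>) + indicator (E F) \<omega>)"
      by (intro Bochner_Integration.integrable_add Bochner_Integration.integrable_sum integrable_mult_right i V F)
    fix \<omega> assume \<omega>: "\<omega> \<in> space M"
    have nn: "0 \<le> (\<Sum>j\<in>J. c j * indicator (E (V j)) \<omega> :: real)" by (intro sum_nonneg mult_nonneg_nonneg c) auto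
    consider j where "j \<in> J" "emp n \<omega> \<in> V j" | "emp n \<omega> \<in> F" using cover[OF \<omega>] by blast
    then show "Q n A \<omega> \<le> (\<Sum>j\<in>J. c j * indicator (E (V j)) \<omega>) + indicator (E F) \<omega>"
    proof cases
      case 1
      have "Q n A \<omega> \<le> c j * indicator (E (V j)) \<omega>" using bound[OF 1(1) \<omega> 1(2)] \<omega> 1 by (simp add: E_def)
      also have "\<dots> \<le> (\<Sum>j\<in>J. c j * indicator (E (V j)) \<omega>)"
        using 1(1) J c by (intro member_le_sum[where f="\<lambda>j. c j * indicator (E (V j)) \<omega>"]) auto
      finally show ?thesis by (simp add: add_increasing2)
    next
      case 2
      then show ?thesis using Q1[of \<omega>] nn \<omega> by (simp add: E_def)
    qed
  qed
  also have "\<dots> = (\<Sum>j\<in>J. c j * prob (E (V j))) + prob (E F)"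
    using i V F E by (simp add: Bochner_Integration.integral_sum Bochner_Integration.integral_add)
  also have "\<dots> = (\<Sum>j\<in>J. c j * PX n (V j)) + PX n F"
    unfolding E_def by (simp add: PX_eq[OF n] V F)
  finally show ?thesis .
qed

lemma P_lower:
  assumes n: "n \<ge> 1" and A: "A \<in> sets (borel_of weak_topology)" and V: "V \<in> sets (borel_of weak_topology)"
    and bound: "\<And>\<omega>. \<omega> \<in> space M \<Longrightarrow> emp n \<omega> \<in> V \<Longrightarrow> c \<le> Q n A \<omega>"
  shows "c * PX n V \<le> P n A"
proof -
  define E where "E = {\<omega>\<in>space M. emp n \<omega> \<in> V}"
  have E: "E \<in> sets M" unfolding E_def by (rule emp_event[OF n V])
  have Q0: "0 \<le> Q n A \<omega>" for \<omega> unfolding Q_def by simp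
  have "c * PX n V = expectation (\<lambda>\<omega>. c * indicator E \<omega>)"
    using E by (simp add: PX_eq[OF n V] E_def[symmetric])
  also have "\<dots> \<le> expectation (Q n A)"
  proof (rule integral_mono)
    show "integrable M (\<lambda>\<omega>. c * indicator E \<omega>)" using E by (intro integrable_mult_right) (simp add: less_top[symmetric])
    show "integrable M (Q n A)" by (rule integrable_Q[OF n A])
    show "c * indicator E \<omega> \<le> Q n A \<omega>" if "\<omega> \<in> space M" for \<omega>
      using bound[OF that] Q0[of \<omega>] that by (simp add: E_def indicator_def)
  qed
  also have "\<dots> = P n A" by (rule P_eq[OF n A, symmetric])
  finally show ?thesis .
qed

end

section \<open>Exponential tilting\<close>

text \<open>The derivative 1 + ln y is at most 1 + ln N in modulus on this interval. The proof uses
  ln t \<le> t - 1 in place of the mean value theorem.\<close>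

lemma xlnx_lipschitz:
  fixes a b N :: real
  assumes N: "N \<ge> 1" and a: "1 / N \<le> a" "a \<le> N" and b: "1 / N \<le> b" "b \<le> N"
  shows "\<bar>a * ln a - b * ln b\<bar> \<le> (1 + ln N) * \<bar>a - b\<bar>"
proof -
  have N0: "0 < 1 / N" using N by simp
  have *: "\<bar>a * ln a - b * ln b\<bar> \<le> (1 + ln N) * \<bar>a - b\<bar>"
    if a: "1 / N \<le> a" "a \<le> N" and b: "1 / N \<le> b" and ba: "b \<le> a" for a b
  proof -
    have p: "a > 0" "b > 0" using a b N0 by linarith+
    have "ln a \<le> ln N" using a p N by (subst ln_le_cancel_iff) auto
    moreover have "ln (1 / N) \<le> ln a" using a p N by (subst ln_le_cancel_iff) auto
    then have "- ln N \<le> ln a" using N by (simp add: ln_div)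
    ultimately have la: "\<bar>ln a\<bar> \<le> ln N" by linarith
    have "ln b \<le> ln a" using ba p by (subst ln_le_cancel_iff) auto
    then have 1: "0 \<le> b * (ln a - ln b)" using p by simp
    have "ln (a / b) \<le> a / b - 1" using p by (intro ln_le_minus_one) simp
    then have "ln a - ln b \<le> a / b - 1" using p by (simp add: ln_div)
    then have "b * (ln a - ln b) \<le> b * (a / b - 1)" using p by (intro mult_left_mono) auto
    also have "\<dots> = a - b" using p by (simp add: right_diff_distrib)
    finally have 2: "\<bar>b * (ln a - ln b)\<bar> \<le> \<bar>a - b\<bar>" using 1 by linarith
    have "a * ln a - b * ln b = ln a * (a - b) + b * (ln a - ln b)" by (simp add: algebra_simps)
    then have "\<bar>a * ln a - b * ln b\<bar> \<le> \<bar>ln a\<bar> * \<bar>a - b\<bar> + \<bar>b * (ln a - ln b)\<bar>"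
      using abs_triangle_ineq[of "ln a * (a - b)" "b * (ln a - ln b)"] by (simp add: abs_mult)
    also have "\<dots> \<le> ln N * \<bar>a - b\<bar> + \<bar>a - b\<bar>" using la 2 by (intro add_mono mult_right_mono) auto
    finally show ?thesis by (simp add: algebra_simps)
  qed
  show ?thesis
  proof (cases "b \<le> a")
    case True then show ?thesis using * a b by blast
  next
    case False
    then have "\<bar>b * ln b - a * ln a\<bar> \<le> (1 + ln N) * \<bar>b - a\<bar>" using *[of b a] a b by simp
    then show ?thesis by (simp add: abs_minus_commute)
  qed
qed

text \<open>The linear term is exact, so that the mean of a centred function cancels in
  \<open>lower\<close>. For x = -y < 0 the bound rests on (1 - y + y^2) (1 + y) = 1 + y^3.\<close>

lemma exp_le_quadratic:
  fixes x :: real assumes "\<bar>x\<bar> \<le> 1" shows "exp x \<le> 1 + x + x\<^sup>2"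
proof (cases "x \<ge> 0")
  case True then show ?thesis using assms exp_bound[of x] by simp
next
  case False
  define y where "y = - x"
  have y: "y > 0" using False by (simp add: y_def)
  have "1 \<le> (1 - y + y\<^sup>2) * (1 + y)"
  proof -
    have "(1 - y + y\<^sup>2) * (1 + y) = 1 + y ^ 3" by (simp add: power2_eq_square power3_eq_cube algebra_simps)
    then show ?thesis using y by simp
  qed
  also have "\<dots> \<le> (1 - y + y\<^sup>2) * exp y"
  proof (rule mult_left_mono)
    have "y\<^sup>2 + 1 - y = (y - 1/2)\<^sup>2 + 3/4" by (simp add: power2_eq_square algebra_simps)
    then show "0 \<le> 1 - y + y\<^sup>2" using zero_le_power2[of "y - 1/2"] by linarith
  qed (rule exp_ge_add_one_self)
  finally have "exp (- y) * 1 \<le> exp (- y) * ((1 - y + y\<^sup>2) * exp y)" by (intro mult_left_mono) auto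
  also have "\<dots> = 1 - y + y\<^sup>2" by (simp add: exp_minus)
  finally show ?thesis by (simp add: y_def)
qed

text \<open>f is the normalized logarithm of a continuous k that approximates the density and has
  positive bounds from both sides. The measure e^f d\<zeta> then nearly reproduces \<nu> on S, and
  its entropy relative to \<zeta>, which is the integral of e^f f, is near H.\<close>

lemma tilted_approximation:
  fixes \<nu> \<zeta> :: "'a::polish_space measure"
  assumes \<nu>: "\<nu> \<in> M1" and \<zeta>: "\<zeta> \<in> M1" and H: "rel_entropy \<nu> \<zeta> = ereal H"
    and S: "finite S" "S \<subseteq> Cb" and \<epsilon>: "\<epsilon> > 0"
  obtains f where "f \<in> Cb" "(\<integral>x. exp (f x) \<partial>\<zeta>) = 1"
    "\<And>g. g \<in> S \<Longrightarrow> \<bar>(\<integral>x. exp (f x) * g x \<partial>\<zeta>) - (\<integral>x. g x \<partial>\<nu>)\<bar> < \<epsilon>"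
    "(\<integral>x. exp (f x) * f x \<partial>\<zeta>) < H + \<epsilon>"
proof -
  interpret \<zeta>: prob_space \<zeta> by (rule M1_prob[OF \<zeta>])
  interpret \<nu>: prob_space \<nu> by (rule M1_prob[OF \<nu>])
  have meq: "borel_measurable \<zeta> = (borel_measurable borel :: ('a \<Rightarrow> real) set)"
    by (rule measurable_cong_sets[OF M1_sets[OF \<zeta>] refl])
  obtain h where h: "h \<in> borel_measurable borel" "\<And>x. 0 \<le> h x"
    "\<nu> = density \<zeta> (\<lambda>x. ennreal (h x))" and lnh: "integrable \<nu> (\<lambda>x. ln (h x))"
    "rel_entropy \<nu> \<zeta> = ereal (\<integral>x. ln (h x) \<partial>\<nu>)"
    using rel_entropy_finiteE[OF \<nu> \<zeta>] H by (metis PInfty_neq_ereal(1))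
  note [measurable] = h(1)
  have hi: "integrable \<zeta> h" "(\<integral>x. h x \<partial>\<zeta>) = 1"
    using integral_density_M1[OF \<zeta> h, of "\<lambda>_. 1"] by (simp_all add: \<nu>.prob_space)
  have pm: "(\<lambda>x. ln (h x)) \<in> borel_measurable borel" by measurable
  have phi: "integrable \<zeta> (\<lambda>x. h x * ln (h x))" "(\<integral>x. h x * ln (h x) \<partial>\<zeta>) = H"
    using integral_density_M1[OF \<zeta> h pm] lnh H by simp_all
  \<comment> \<open>The offset gives N > 1, hence 1/N < N, for every n including 0.\<close>
  define N where "N n = real n + 2" for n
  have N: "N n \<ge> 2" for n by (simp add: N_def)
  have N1: "N n \<ge> 1" for n using N[of n] by linarith
  have N0: "0 < 1 / N n" "1 / N n < N n" for n
  proof -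
    show "0 < 1 / N n" using N[of n] by simp
    have "1 / N n \<le> 1" using N1[of n] by simp
    then show "1 / N n < N n" using N[of n] by linarith
  qed
  define hN where "hN n x = max (1 / N n) (min (N n) (h x))" for n x
  have hN: "1 / N n \<le> hN n x" "hN n x \<le> N n" for n x using N0[of n] by (auto simp: hN_def)
  have hNm: "hN n \<in> borel_measurable borel" for n unfolding hN_def by measurable
  \<comment> \<open>The precision 1/N^2 compensates the Lipschitz constant 1 + ln N \<le> N of y ln
    y on the range of k, which leaves an error 1/N in the entropy.\<close>
  have "\<exists>k. continuous_on UNIV k \<and> (\<forall>x. 1 / N n \<le> k x \<and> k x \<le> N n) \<and> (\<integral>x. \<bar>k x - hN n x\<bar> \<partial>\<zeta>) < 1 / (N n)\<^sup>2" for n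
  proof -
    have "0 < 1 / (N n)\<^sup>2" using N[of n] by simp
    from approx_continuous[OF \<zeta>.finite_measure_axioms M1_sets[OF \<zeta>] \<zeta>.finite_measure_axioms M1_sets[OF \<zeta>] hNm[of n] hN N0(2)[of n] this]
    obtain k where "continuous_on UNIV k" "\<And>x. 1 / N n \<le> k x" "\<And>x. k x \<le> N n" "(\<integral>x. \<bar>k x - hN n x\<bar> \<partial>\<zeta>) < 1 / (N n)\<^sup>2"
      by metis
    then show ?thesis by blast
  qed
  then obtain k where kc: "\<And>n. continuous_on UNIV (k n)" and kb: "\<And>n x. 1 / N n \<le> k n x" "\<And>n x. k n x \<le> N n"
    and kL: "\<And>n. (\<integral>x. \<bar>k n x - hN n x\<bar> \<partial>\<zeta>) < 1 / (N n)\<^sup>2" by metis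
  have kp: "0 < k n x" for n x using kb(1)[of n x] N0(1)[of n] by linarith
  have kC: "k n \<in> Cb" for n
  proof (rule CbI[OF kc])
    show "\<bar>k n x\<bar> \<le> N n" for x using kp[of n x] kb(2)[of n x] by simp
  qed
  have lnkC: "(\<lambda>x. ln (k n x)) \<in> Cb" for n
  proof (rule CbI)
    show "continuous_on UNIV (\<lambda>x. ln (k n x))" using kc kp by (intro continuous_on_ln) (auto simp: less_imp_neq[symmetric])
    fix x
    have "ln (1 / N n) \<le> ln (k n x)" using kb N0 kp by (subst ln_le_cancel_iff) auto
    moreover have "ln (k n x) \<le> ln (N n)" using kb N[of n] kp by (subst ln_le_cancel_iff) auto
    moreover have "ln (1 / N n) = - ln (N n)" using N[of n] by (simp add: ln_div)
    ultimately show "\<bar>ln (k n x)\<bar> \<le> ln (N n)" by linarith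
  qed
  have ki: "integrable \<zeta> (k n)" for n by (rule Cb_integrable_M1[OF kC \<zeta>])
  have hNi: "integrable \<zeta> (hN n)" for n
  proof (rule bounded_integrable[OF \<zeta>.finite_measure_axioms])
    show "hN n \<in> borel_measurable \<zeta>" unfolding meq by (rule hNm)
    show "\<bar>hN n x\<bar> \<le> N n" for x using hN[of n x] N0(1)[of n] by linarith
  qed
  have inv: "(\<lambda>n. 1 / N n) \<longlonglongrightarrow> 0" unfolding N_def by real_asymp
  have Ninf: "\<forall>\<^sub>F n in sequentially. y < N n" for y
    using filterlim_at_top_dense[THEN iffD1, OF filterlim_real_sequentially, rule_format, of y]
    by eventually_elim (simp add: N_def)
  have hNlim: "(\<lambda>n. hN n x) \<longlonglongrightarrow> h x" for x
  proof -
    have "\<forall>\<^sub>F n in sequentially. max (1 / N n) (h x) = hN n x"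
      using Ninf[of "h x"] by eventually_elim (simp add: hN_def min_absorb2)
    moreover have "(\<lambda>n. max (1 / N n) (h x)) \<longlonglongrightarrow> max 0 (h x)" by (intro tendsto_max inv tendsto_const)
    ultimately have "(\<lambda>n. hN n x) \<longlonglongrightarrow> max 0 (h x)" by (rule Lim_transform_eventually[rotated])
    then show ?thesis using h(2)[of x] by simp
  qed
  have L1: "(\<lambda>n. \<integral>x. \<bar>hN n x - h x\<bar> \<partial>\<zeta>) \<longlonglongrightarrow> (\<integral>x. 0 \<partial>\<zeta>)"
  proof (rule integral_dominated_convergence[where w="\<lambda>x. h x + 1"])
    show "AE x in \<zeta>. (\<lambda>n. \<bar>hN n x - h x\<bar>) \<longlonglongrightarrow> 0"
    proof (rule AE_I2)
      fix x show "(\<lambda>n. \<bar>hN n x - h x\<bar>) \<longlonglongrightarrow> 0"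
        using tendsto_rabs[OF tendsto_diff[OF hNlim[of x] tendsto_const[of "h x"]]] by simp
    qed
    show "AE x in \<zeta>. norm \<bar>hN n x - h x\<bar> \<le> h x + 1" for n
    proof (rule AE_I2)
      fix x
      have "1 / N n \<le> 1" using N1[of n] by simp
      moreover have "hN n x \<le> max (1 / N n) (h x)" unfolding hN_def by (intro max.mono) auto
      moreover have "0 \<le> hN n x" using hN(1)[of n x] N0(1)[of n] by linarith
      ultimately show "norm \<bar>hN n x - h x\<bar> \<le> h x + 1" using h(2)[of x] by (simp add: abs_le_iff max_def split: if_splits)
    qed
    show "(\<lambda>x. \<bar>hN n x - h x\<bar>) \<in> borel_measurable \<zeta>" for n unfolding meq using hNm h(1) by measurable
  qed (use hi in auto)
  have K1: "(\<lambda>n. \<integral>x. \<bar>k n x - h x\<bar> \<partial>\<zeta>) \<longlonglongrightarrow> 0"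
  proof (rule tendsto_sandwich[OF _ _ tendsto_const])
    show "\<forall>\<^sub>F n in sequentially. 0 \<le> (\<integral>x. \<bar>k n x - h x\<bar> \<partial>\<zeta>)" by simp
    show "\<forall>\<^sub>F n in sequentially. (\<integral>x. \<bar>k n x - h x\<bar> \<partial>\<zeta>) \<le> 1 / N n * (1 / N n) + (\<integral>x. \<bar>hN n x - h x\<bar> \<partial>\<zeta>)"
    proof (rule always_eventually, rule allI)
      fix n
      have "(\<integral>x. \<bar>k n x - h x\<bar> \<partial>\<zeta>) \<le> (\<integral>x. \<bar>k n x - hN n x\<bar> + \<bar>hN n x - h x\<bar> \<partial>\<zeta>)"
        using ki hNi hi by (intro integral_mono) auto
      also have "\<dots> = (\<integral>x. \<bar>k n x - hN n x\<bar> \<partial>\<zeta>) + (\<integral>x. \<bar>hN n x - h x\<bar> \<partial>\<zeta>)"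
        using ki hNi hi by simp
      finally show "(\<integral>x. \<bar>k n x - h x\<bar> \<partial>\<zeta>) \<le> 1 / N n * (1 / N n) + (\<integral>x. \<bar>hN n x - h x\<bar> \<partial>\<zeta>)"
        using kL[of n] by (simp add: power2_eq_square)
    qed
    show "(\<lambda>n. 1 / N n * (1 / N n) + (\<integral>x. \<bar>hN n x - h x\<bar> \<partial>\<zeta>)) \<longlonglongrightarrow> 0"
      using tendsto_add[OF tendsto_mult[OF inv inv] L1] by simp
  qed
  have lim_g: "(\<lambda>n. \<integral>x. k n x * g x \<partial>\<zeta>) \<longlonglongrightarrow> (\<integral>x. g x \<partial>\<nu>)" if g: "g \<in> Cb" for g
  proof -
    from CbE[OF g] obtain B where B: "B > 0" "\<And>x. \<bar>g x\<bar> \<le> B" by blast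
    have gi: "integrable \<zeta> (\<lambda>x. h x * g x)"
      using integral_density_M1(1)[OF \<zeta> h Cb_measurable[OF g]] Cb_integrable_M1[OF g \<nu>] by simp
    have kgi: "integrable \<zeta> (\<lambda>x. k n x * g x)" for n
    proof (rule bounded_integrable[OF \<zeta>.finite_measure_axioms])
      show "(\<lambda>x. k n x * g x) \<in> borel_measurable \<zeta>" unfolding meq
        using Cb_measurable[OF kC[of n]] Cb_measurable[OF g] by measurable
      show "\<bar>k n x * g x\<bar> \<le> N n * B" for x
        unfolding abs_mult using kp[of n x] kb(2)[of n x] B by (intro mult_mono) auto
    qed
    have "(\<lambda>n. (\<integral>x. k n x * g x \<partial>\<zeta>) - (\<integral>x. h x * g x \<partial>\<zeta>)) \<longlonglongrightarrow> 0"
    proof (rule Lim_null_comparison)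
      show "(\<lambda>n. B * (\<integral>x. \<bar>k n x - h x\<bar> \<partial>\<zeta>)) \<longlonglongrightarrow> 0" using tendsto_mult_right_zero[OF K1] .
      show "\<forall>\<^sub>F n in sequentially. norm ((\<integral>x. k n x * g x \<partial>\<zeta>) - (\<integral>x. h x * g x \<partial>\<zeta>)) \<le> B * (\<integral>x. \<bar>k n x - h x\<bar> \<partial>\<zeta>)"
      proof (rule always_eventually, rule allI)
        fix n
        have "(\<integral>x. k n x * g x \<partial>\<zeta>) - (\<integral>x. h x * g x \<partial>\<zeta>) = (\<integral>x. (k n x - h x) * g x \<partial>\<zeta>)"
          using kgi gi by (simp add: left_diff_distrib)
        also have "norm \<dots> \<le> (\<integral>x. norm ((k n x - h x) * g x) \<partial>\<zeta>)" by (rule integral_norm_bound)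
        also have "\<dots> \<le> (\<integral>x. B * \<bar>k n x - h x\<bar> \<partial>\<zeta>)"
        proof (rule integral_mono)
          have "integrable \<zeta> (\<lambda>x. k n x * g x - h x * g x)" using kgi gi by simp
          then show "integrable \<zeta> (\<lambda>x. norm ((k n x - h x) * g x))" by (simp add: left_diff_distrib)
          show "norm ((k n x - h x) * g x) \<le> B * \<bar>k n x - h x\<bar>" for x
            using mult_right_mono[OF B(2)[of x], of "\<bar>k n x - h x\<bar>"] by (simp add: abs_mult mult.commute)
        qed (use ki hi in auto)
        finally show "norm ((\<integral>x. k n x * g x \<partial>\<zeta>) - (\<integral>x. h x * g x \<partial>\<zeta>)) \<le> B * (\<integral>x. \<bar>k n x - h x\<bar> \<partial>\<zeta>)" by simp
      qed
    qed
    then show ?thesis unfolding integral_density_M1(2)[OF \<zeta> h Cb_measurable[OF g]] by (rule LIM_zero_cancel)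
  qed
  have phiN: "(\<lambda>n. \<integral>x. hN n x * ln (hN n x) \<partial>\<zeta>) \<longlonglongrightarrow> H"
    unfolding phi(2)[symmetric]
  proof (rule integral_dominated_convergence[where w="\<lambda>x. \<bar>h x * ln (h x)\<bar> + 1"])
    show "(\<lambda>x. hN n x * ln (hN n x)) \<in> borel_measurable \<zeta>" for n unfolding meq using hNm[of n] by measurable
    show "(\<lambda>x. h x * ln (h x)) \<in> borel_measurable \<zeta>" unfolding meq by measurable
    show "integrable \<zeta> (\<lambda>x. \<bar>h x * ln (h x)\<bar> + 1)" using phi(1) by auto
    \<comment> \<open>Clipping from above decreases h ln h; clipping from below gives the value ln N
      / N \<le> 1 in modulus, whence the summand 1 in the dominating function.\<close>
    show "AE x in \<zeta>. norm (hN n x * ln (hN n x)) \<le> \<bar>h x * ln (h x)\<bar> + 1" for n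
    proof (rule AE_I2)
      fix x
      have lN: "0 \<le> ln (N n)" using N1[of n] by simp
      consider "h x < 1 / N n" | "1 / N n \<le> h x" "h x \<le> N n" | "N n < h x" by linarith
      then show "norm (hN n x * ln (hN n x)) \<le> \<bar>h x * ln (h x)\<bar> + 1"
      proof cases
        case 1
        then have e: "hN n x = 1 / N n" using N0[of n] by (simp add: hN_def)
        have "ln (N n) \<le> N n - 1" using N[of n] by (intro ln_le_minus_one) linarith
        then have "1 / N n * ln (N n) \<le> 1 / N n * N n" using N0(1)[of n] by (intro mult_left_mono) auto
        also have "\<dots> = 1" using N[of n] by simp
        finally have "1 / N n * ln (N n) \<le> 1" .
        moreover have "ln (1 / N n) = - ln (N n)" using N[of n] by (simp add: ln_div)
        ultimately have "norm (hN n x * ln (hN n x)) \<le> 1"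
          unfolding e using lN N[of n] by (simp add: abs_mult)
        then show ?thesis by linarith
      next
        case 2
        then have "hN n x = h x" by (simp add: hN_def)
        then show ?thesis by simp
      next
        case 3
        then have e: "hN n x = N n" using N0[of n] by (simp add: hN_def)
        have "ln (N n) \<le> ln (h x)" using 3 N[of n] by (subst ln_le_cancel_iff) auto
        then have "N n * ln (N n) \<le> h x * ln (h x)" using 3 N[of n] lN by (intro mult_mono) auto
        moreover have "0 \<le> N n * ln (N n)" using lN N[of n] by simp
        ultimately show ?thesis unfolding e by (simp add: abs_of_nonneg)
      qed
    qed
    show "AE x in \<zeta>. (\<lambda>n. hN n x * ln (hN n x)) \<longlonglongrightarrow> h x * ln (h x)"
    proof (rule AE_I2)
      fix x
      show "(\<lambda>n. hN n x * ln (hN n x)) \<longlonglongrightarrow> h x * ln (h x)"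
      proof (cases "h x = 0")
        case False
        then show ?thesis by (intro tendsto_mult tendsto_ln hNlim)
      next
        case True
        have "(\<lambda>n. hN n x * ln (hN n x)) \<longlonglongrightarrow> 0"
        proof -
          \<comment> \<open>The clipped values are positive and tend to 0, where ln is not
            continuous; the one-sided limit of y ln y takes over.\<close>
          have lim: "((\<lambda>y::real. y * ln y) \<longlongrightarrow> 0) (at_right 0)" by real_asymp
          have "filterlim (\<lambda>n. hN n x) (at_right 0) sequentially"
            unfolding filterlim_at
          proof (intro conjI)
            show "\<forall>\<^sub>F n in sequentially. hN n x \<in> {0<..} \<and> hN n x \<noteq> 0"
            proof (rule always_eventually, rule allI)
              fix n
              have "0 < hN n x" using hN(1)[of n x] N0(1)[of n] by linarith
              then show "hN n x \<in> {0<..} \<and> hN n x \<noteq> 0" by simp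
            qed
            show "(\<lambda>n. hN n x) \<longlonglongrightarrow> 0" using hNlim[of x] True by simp
          qed
          from filterlim_compose[OF lim this] show ?thesis .
        qed
        then show ?thesis using True by simp
      qed
    qed
  qed
  have phiK: "(\<lambda>n. \<integral>x. k n x * ln (k n x) \<partial>\<zeta>) \<longlonglongrightarrow> H"
  proof -
    have kli: "integrable \<zeta> (\<lambda>x. k n x * ln (k n x))" for n
    proof -
      have "continuous_on {1 / N n..N n} (\<lambda>y. y * ln y)"
        using N0[of n] by (intro continuous_intros) auto
      then have "compact ((\<lambda>y. y * ln y) ` {1 / N n..N n})" by (rule compact_continuous_image) simp
      then obtain B where B: "\<forall>z\<in>(\<lambda>y. y * ln y) ` {1 / N n..N n}. norm z \<le> B"
        using compact_imp_bounded bounded_iff by metis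
      show ?thesis
      proof (rule bounded_integrable[OF \<zeta>.finite_measure_axioms])
        show "(\<lambda>x. k n x * ln (k n x)) \<in> borel_measurable \<zeta>" unfolding meq using Cb_measurable[OF kC[of n]] by measurable
        show "\<bar>k n x * ln (k n x)\<bar> \<le> B" for x using B kb[of n x] by auto
      qed
    qed
    have hli: "integrable \<zeta> (\<lambda>x. hN n x * ln (hN n x))" for n
    proof -
      have "continuous_on {1 / N n..N n} (\<lambda>y. y * ln y)"
        using N0[of n] by (intro continuous_intros) auto
      then have "compact ((\<lambda>y. y * ln y) ` {1 / N n..N n})" by (rule compact_continuous_image) simp
      then obtain B where B: "\<forall>z\<in>(\<lambda>y. y * ln y) ` {1 / N n..N n}. norm z \<le> B"
        using compact_imp_bounded bounded_iff by metis
      show ?thesis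
      proof (rule bounded_integrable[OF \<zeta>.finite_measure_axioms])
        show "(\<lambda>x. hN n x * ln (hN n x)) \<in> borel_measurable \<zeta>" unfolding meq using hNm[of n] by measurable
        show "\<bar>hN n x * ln (hN n x)\<bar> \<le> B" for x using B hN[of n x] by auto
      qed
    qed
    have "(\<lambda>n. (\<integral>x. k n x * ln (k n x) \<partial>\<zeta>) - (\<integral>x. hN n x * ln (hN n x) \<partial>\<zeta>)) \<longlonglongrightarrow> 0"
    proof (rule Lim_null_comparison[OF _ inv], rule always_eventually, rule allI)
      fix n
      have "(\<integral>x. k n x * ln (k n x) \<partial>\<zeta>) - (\<integral>x. hN n x * ln (hN n x) \<partial>\<zeta>) = (\<integral>x. k n x * ln (k n x) - hN n x * ln (hN n x) \<partial>\<zeta>)"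
        using kli hli by simp
      also have "norm \<dots> \<le> (\<integral>x. norm (k n x * ln (k n x) - hN n x * ln (hN n x)) \<partial>\<zeta>)" by (rule integral_norm_bound)
      also have "\<dots> \<le> (\<integral>x. N n * \<bar>k n x - hN n x\<bar> \<partial>\<zeta>)"
      proof (rule integral_mono)
        show "integrable \<zeta> (\<lambda>x. norm (k n x * ln (k n x) - hN n x * ln (hN n x)))" using kli hli by simp
        show "integrable \<zeta> (\<lambda>x. N n * \<bar>k n x - hN n x\<bar>)" using ki hNi by simp
        have "1 + ln (N n) \<le> N n" using ln_le_minus_one[of "N n"] N[of n] by linarith
        then have "(1 + ln (N n)) * \<bar>k n x - hN n x\<bar> \<le> N n * \<bar>k n x - hN n x\<bar>" for x by (intro mult_right_mono) auto
        then show "norm (k n x * ln (k n x) - hN n x * ln (hN n x)) \<le> N n * \<bar>k n x - hN n x\<bar>" for x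
          using xlnx_lipschitz[OF N1 kb(1,2)[of n x] hN(1,2)[of n x]] by (simp add: order_trans)
      qed
      also have "\<dots> = N n * (\<integral>x. \<bar>k n x - hN n x\<bar> \<partial>\<zeta>)" by simp
      also have "\<dots> \<le> N n * (1 / (N n)\<^sup>2)" using kL[of n] N[of n] by (intro mult_left_mono) auto
      also have "\<dots> = 1 / N n" using N[of n] by (simp add: power2_eq_square)
      finally show "norm ((\<integral>x. k n x * ln (k n x) \<partial>\<zeta>) - (\<integral>x. hN n x * ln (hN n x) \<partial>\<zeta>)) \<le> 1 / N n" .
    qed
    from tendsto_add[OF this phiN] show ?thesis by simp
  qed
  define c where "c n = (\<integral>x. k n x \<partial>\<zeta>)" for n
  have c: "c \<longlonglongrightarrow> 1" unfolding c_def using lim_g[OF Cb_const[of 1]] by (simp add: \<nu>.prob_space)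
  have cp: "c n > 0" for n
  proof -
    have "1 / N n \<le> c n" unfolding c_def using ki kb by (intro \<zeta>.integral_ge_const) auto
    then show ?thesis using N0(1)[of n] by linarith
  qed
  \<comment> \<open>Division by the integral c n of k n makes e^f a probability density; as c n
    tends to 1, the limits are unaffected.\<close>
  define f where "f n x = ln (k n x) - ln (c n)" for n x
  have fC: "f n \<in> Cb" for n unfolding f_def by (intro Cb_diff lnkC Cb_const)
  have ef: "exp (f n x) = k n x / c n" for n x using kp[of n x] cp[of n] by (simp add: f_def exp_diff)
  have e1: "(\<integral>x. exp (f n x) \<partial>\<zeta>) = 1" for n unfolding ef using cp[of n] by (simp add: c_def)
  have eg: "(\<lambda>n. \<integral>x. exp (f n x) * g x \<partial>\<zeta>) \<longlonglongrightarrow> (\<integral>x. g x \<partial>\<nu>)" if g: "g \<in> Cb" for g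
  proof -
    have "(\<integral>x. exp (f n x) * g x \<partial>\<zeta>) = (\<integral>x. k n x * g x \<partial>\<zeta>) / c n" for n unfolding ef by simp
    then show ?thesis using tendsto_divide[OF lim_g[OF g] c] by simp
  qed
  have eH: "(\<lambda>n. \<integral>x. exp (f n x) * f n x \<partial>\<zeta>) \<longlonglongrightarrow> H"
  proof -
    have "(\<integral>x. exp (f n x) * f n x \<partial>\<zeta>) = (\<integral>x. k n x * ln (k n x) \<partial>\<zeta>) / c n - ln (c n)" for n
    proof -
      have i: "integrable \<zeta> (\<lambda>x. k n x * ln (k n x))"
      proof -
        from CbE[OF lnkC[of n]] obtain B where B: "B > 0" "\<And>x. \<bar>ln (k n x)\<bar> \<le> B" by blast
        show ?thesis
        proof (rule bounded_integrable[OF \<zeta>.finite_measure_axioms])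
          show "(\<lambda>x. k n x * ln (k n x)) \<in> borel_measurable \<zeta>" unfolding meq using Cb_measurable[OF kC[of n]] by measurable
          show "\<bar>k n x * ln (k n x)\<bar> \<le> N n * B" for x
            unfolding abs_mult using kp[of n x] kb(2)[of n x] B by (intro mult_mono) auto
        qed
      qed
      have "exp (f n x) * f n x = (k n x * ln (k n x)) / c n - ln (c n) / c n * k n x" for x
        unfolding ef unfolding f_def by (simp add: right_diff_distrib diff_divide_distrib)
      then have "(\<integral>x. exp (f n x) * f n x \<partial>\<zeta>) = (\<integral>x. k n x * ln (k n x) \<partial>\<zeta>) / c n - ln (c n) / c n * (\<integral>x. k n x \<partial>\<zeta>)"
        using i ki by simp
      then show ?thesis using cp[of n] by (simp add: c_def)
    qed
    moreover have "(\<lambda>n. (\<integral>x. k n x * ln (k n x) \<partial>\<zeta>) / c n - ln (c n)) \<longlonglongrightarrow> H / 1 - ln 1"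
      by (intro tendsto_intros phiK c) auto
    ultimately show ?thesis by simp
  qed
  have ev1: "\<forall>\<^sub>F n in sequentially. \<forall>g\<in>S. \<bar>(\<integral>x. exp (f n x) * g x \<partial>\<zeta>) - (\<integral>x. g x \<partial>\<nu>)\<bar> < \<epsilon>"
  proof (rule eventually_ball_finite[OF S(1)], rule ballI)
    fix g assume "g \<in> S"
    then have "g \<in> Cb" using S by blast
    from tendstoD[OF eg[OF this] \<epsilon>]
    show "\<forall>\<^sub>F n in sequentially. \<bar>(\<integral>x. exp (f n x) * g x \<partial>\<zeta>) - (\<integral>x. g x \<partial>\<nu>)\<bar> < \<epsilon>" by (simp add: dist_real_def)
  qed
  have ev2: "\<forall>\<^sub>F n in sequentially. (\<integral>x. exp (f n x) * f n x \<partial>\<zeta>) < H + \<epsilon>"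
    using \<epsilon> by (intro order_tendstoD(2)[OF eH]) simp
  from eventually_happens'[OF sequentially_bot eventually_conj[OF ev1 ev2]]
  obtain n where "\<forall>g\<in>S. \<bar>(\<integral>x. exp (f n x) * g x \<partial>\<zeta>) - (\<integral>x. g x \<partial>\<nu>)\<bar> < \<epsilon>" "(\<integral>x. exp (f n x) * f n x \<partial>\<zeta>) < H + \<epsilon>" by blast
  then show ?thesis using fC e1 by (intro that[of "f n"]) auto
qed

text \<open>Reduces an open set to finitely many integrals, the form that the tilting bound
  controls. Intersections join the sets of test functions and take the smaller tolerance.\<close>

lemma weak_topology_neighbourhood:
  fixes G :: "'a::topological_space measure set"
  assumes "openin weak_topology G" "\<nu> \<in> G"
  obtains S \<epsilon> where "finite S" "S \<subseteq> Cb" "\<epsilon> > 0"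
    "\<And>\<mu>. \<mu> \<in> M1 \<Longrightarrow> (\<And>g. g \<in> S \<Longrightarrow> \<bar>(\<integral>x. g x \<partial>\<mu>) - (\<integral>x. g x \<partial>\<nu>)\<bar> < \<epsilon>) \<Longrightarrow> \<mu> \<in> G"
proof -
  have "generate_topology_on {{\<mu> \<in> M1. (\<integral>x. f x \<partial>\<mu>) \<in> U} | (f :: 'a \<Rightarrow> real) U.
        continuous_on UNIV f \<and> bounded (range f) \<and> open U} G"
    using assms(1) unfolding weak_topology_def by (rule openin_topology_generated_by)
  then have "\<nu> \<in> G \<Longrightarrow> \<exists>S \<epsilon>. finite S \<and> S \<subseteq> Cb \<and> \<epsilon> > 0 \<and>
    (\<forall>\<mu>\<in>M1. (\<forall>g\<in>S. \<bar>(\<integral>x. g x \<partial>\<mu>) - (\<integral>x. g x \<partial>\<nu>)\<bar> < \<epsilon>) \<longrightarrow> \<mu> \<in> G)"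
  proof induction
    case (Int a b)
    then obtain S \<epsilon> T \<delta> where "finite S" "S \<subseteq> Cb" "\<epsilon> > 0" "finite T" "T \<subseteq> Cb" "\<delta> > 0"
      "\<forall>\<mu>\<in>M1. (\<forall>g\<in>S. \<bar>(\<integral>x. g x \<partial>\<mu>) - (\<integral>x. g x \<partial>\<nu>)\<bar> < \<epsilon>) \<longrightarrow> \<mu> \<in> a"
      "\<forall>\<mu>\<in>M1. (\<forall>g\<in>T. \<bar>(\<integral>x. g x \<partial>\<mu>) - (\<integral>x. g x \<partial>\<nu>)\<bar> < \<delta>) \<longrightarrow> \<mu> \<in> b" by blast
    then show ?case by (intro exI[of _ "S \<union> T"] exI[of _ "min \<epsilon> \<delta>"]) auto
  next
    case (UN \<K>)
    then obtain k where k: "k \<in> \<K>" "\<nu> \<in> k" by blast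
    from UN.IH[OF k] show ?case using k(1) by blast
  next
    case (Basis s)
    then obtain f :: "'a \<Rightarrow> real" and U where s: "s = {\<mu> \<in> M1. (\<integral>x. f x \<partial>\<mu>) \<in> U}" and f: "f \<in> Cb" and U: "open U"
      unfolding Cb_def by blast
    have "(\<integral>x. f x \<partial>\<nu>) \<in> U" using Basis.prems s by blast
    then obtain e where e: "e > 0" "\<And>y. dist y (\<integral>x. f x \<partial>\<nu>) < e \<Longrightarrow> y \<in> U" using U unfolding open_dist by metis
    show ?case using f e by (intro exI[of _ "{f}"] exI[of _ e]) (auto simp: s dist_real_def)
  qed auto
  then show ?thesis using assms(2) that by metis
qed

section \<open>The large deviation principle\<close>

text \<open>Principle of the largest term: the number of summands is absorbed by descending from an
  intermediate rate b' to b.\<close>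

lemma expbound_sum:
  fixes p :: "'j \<Rightarrow> nat \<Rightarrow> real"
  assumes J: "finite J" and p: "\<And>j b. j \<in> J \<Longrightarrow> b < a \<Longrightarrow> \<forall>\<^sub>F n in sequentially. p j n \<le> exp (- real n * b)"
    and b: "b < a"
  shows "\<forall>\<^sub>F n in sequentially. (\<Sum>j\<in>J. p j n) \<le> exp (- real n * b)"
proof -
  obtain b' where b': "b < b'" "b' < a" using dense[OF b] by blast
  have "\<forall>\<^sub>F n in sequentially. \<forall>j\<in>J. p j n \<le> exp (- real n * b')"
    by (rule eventually_ball_finite[OF J]) (use p b' in blast)
  moreover have "\<forall>\<^sub>F n in sequentially. real (card J) \<le> exp (real n * (b' - b))"
  proof -
    have "0 < b' - b" using b' by simp
    then have "filterlim (\<lambda>n::nat. exp (real n * (b' - b))) at_top sequentially" by real_asymp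
    then show ?thesis by (simp add: filterlim_at_top)
  qed
  ultimately show ?thesis
  proof eventually_elim
    case (elim n)
    have "(\<Sum>j\<in>J. p j n) \<le> (\<Sum>j\<in>J. exp (- real n * b'))" using elim(1) by (intro sum_mono) blast
    also have "\<dots> = real (card J) * exp (- real n * b')" by simp
    also have "\<dots> \<le> exp (real n * (b' - b)) * exp (- real n * b')" using elim(2) by (intro mult_right_mono) auto
    also have "\<dots> = exp (- real n * b)" by (simp add: algebra_simps flip: exp_add)
    finally show ?case .
  qed
qed

locale resampled_LDP = multinomial_weights M m W X
  for M :: "'w measure" and m :: "nat \<Rightarrow> nat" and W :: "nat \<Rightarrow> nat \<Rightarrow> 'w \<Rightarrow> real"
    and X :: "nat \<Rightarrow> nat \<Rightarrow> 'w \<Rightarrow> 'a::polish_space" +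
  fixes lam :: real and I :: "'a measure \<Rightarrow> ereal"
  assumes m_lim: "(\<lambda>n. real (m n) / real n) \<longlonglongrightarrow> lam" and lam_pos: "lam > 0"
    and X_LDP: "LDP weak_topology (\<lambda>n. law_M1 M (emp n)) I"
    and X_good: "good_rate weak_topology I"
begin

definition K :: "'a measure \<Rightarrow> ereal" where
  "K \<nu> = (INF \<zeta>\<in>M1. ereal lam * rel_entropy \<nu> \<zeta> + I \<zeta>)"

lemma I_nonneg: "\<zeta> \<in> M1 \<Longrightarrow> 0 \<le> I \<zeta>"
  using X_LDP unfolding LDP_def topspace_weak_topology by blast

lemma K_le: "\<zeta> \<in> M1 \<Longrightarrow> K \<nu> \<le> ereal lam * rel_entropy \<nu> \<zeta> + I \<zeta>"
  unfolding K_def by (rule INF_lower)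

lemma K_nonneg: "\<nu> \<in> M1 \<Longrightarrow> 0 \<le> K \<nu>"
  unfolding K_def using lam_pos
  by (intro INF_greatest add_nonneg_nonneg ereal_0_le_mult rel_entropy_nonneg I_nonneg) auto

lemma m_at_top: "filterlim m at_top sequentially"
proof -
  have "filterlim (\<lambda>n. real (m n) / real n * real n) at_top sequentially"
    by (rule filterlim_tendsto_pos_mult_at_top[OF m_lim lam_pos filterlim_real_sequentially])
  moreover have "\<forall>\<^sub>F n in sequentially. real (m n) / real n * real n = real (m n)"
    using eventually_gt_at_top[of 0] by eventually_elim simp
  ultimately have "filterlim (\<lambda>n. real (m n)) at_top sequentially"
    by (rule filterlim_cong[OF refl refl, THEN iffD1, rotated])
  then show ?thesis by (simp only: filterlim_sequentially_iff_filterlim_real)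
qed

text \<open>If every f satisfied \<Lambda> f - ln (integral of e^f d\<zeta>) \<le> c, then by
  \<open>representing_measure\<close> \<Lambda> would come from a measure whose entropy and
  \<open>I \<zeta>\<close> give \<open>K\<close> at most a, against \<open>fibre\<close>. So some f
  violates the bound, and its excess is distributed over p, q and r.\<close>

lemma local_cover:
  fixes \<Lambda> :: "('a \<Rightarrow> real) \<Rightarrow> real"
  assumes \<Lambda>: "\<Lambda> \<in> linear_functionals" and fibre: "\<And>\<nu>. \<nu> \<in> M1 \<Longrightarrow> emb \<nu> = \<Lambda> \<Longrightarrow> ereal a < K \<nu>"
    and \<zeta>: "\<zeta> \<in> M1" "I \<zeta> \<le> ereal a"
  obtains V F f p q r where "openin weak_topology V" "\<zeta> \<in> V" "closedin weak_topology F" "V \<subseteq> F"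
    "f \<in> Cb" "p < \<Lambda> f" "\<And>\<mu>. \<mu> \<in> V \<Longrightarrow> (\<integral>x. exp (f x) \<partial>\<mu>) < exp q"
    "\<And>\<mu>. \<mu> \<in> F \<Longrightarrow> ereal r < I \<mu>" "lam * (p - q) + r > a"
proof -
  obtain i where i: "I \<zeta> = ereal i" using \<zeta> I_nonneg[OF \<zeta>(1)] by (cases "I \<zeta>") auto
  \<comment> \<open>The entropy relative to \<zeta> at which the total cost is exactly a.\<close>
  define c where "c = (a - i) / lam"
  obtain f where f: "f \<in> Cb" "c < \<Lambda> f - ln (\<integral>x. exp (f x) \<partial>\<zeta>)"
  proof (rule ccontr)
    assume "\<not> thesis"
    then have "\<And>f. f \<in> Cb \<Longrightarrow> \<Lambda> f \<le> c + ln (\<integral>x. exp (f x) \<partial>\<zeta>)" using that by force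
    then interpret entropic_functional \<zeta> \<Lambda> c
      using \<Lambda> \<zeta> by unfold_locales (auto simp: linear_functionals_def)
    obtain \<nu>' where \<nu>': "\<nu>' \<in> M1" "\<And>f. f \<in> Cb \<Longrightarrow> \<Lambda> f = (\<integral>x. f x \<partial>\<nu>')" "rel_entropy \<nu>' \<zeta> \<le> ereal c"
      using representing_measure by blast
    have "emb \<nu>' = \<Lambda>"
    proof
      fix f
      show "emb \<nu>' f = \<Lambda> f"
      proof (cases "f \<in> Cb")
        case True then show ?thesis using \<nu>'(2) by (simp add: emb_apply)
      next
        case False
        have "\<bar>\<Lambda> f\<bar> \<le> (if f \<in> Cb then SUP x. \<bar>f x\<bar> else 0)" using \<Lambda> unfolding linear_functionals_def by blast
        then show ?thesis using False by (simp add: emb_def)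
      qed
    qed
    then have "ereal a < K \<nu>'" by (rule fibre[OF \<nu>'(1)])
    also have "\<dots> \<le> ereal lam * rel_entropy \<nu>' \<zeta> + I \<zeta>" by (rule K_le[OF \<zeta>(1)])
    also have "\<dots> \<le> ereal lam * ereal c + ereal i"
      unfolding i using \<nu>'(3) lam_pos by (intro add_right_mono ereal_mult_left_mono) auto
    also have "\<dots> = ereal a" using lam_pos by (simp add: c_def)
    finally show False by simp
  qed
  define d where "d = \<Lambda> f - ln (\<integral>x. exp (f x) \<partial>\<zeta>)"
  have "lam * c = a - i" using lam_pos by (simp add: c_def)
  moreover have "lam * c < lam * d" using f(2) lam_pos by (simp add: d_def)
  ultimately have gap: "0 < lam * d + i - a" by linarith
  \<comment> \<open>Lowering p, raising q and lowering r by \<eta> costs (2 lam + 1) \<eta> in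
    total; this choice spends half of the gap.\<close>
  define \<eta> where "\<eta> = (lam * d + i - a) / (2 * (2 * lam + 1))"
  have \<eta>: "\<eta> > 0" unfolding \<eta>_def using gap lam_pos by (intro divide_pos_pos) auto
  have \<eta>': "(2 * lam + 1) * \<eta> < lam * d + i - a"
  proof -
    have "(2 * lam + 1) * \<eta> = (lam * d + i - a) / 2" unfolding \<eta>_def using lam_pos by (simp add: field_simps)
    then show ?thesis using gap by simp
  qed
  define p where "p = \<Lambda> f - \<eta>"
  define q where "q = ln (\<integral>x. exp (f x) \<partial>\<zeta>) + \<eta>"
  define r where "r = i - \<eta>"
  have pq: "p - q = d - 2 * \<eta>" by (simp add: p_def q_def d_def)
  have sum: "lam * (p - q) + r > a" unfolding pq r_def using \<eta>' by (simp add: algebra_simps)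
  have "lsc_on weak_topology I" using X_LDP unfolding LDP_def by blast
  then have lsc: "openin weak_topology {\<mu>\<in>M1. ereal r < I \<mu>}" unfolding lsc_on_def topspace_weak_topology by blast
  have "\<zeta> \<in> {\<mu>\<in>M1. ereal r < I \<mu>}" using \<zeta> \<eta> by (simp add: i r_def)
  then obtain U C where UC: "openin weak_topology U" "closedin weak_topology C" "\<zeta> \<in> U" "U \<subseteq> C" "C \<subseteq> {\<mu>\<in>M1. ereal r < I \<mu>}"
    by (rule weak_topology_regular[OF lsc])
  define V where "V = U \<inter> {\<mu>\<in>M1. (\<integral>x. exp (f x) \<partial>\<mu>) < exp q}"
  show ?thesis
  proof (rule that[of V C f p q r])
    show "openin weak_topology V" unfolding V_def
      by (intro openin_Int UC openin_integral_less Cb_exp f)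
    have "(\<integral>x. exp (f x) \<partial>\<zeta>) = exp (ln (\<integral>x. exp (f x) \<partial>\<zeta>))" using integral_exp_pos[OF f(1) \<zeta>(1)] by simp
    also have "\<dots> < exp q" using \<eta> by (simp add: q_def)
    finally show "\<zeta> \<in> V" using UC(3) \<zeta>(1) by (simp add: V_def)
    show "p < \<Lambda> f" using \<eta> by (simp add: p_def)
  qed (use UC f sum in \<open>auto simp: V_def\<close>)
qed

text \<open>The local form of the upper bound, on the compact space of linear functionals: the measures
  form a possibly non-closed subset of it, but the fibres over the other functionals are empty, so
  neither exponential tightness nor Prokhorov's theorem is needed.\<close>

lemma local_upper:
  fixes \<Lambda> :: "('a \<Rightarrow> real) \<Rightarrow> real"
  assumes \<Lambda>: "\<Lambda> \<in> linear_functionals" and fibre: "\<forall>\<nu>\<in>M1. emb \<nu> = \<Lambda> \<longrightarrow> ereal a < K \<nu>"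
  shows "\<exists>U. open U \<and> \<Lambda> \<in> U \<and> (\<forall>\<nu>\<in>M1. emb \<nu> \<in> U \<longrightarrow> ereal a \<le> K \<nu>) \<and>
    (\<forall>b<a. \<forall>\<^sub>F n in sequentially. P n {\<nu>\<in>M1. emb \<nu> \<in> U} \<le> exp (- real n * b))"
proof -
  define good where "good V F f p q r \<longleftrightarrow> openin weak_topology V \<and> closedin weak_topology F \<and> V \<subseteq> F \<and>
    f \<in> Cb \<and> p < \<Lambda> f \<and> (\<forall>\<mu>\<in>V. (\<integral>x. exp (f x) \<partial>\<mu>) < exp q) \<and>
    (\<forall>\<mu>\<in>F. ereal r < I \<mu>) \<and> lam * (p - q) + r > a" for V F and f :: "'a \<Rightarrow> real" and p q r
  define \<V> where "\<V> = {V. \<exists>F f p q r. good V F f p q r}"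
  define C where "C = {\<zeta> \<in> M1. I \<zeta> \<le> ereal a}"
  have "compactin weak_topology C"
    using X_good unfolding good_rate_def topspace_weak_topology C_def by blast
  moreover have "openin weak_topology V" if "V \<in> \<V>" for V using that by (auto simp: \<V>_def good_def)
  moreover have "C \<subseteq> \<Union>\<V>"
  proof
    fix \<zeta> assume "\<zeta> \<in> C"
    then have \<zeta>: "\<zeta> \<in> M1" "I \<zeta> \<le> ereal a" by (auto simp: C_def)
    obtain V F f p q r where "openin weak_topology V" "\<zeta> \<in> V" "closedin weak_topology F" "V \<subseteq> F"
      "f \<in> Cb" "p < \<Lambda> f" "\<And>\<mu>. \<mu> \<in> V \<Longrightarrow> (\<integral>x. exp (f x) \<partial>\<mu>) < exp q"
      "\<And>\<mu>. \<mu> \<in> F \<Longrightarrow> ereal r < I \<mu>" "lam * (p - q) + r > a"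
      using local_cover[OF \<Lambda> _ \<zeta>] fibre by blast
    then have "good V F f p q r" unfolding good_def by blast
    then show "\<zeta> \<in> \<Union>\<V>" using \<open>\<zeta> \<in> V\<close> unfolding \<V>_def by blast
  qed
  ultimately obtain J where J: "finite J" "J \<subseteq> \<V>" "C \<subseteq> \<Union>J"
    unfolding compactin_def by meson
  have "\<forall>V\<in>J. \<exists>F f p q r. good V F f p q r" using J(2) by (auto simp: \<V>_def)
  then obtain F f p q r where good: "\<And>V. V \<in> J \<Longrightarrow> good V (F V) (f V) (p V) (q V) (r V)" by metis
  \<comment> \<open>Each of the finitely many V contributes one strict inequality that holds at
    \<Lambda>, so a measure in U has its f V-integral above p V for all V at once, whichever V
    contains the sample measure.\<close>
  define U where "U = (\<Inter>V\<in>J. {\<Lambda>'. p V < \<Lambda>' (f V)})"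
  define A where "A = {\<nu>\<in>M1. emb \<nu> \<in> U}"
  \<comment> \<open>The part of \<open>M1\<close> left uncovered. It misses the level set C, so
    \<open>I\<close> exceeds a on it, and for every b < a the sample measure eventually falls there
    with probability at most e^(-n b).\<close>
  define F0 where "F0 = M1 - \<Union>J"
  have oJ: "openin weak_topology V" if "V \<in> J" for V using good[OF that] by (simp add: good_def)
  have oU: "open U" unfolding U_def
    using open_coordinate[OF open_greaterThan] by (intro open_INT J(1)) (auto simp: greaterThan_def)
  have \<Lambda>U: "\<Lambda> \<in> U" unfolding U_def using good by (simp add: good_def)
  have cF0: "closedin weak_topology F0" unfolding F0_def
    using closedin_diff[OF closedin_topspace openin_Union, of J weak_topology] oJ
    by (simp add: topspace_weak_topology)
  have IF0: "ereal a < I \<mu>" if "\<mu> \<in> F0" for \<mu> using that J(3) by (auto simp: F0_def C_def not_le[symmetric])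
  have A: "A \<in> sets (borel_of weak_topology)" unfolding A_def
    by (rule openin_borel_of[OF openin_weak_topologyI[OF oU]])
  show ?thesis
  proof (intro exI[of _ U] conjI oU \<Lambda>U ballI allI impI)
    fix \<nu> :: "'a measure" assume \<nu>: "\<nu> \<in> M1" "emb \<nu> \<in> U"
    show "ereal a \<le> K \<nu>" unfolding K_def
    proof (rule INF_greatest)
      fix \<zeta> :: "'a measure" assume \<zeta>: "\<zeta> \<in> M1"
      show "ereal a \<le> ereal lam * rel_entropy \<nu> \<zeta> + I \<zeta>"
      \<comment> \<open>The deterministic counterpart of the probability estimate below: in F0 the
        rate of \<zeta> alone pays for a, and in some V the variational inequality with f V pays p V
        - q V per draw.\<close>
      proof (cases "\<zeta> \<in> F0")
        case True
        have "ereal a \<le> 0 + I \<zeta>" using IF0[OF True] by simp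
        also have "\<dots> \<le> ereal lam * rel_entropy \<nu> \<zeta> + I \<zeta>"
          using lam_pos rel_entropy_nonneg[OF \<nu>(1) \<zeta>] by (intro add_right_mono ereal_0_le_mult) auto
        finally show ?thesis .
      next
        case False
        then obtain V where V: "V \<in> J" "\<zeta> \<in> V" using \<zeta> by (auto simp: F0_def)
        note g = good[OF V(1), unfolded good_def]
        have fC: "f V \<in> Cb" using g by blast
        have "p V < emb \<nu> (f V)" using \<nu>(2) V(1) by (auto simp: U_def)
        then have 1: "p V < (\<integral>x. f V x \<partial>\<nu>)" by (simp add: emb_apply fC)
        have "(\<integral>x. exp (f V x) \<partial>\<zeta>) < exp (q V)" using g V(2) by blast
        then have "ln (\<integral>x. exp (f V x) \<partial>\<zeta>) < ln (exp (q V))"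
          using integral_exp_pos[OF fC \<zeta>] by (subst ln_less_cancel_iff) auto
        then have "p V - q V \<le> (\<integral>x. f V x \<partial>\<nu>) - ln (\<integral>x. exp (f V x) \<partial>\<zeta>)" using 1 by simp
        then have "ereal (p V - q V) \<le> rel_entropy \<nu> \<zeta>"
          using donsker_varadhan_le[OF \<nu>(1) \<zeta> fC] by (meson ereal_less_eq(3) order_trans)
        then have "ereal lam * ereal (p V - q V) \<le> ereal lam * rel_entropy \<nu> \<zeta>"
          using lam_pos by (intro ereal_mult_left_mono) auto
        moreover have "ereal (r V) \<le> I \<zeta>" using g V(2) by (meson less_imp_le subsetD)
        ultimately have "ereal lam * ereal (p V - q V) + ereal (r V) \<le> ereal lam * rel_entropy \<nu> \<zeta> + I \<zeta>"
          by (rule add_mono)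
        moreover have "ereal a \<le> ereal lam * ereal (p V - q V) + ereal (r V)" using g by simp
        ultimately show ?thesis by (rule order_trans[rotated])
      qed
    qed
  next
    fix b assume b: "b < a"
    define c where "c n V = exp (- real (m n) * (p V - q V))" for n V
    have PXmono: "PX n V \<le> PX n V'" if "n \<ge> 1" "V \<subseteq> V'" "V' \<in> sets (borel_of weak_topology)" for n V V'
    proof -
      have "prob_space (law_M1 M (emp n))" using X_LDP that(1) unfolding LDP_def by blast
      then show ?thesis unfolding PX_def using that
        by (intro finite_measure.finite_measure_mono prob_space.finite_measure) (auto simp: sets_law_M1)
    qed
    \<comment> \<open>\<open>None\<close> stands for the exceptional set, so that all terms form one
      finite sum for \<open>expbound_sum\<close>.\<close>
    define t where "t V n = (case V of None \<Rightarrow> PX n F0 | Some V \<Rightarrow> c n V * PX n V)" for V n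
    have "\<forall>\<^sub>F n in sequentially. (\<Sum>V\<in>insert None (Some ` J). t V n) \<le> exp (- real n * b)"
    proof (rule expbound_sum[OF _ _ b])
      fix V b assume "V \<in> insert None (Some ` J)" and b: "b < a"
      then consider "V = None" | V' where "V = Some V'" "V' \<in> J" by blast
      then show "\<forall>\<^sub>F n in sequentially. t V n \<le> exp (- real n * b)"
      proof cases
        case 1
        then show ?thesis unfolding t_def PX_def
          using LDP_upper_exp[OF X_LDP cF0 less_imp_le[OF IF0] b] by simp
      next
        case (2 V)
        note g = good[OF 2(2), unfolded good_def]
        \<comment> \<open>The excess of V over a. Half of it is given up in the LDP for F V; the
          other half leaves room for replacing lam by m n / n.\<close>
        define e where "e = lam * (p V - q V) + r V - a"
        have e: "e > 0" using g by (simp add: e_def)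
        have FV: "closedin weak_topology (F V)" "V \<subseteq> F V" using g by blast+
        have "\<forall>\<^sub>F n in sequentially. measure (law_M1 M (emp n)) (F V) \<le> exp (- real n * (r V - e / 2))"
          by (rule LDP_upper_exp[OF X_LDP FV(1), where b="r V"]) (use g e in \<open>auto intro: less_imp_le\<close>)
        moreover have "\<forall>\<^sub>F n in sequentially. b < real (m n) / real n * (p V - q V) + (r V - e / 2)"
        proof -
          have "(\<lambda>n. real (m n) / real n * (p V - q V) + (r V - e / 2)) \<longlonglongrightarrow> lam * (p V - q V) + (r V - e / 2)"
            by (intro tendsto_intros m_lim)
          moreover have "b < lam * (p V - q V) + (r V - e / 2)" using b e unfolding e_def by (simp add: field_simps)
          ultimately show ?thesis by (rule order_tendstoD(1))
        qed
        ultimately show ?thesis using eventually_ge_at_top[of 1]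
        proof eventually_elim
          case (elim n)
          have "t (Some V) n \<le> c n V * exp (- real n * (r V - e / 2))"
            unfolding t_def using elim(1) PXmono[OF elim(3) FV(2) closedin_borel_of[OF FV(1)]]
            by (auto simp: PX_def c_def intro!: mult_left_mono)
          also have "\<dots> = exp (- real n * (real (m n) / real n * (p V - q V) + (r V - e / 2)))"
            unfolding c_def using elim(3) by (simp add: distrib_left flip: exp_add)
          also have "\<dots> \<le> exp (- real n * b)" using elim(2) by (simp add: mult_left_mono)
          finally show ?case by (simp add: 2(1))
        qed
      qed
    qed (use J in simp)
    then show "\<forall>\<^sub>F n in sequentially. P n {\<nu>\<in>M1. emb \<nu> \<in> U} \<le> exp (- real n * b)"
      using eventually_ge_at_top[of 1]
    proof eventually_elim
      case (elim n)
      have mn: "m n \<ge> 1" using m_pos[OF elim(2)] by simp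
      have "P n A \<le> (\<Sum>V\<in>J. c n V * PX n V) + PX n F0"
      proof (rule P_upper[OF elim(2) A J(1)])
        show "V \<in> sets (borel_of weak_topology)" if "V \<in> J" for V by (rule openin_borel_of[OF oJ[OF that]])
        show "F0 \<in> sets (borel_of weak_topology)" by (rule closedin_borel_of[OF cF0])
        show "emp n \<omega> \<in> (\<Union>V\<in>J. V) \<union> F0" for \<omega>
          using empirical_M1[OF elim(2), of "\<lambda>i. X n i \<omega>"] by (auto simp: F0_def emp_eq)
        show "0 \<le> c n V" for V by (simp add: c_def)
        fix V \<omega> assume V: "V \<in> J" "emp n \<omega> \<in> V"
        note g = good[OF V(1), unfolded good_def]
        have fC: "f V \<in> Cb" using g by blast
        have "(\<integral>y. exp (f V y) \<partial>(emp n \<omega>)) < exp (q V)" using g V(2) by blast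
        then have le: "(\<integral>y. exp (f V y) \<partial>(empirical n (\<lambda>i. X n i \<omega>))) \<le> exp (q V)" by (simp add: emp_eq)
        have "Q n A \<omega> \<le> measure_pmf.prob (urns n (m n)) {u. p V < (\<integral>y. f V y \<partial>(resample n (m n) u (\<lambda>i. X n i \<omega>)))}"
          unfolding Q_def using V(1) fC
          by (intro measure_pmf.finite_measure_mono) (auto simp: A_def U_def emb_apply)
        also have "\<dots> \<le> c n V" unfolding c_def by (rule resample_upper[OF elim(2) mn fC le])
        finally show "Q n A \<omega> \<le> c n V" .
      qed
      also have "\<dots> = (\<Sum>V\<in>insert None (Some ` J). t V n)"
        using J(1) by (simp add: sum.reindex t_def)
      also have "\<dots> \<le> exp (- real n * b)" by (rule elim(1))
      finally show ?case unfolding A_def .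
    qed
  qed
qed

text \<open>Take \<zeta> with cost below r and tilt the draws by an f whose tilted measure is close
  to \<nu>. On a neighbourhood V of \<zeta> the exponential moments in \<open>resample_lower\<close>
  are under control, so hitting G costs about H per draw, while the LDP gives the probability of
  V.\<close>

lemma lower:
  assumes G: "openin weak_topology G" and \<nu>: "\<nu> \<in> G" and r: "K \<nu> < ereal r"
  shows "\<forall>\<^sub>F n in sequentially. exp (- real n * r) \<le> P n G"
proof -
  have \<nu>M: "\<nu> \<in> M1" using openin_subset[OF G] \<nu> by (auto simp: topspace_weak_topology)
  obtain \<zeta> where \<zeta>: "\<zeta> \<in> M1" "ereal lam * rel_entropy \<nu> \<zeta> + I \<zeta> < ereal r"
    using r unfolding K_def INF_less_iff by blast
  have H0: "0 \<le> rel_entropy \<nu> \<zeta>" by (rule rel_entropy_nonneg[OF \<nu>M \<zeta>(1)])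
  have I0: "0 \<le> I \<zeta>" by (rule I_nonneg[OF \<zeta>(1)])
  obtain H where H: "rel_entropy \<nu> \<zeta> = ereal H" using \<zeta>(2) H0 I0 lam_pos by (cases "rel_entropy \<nu> \<zeta>"; cases "I \<zeta>") auto
  obtain i where i: "I \<zeta> = ereal i" using \<zeta>(2) H I0 by (cases "I \<zeta>") auto
  have gap: "lam * H + i < r" using \<zeta>(2) unfolding H i by simp
  \<comment> \<open>The losses add up to (3 lam + 1) \<delta>: one \<delta> in the LDP for V, and
    per draw one each for the entropy approximation, for the deviation \<epsilon> and for ln
    \<gamma>. They use half of the gap.\<close>
  define \<delta> where "\<delta> = (r - (lam * H + i)) / (2 * (3 * lam + 1))"
  have \<delta>: "\<delta> > 0" unfolding \<delta>_def using gap lam_pos by (intro divide_pos_pos) auto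
  have \<delta>': "(i + \<delta>) + lam * (H + \<delta> + \<delta> + \<delta>) < r"
  proof -
    have "(3 * lam + 1) * \<delta> = (r - (lam * H + i)) / 2" unfolding \<delta>_def using lam_pos by (simp add: field_simps)
    moreover have "(i + \<delta>) + lam * (H + \<delta> + \<delta> + \<delta>) = lam * H + i + (3 * lam + 1) * \<delta>" by (simp add: algebra_simps)
    ultimately show ?thesis using gap by simp
  qed
  obtain S0 \<epsilon>0 where S0: "finite S0" "S0 \<subseteq> Cb" "\<epsilon>0 > 0"
    and S0G: "\<And>\<mu>. \<mu> \<in> M1 \<Longrightarrow> (\<And>g. g \<in> S0 \<Longrightarrow> \<bar>(\<integral>x. g x \<partial>\<mu>) - (\<integral>x. g x \<partial>\<nu>)\<bar> < \<epsilon>0) \<Longrightarrow> \<mu> \<in> G"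
    using weak_topology_neighbourhood[OF G \<nu>] by blast
  \<comment> \<open>Half of \<epsilon>0, because the draws are compared with \<nu> through the
    tilted means c g, with an error \<epsilon> on either side.\<close>
  define \<epsilon> where "\<epsilon> = min (\<epsilon>0 / 2) \<delta>"
  have \<epsilon>: "\<epsilon> > 0" "\<epsilon> \<le> \<epsilon>0 / 2" "\<epsilon> \<le> \<delta>" using S0(3) \<delta> by (auto simp: \<epsilon>_def)
  obtain f where f: "f \<in> Cb" "(\<integral>x. exp (f x) \<partial>\<zeta>) = 1"
    "\<And>g. g \<in> S0 \<Longrightarrow> \<bar>(\<integral>x. exp (f x) * g x \<partial>\<zeta>) - (\<integral>x. g x \<partial>\<nu>)\<bar> < \<epsilon>"
    "(\<integral>x. exp (f x) * f x \<partial>\<zeta>) < H + \<epsilon>"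
    using tilted_approximation[OF \<nu>M \<zeta>(1) H S0(1,2) \<epsilon>(1)] by blast
  \<comment> \<open>f joins the test functions: the size of the tilt is known only if the mean of f
    over the draws is close to its target c f.\<close>
  define S where "S = insert f S0"
  have S: "finite S" "S \<subseteq> Cb" "f \<in> S" using S0 f by (auto simp: S_def)
  define c where "c g = (\<integral>x. exp (f x) * g x \<partial>\<zeta>)" for g
  have "\<forall>g\<in>S. \<exists>B. \<forall>x. \<bar>g x - c g\<bar> + \<epsilon> \<le> B"
  proof
    fix g assume "g \<in> S"
    then have "g \<in> Cb" using S by blast
    from CbE[OF this] obtain B where B: "\<And>x. \<bar>g x\<bar> \<le> B" by blast
    have "\<bar>g x - c g\<bar> + \<epsilon> \<le> B + \<bar>c g\<bar> + \<epsilon>" for x using B[of x] by linarith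
    then show "\<exists>B. \<forall>x. \<bar>g x - c g\<bar> + \<epsilon> \<le> B" by blast
  qed
  then obtain B' where B': "\<And>g x. g \<in> S \<Longrightarrow> \<bar>g x - c g\<bar> + \<epsilon> \<le> B' g" by metis
  define B where "B = Max (insert 1 (B' ` S))"
  have B1: "B \<ge> 1" unfolding B_def using S(1) by (intro Max_ge) auto
  have B: "\<bar>g x - c g\<bar> + \<epsilon> \<le> B" if "g \<in> S" for g x
  proof -
    have "B' g \<le> B" unfolding B_def using S(1) that by (intro Max_ge) auto
    then show ?thesis using B'[OF that, of x] by linarith
  qed
  \<comment> \<open>\<theta> B \<le> 1 puts the exponent in the range of
    \<open>exp_le_quadratic\<close>, and \<theta> B^2 \<le> \<epsilon>/2 keeps the second-order term
    below half of the gain \<theta> \<epsilon>.\<close>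
  define \<theta> where "\<theta> = min (1 / B) (\<epsilon> / (2 * B\<^sup>2))"
  have \<theta>: "\<theta> > 0" "\<theta> * B \<le> 1" "\<theta> * B\<^sup>2 \<le> \<epsilon> / 2"
  proof -
    show "\<theta> > 0" unfolding \<theta>_def using B1 \<epsilon>(1) by simp
    have "\<theta> \<le> 1 / B" by (simp add: \<theta>_def)
    then show "\<theta> * B \<le> 1" using B1 by (simp add: pos_le_divide_eq)
    have "\<theta> \<le> \<epsilon> / 2 / B\<^sup>2" by (simp add: \<theta>_def)
    moreover have "B\<^sup>2 > 0" using B1 by simp
    ultimately show "\<theta> * B\<^sup>2 \<le> \<epsilon> / 2" by (simp only: pos_le_divide_eq)
  qed
  define h where "h g s y = f y + (s * \<theta> * (g y - c g) - \<theta> * \<epsilon>)" for g s y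
  have hC: "h g s \<in> Cb" if "g \<in> S" for g s
  proof -
    have "g \<in> Cb" using that S by blast
    then show ?thesis unfolding h_def by (intro Cb_add Cb_diff Cb_scale Cb_const f)
  qed
  define \<beta>0 where "\<beta>0 = 1 - \<theta> * \<epsilon> / 2"
  have \<beta>0: "\<beta>0 < 1" using \<theta>(1) \<epsilon>(1) by (simp add: \<beta>0_def)
  \<comment> \<open>Under the tilted measure g - c g has mean 0, so only the loss \<theta>
    \<epsilon> and the second-order term remain. The moment is strictly below that of f, which is 1,
    and strictness is what persists near \<zeta>.\<close>
  have hle: "(\<integral>y. exp (h g s y) \<partial>\<zeta>) \<le> \<beta>0" if g: "g \<in> S" and s: "s \<in> {1,-1}" for g s
  proof -
    interpret \<zeta>: prob_space \<zeta> by (rule M1_prob[OF \<zeta>(1)])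
    have gC: "g \<in> Cb" using g S by blast
    define u where "u y = s * (g y - c g) - \<epsilon>" for y
    have ub: "\<bar>u y\<bar> \<le> B" for y
    proof -
      have "\<bar>u y\<bar> \<le> \<bar>s * (g y - c g)\<bar> + \<epsilon>" unfolding u_def using \<epsilon>(1) by linarith
      also have "\<bar>s * (g y - c g)\<bar> = \<bar>g y - c g\<bar>" using s by (auto simp: abs_mult)
      finally show ?thesis using B[OF g, of y] by linarith
    qed
    have ei: "integrable \<zeta> (\<lambda>y. exp (f y))" by (intro Cb_integrable_M1 Cb_exp f \<zeta>)
    have egi: "integrable \<zeta> (\<lambda>y. exp (f y) * g y)"
    proof -
      from CbE[OF gC] obtain D where D: "D > 0" "\<And>x. \<bar>g x\<bar> \<le> D" by blast
      have "continuous_on UNIV (\<lambda>y. exp (f y) * g y)"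
        using Cb_cont[OF f(1)] Cb_cont[OF gC] by (intro continuous_intros)
      moreover obtain D' where D': "D' > 0" "\<And>x. \<bar>exp (f x)\<bar> \<le> D'" using CbE[OF Cb_exp[OF f(1)]] by blast
      have "\<bar>exp (f y) * g y\<bar> \<le> D' * D" for y unfolding abs_mult using D D' by (intro mult_mono) auto
      ultimately show ?thesis by (intro Cb_integrable_M1[OF CbI \<zeta>(1)])
    qed
    have "(\<integral>y. exp (h g s y) \<partial>\<zeta>) \<le> (\<integral>y. (1 + \<theta>\<^sup>2 * B\<^sup>2 - \<theta> * s * c g - \<theta> * \<epsilon>) * exp (f y) + \<theta> * s * (exp (f y) * g y) \<partial>\<zeta>)"
    proof (rule integral_mono)
      show "integrable \<zeta> (\<lambda>y. exp (h g s y))" by (intro Cb_integrable_M1 Cb_exp hC g \<zeta>)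
      show "integrable \<zeta> (\<lambda>y. (1 + \<theta>\<^sup>2 * B\<^sup>2 - \<theta> * s * c g - \<theta> * \<epsilon>) * exp (f y) + \<theta> * s * (exp (f y) * g y))"
        by (intro Bochner_Integration.integrable_add integrable_mult_right ei egi)
      fix y
      have "\<bar>\<theta> * u y\<bar> \<le> \<theta> * B" unfolding abs_mult using ub[of y] \<theta>(1) by (simp add: mult_left_mono)
      then have a: "\<bar>\<theta> * u y\<bar> \<le> 1" using \<theta>(2) by linarith
      have "(u y)\<^sup>2 \<le> B\<^sup>2" using ub[of y] B1 by (intro power2_le_iff_abs_le[THEN iffD2]) auto
      then have "\<theta>\<^sup>2 * (u y)\<^sup>2 \<le> \<theta>\<^sup>2 * B\<^sup>2" by (intro mult_left_mono) auto
      then have "exp (\<theta> * u y) \<le> 1 + \<theta> * u y + \<theta>\<^sup>2 * B\<^sup>2"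
        using exp_le_quadratic[OF a] by (simp add: power_mult_distrib)
      then have "exp (f y) * exp (\<theta> * u y) \<le> exp (f y) * (1 + \<theta> * u y + \<theta>\<^sup>2 * B\<^sup>2)" by (intro mult_left_mono) auto
      also have "\<dots> = (1 + \<theta>\<^sup>2 * B\<^sup>2 - \<theta> * s * c g - \<theta> * \<epsilon>) * exp (f y) + \<theta> * s * (exp (f y) * g y)"
        by (simp add: u_def algebra_simps)
      also have "exp (f y) * exp (\<theta> * u y) = exp (h g s y)"
        unfolding exp_add[symmetric] by (simp add: h_def u_def algebra_simps)
      finally show "exp (h g s y) \<le> (1 + \<theta>\<^sup>2 * B\<^sup>2 - \<theta> * s * c g - \<theta> * \<epsilon>) * exp (f y) + \<theta> * s * (exp (f y) * g y)" .
    qed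
    also have "\<dots> = (1 + \<theta>\<^sup>2 * B\<^sup>2 - \<theta> * s * c g - \<theta> * \<epsilon>) * 1 + \<theta> * s * c g"
      using ei egi by (simp add: f(2) c_def)
    also have "\<dots> = 1 + \<theta> * (\<theta> * B\<^sup>2) - \<theta> * \<epsilon>" by (simp add: power2_eq_square algebra_simps)
    also have "\<dots> \<le> 1 + \<theta> * (\<epsilon> / 2) - \<theta> * \<epsilon>"
      using mult_left_mono[OF \<theta>(3) less_imp_le[OF \<theta>(1)]] by linarith
    also have "\<dots> = \<beta>0" by (simp add: \<beta>0_def)
    finally show ?thesis .
  qed
  have \<beta>00: "0 < \<beta>0"
  proof -
    have "0 < (\<integral>y. exp (h f 1 y) \<partial>\<zeta>)" by (rule integral_exp_pos[OF hC[OF S(3)] \<zeta>(1)])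
    also have "\<dots> \<le> \<beta>0" by (rule hle[OF S(3)]) simp
    finally show ?thesis .
  qed
  \<comment> \<open>The order is \<beta>0 < \<beta> < \<gamma> < 1, where \<beta>0 bounds the
    moments of the h and 1 is the moment of f, both at \<zeta>. Strictness makes room for a
    neighbourhood, \<beta> < \<gamma> makes the correction terms negligible, and \<gamma> \<ge>
    e^(-\<delta>) limits the loss per draw.\<close>
  define \<beta> where "\<beta> = (1 + \<beta>0) / 2"
  have \<beta>: "\<beta>0 < \<beta>" "\<beta> < 1" "0 < \<beta>" using \<beta>0 \<beta>00 by (auto simp: \<beta>_def)
  define \<gamma> where "\<gamma> = max (exp (- \<delta>)) ((1 + \<beta>) / 2)"
  have \<gamma>: "\<beta> < \<gamma>" "\<gamma> < 1" "exp (- \<delta>) \<le> \<gamma>" "0 < \<gamma>" using \<beta> \<delta> by (auto simp: \<gamma>_def less_max_iff_disj)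
  define V where "V = {\<mu>\<in>M1. \<gamma> < (\<integral>y. exp (f y) \<partial>\<mu>)} \<inter> (\<Inter>gs\<in>S\<times>{1,-1}. {\<mu>\<in>M1. (\<integral>y. exp (h (fst gs) (snd gs) y) \<partial>\<mu>) < \<beta>})"
  have oV: "openin weak_topology V" unfolding V_def
  proof (intro openin_Int openin_INT2)
    show "openin weak_topology {\<mu>\<in>M1. \<gamma> < (\<integral>y. exp (f y) \<partial>\<mu>)}" by (intro openin_integral_less Cb_exp f)
    show "openin weak_topology {\<mu>\<in>M1. (\<integral>y. exp (h (fst gs) (snd gs) y) \<partial>\<mu>) < \<beta>}" if "gs \<in> S \<times> {1,-1}" for gs
      using that by (intro openin_integral_less Cb_exp hC) auto
  qed (use S in auto)
  have \<zeta>V: "\<zeta> \<in> V" unfolding V_def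
  proof (intro IntI INT_I CollectI conjI \<zeta>(1))
    show "\<gamma> < (\<integral>y. exp (f y) \<partial>\<zeta>)" unfolding f(2) by (rule \<gamma>(2))
    fix gs :: "('a \<Rightarrow> real) \<times> real" assume "gs \<in> S \<times> {1,-1}"
    then have "fst gs \<in> S" "snd gs \<in> {1,-1}" by auto
    from hle[OF this] show "(\<integral>y. exp (h (fst gs) (snd gs) y) \<partial>\<zeta>) < \<beta>" using \<beta>(1) by linarith
  qed
  have ev1: "\<forall>\<^sub>F n in sequentially. exp (- real n * (i + \<delta>)) \<le> measure (law_M1 M (emp n)) V"
    by (rule LDP_lower_exp[OF X_LDP oV \<zeta>V]) (use \<delta> i in simp)
  \<comment> \<open>\<open>m n\<close> tends to infinity since its ratio to n has a positive limit,
    so the powers of \<beta>/\<gamma> vanish and half of \<gamma>^m survives.\<close>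
  have ev2: "\<forall>\<^sub>F n in sequentially. \<gamma> ^ m n / 2 \<le> \<gamma> ^ m n - 2 * real (card S) * \<beta> ^ m n"
  proof -
    have "(\<lambda>n. 2 * real (card S) * (\<beta> / \<gamma>) ^ m n) \<longlonglongrightarrow> 2 * real (card S) * 0"
      using \<beta> \<gamma> by (intro tendsto_intros filterlim_compose[OF LIMSEQ_realpow_zero m_at_top]) auto
    then have "\<forall>\<^sub>F n in sequentially. 2 * real (card S) * (\<beta> / \<gamma>) ^ m n < 1 / 2" by (intro order_tendstoD(2)) auto
    then show ?thesis
    proof eventually_elim
      case (elim n)
      have gp: "0 < \<gamma> ^ m n" using \<gamma> by simp
      have "2 * real (card S) * \<beta> ^ m n = (2 * real (card S) * (\<beta> / \<gamma>) ^ m n) * \<gamma> ^ m n"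
        using \<gamma> by (simp add: power_divide)
      also have "\<dots> \<le> 1 / 2 * \<gamma> ^ m n" using elim gp by (intro mult_right_mono) auto
      finally show ?case by simp
    qed
  qed
  \<comment> \<open>The factor 1/2 from the previous estimate enters the exponent as ln 2 / n and
    disappears in the limit.\<close>
  have ev3: "\<forall>\<^sub>F n in sequentially. (i + \<delta>) + real (m n) / real n * (c f + \<epsilon> - ln \<gamma>) + ln 2 / real n < r"
  proof -
    have "- \<delta> \<le> ln \<gamma>" using \<gamma>(3,4) by (simp add: ln_ge_iff)
    then have "c f + \<epsilon> - ln \<gamma> \<le> H + \<delta> + \<delta> + \<delta>" using f(4) \<epsilon>(3) unfolding c_def by linarith
    then have "lam * (c f + \<epsilon> - ln \<gamma>) \<le> lam * (H + \<delta> + \<delta> + \<delta>)" using lam_pos by (intro mult_left_mono) auto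
    then have "(i + \<delta>) + lam * (c f + \<epsilon> - ln \<gamma>) + 0 < r" using \<delta>' by linarith
    moreover have "(\<lambda>n. (i + \<delta>) + real (m n) / real n * (c f + \<epsilon> - ln \<gamma>) + ln 2 / real n) \<longlonglongrightarrow> (i + \<delta>) + lam * (c f + \<epsilon> - ln \<gamma>) + 0"
      by (intro tendsto_intros m_lim tendsto_divide_0[OF tendsto_const] filterlim_at_top_imp_at_infinity filterlim_real_sequentially)
    ultimately show ?thesis by (rule order_tendstoD(2)[rotated])
  qed
  have GA: "G \<in> sets (borel_of weak_topology)" by (rule openin_borel_of[OF G])
  show ?thesis using ev1 ev2 ev3 eventually_ge_at_top[of 1]
  proof eventually_elim
    case (elim n)
    have n: "n \<ge> 1" "real n > 0" using elim(4) by auto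
    have mn: "m n \<ge> 1" using m_pos[OF n(1)] by simp
    define d where "d = exp (- real (m n) * (c f + \<epsilon>)) * (\<gamma> ^ m n / 2)"
    have "d * PX n V \<le> P n G"
    proof (rule P_lower[OF n(1) GA openin_borel_of[OF oV]])
      fix \<omega> assume \<omega>: "emp n \<omega> \<in> V"
      define x where "x = (\<lambda>i. X n i \<omega>)"
      have "d \<le> exp (- real (m n) * (c f + \<epsilon>)) * (\<gamma> ^ m n - 2 * real (card S) * \<beta> ^ m n)"
        unfolding d_def using elim(2) by (intro mult_left_mono) auto
      also have "\<dots> \<le> measure_pmf.prob (urns n (m n)) {u. \<forall>g\<in>S. \<bar>(\<integral>y. g y \<partial>(resample n (m n) u x)) - c g\<bar> < \<epsilon>}"
      proof (rule resample_lower[OF n(1) mn S \<theta>(1)])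
        show "0 \<le> \<beta>" "0 \<le> \<gamma>" using \<beta> \<gamma> by auto
        show "\<gamma> \<le> (\<integral>y. exp (f y) \<partial>(empirical n x))" using \<omega> by (simp add: V_def emp_eq x_def)
        fix g and s :: real assume gs: "g \<in> S" "s \<in> {1,-1}"
        then have "(g, s) \<in> S \<times> {1,-1}" by simp
        then have "emp n \<omega> \<in> {\<mu>\<in>M1. (\<integral>y. exp (h (fst (g, s)) (snd (g, s)) y) \<partial>\<mu>) < \<beta>}"
          using \<omega> unfolding V_def by blast
        then show "(\<integral>y. exp (f y + (s * \<theta> * (g y - c g) - \<theta> * \<epsilon>)) \<partial>(empirical n x)) \<le> \<beta>"
          by (simp add: emp_eq x_def h_def)
      qed
      also have "\<dots> \<le> Q n G \<omega>" unfolding Q_def x_def[symmetric]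
      proof (rule measure_pmf.finite_measure_mono_AE)
        show "AE u in measure_pmf (urns n (m n)). u \<in> {u. \<forall>g\<in>S. \<bar>(\<integral>y. g y \<partial>(resample n (m n) u x)) - c g\<bar> < \<epsilon>}
          \<longrightarrow> u \<in> {u. resample n (m n) u x \<in> G}"
        proof (rule AE_pmfI, rule impI)
          fix u assume u: "u \<in> set_pmf (urns n (m n))"
            and close: "u \<in> {u. \<forall>g\<in>S. \<bar>(\<integral>y. g y \<partial>(resample n (m n) u x)) - c g\<bar> < \<epsilon>}"
          have "resample n (m n) u x \<in> G"
          proof (rule S0G)
            show "resample n (m n) u x \<in> M1" by (rule resample_M1[OF n(1) mn set_urns[OF n(1) u]])
            fix g assume g: "g \<in> S0"
            then have "\<bar>(\<integral>y. g y \<partial>(resample n (m n) u x)) - c g\<bar> < \<epsilon>" using close by (simp add: S_def)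
            moreover have "\<bar>c g - (\<integral>x. g x \<partial>\<nu>)\<bar> < \<epsilon>" unfolding c_def by (rule f(3)[OF g])
            ultimately show "\<bar>(\<integral>y. g y \<partial>(resample n (m n) u x)) - (\<integral>x. g x \<partial>\<nu>)\<bar> < \<epsilon>0" using \<epsilon>(2) by linarith
          qed
          then show "u \<in> {u. resample n (m n) u x \<in> G}" by simp
        qed
      qed simp
      finally show "d \<le> Q n G \<omega>" .
    qed
    moreover have "d * exp (- real n * (i + \<delta>)) \<le> d * PX n V"
      unfolding PX_def using elim(1) \<gamma>(4) by (intro mult_left_mono) (auto simp: d_def)
    moreover have "exp (- real n * r) \<le> d * exp (- real n * (i + \<delta>))"
    proof -
      have "\<gamma> ^ m n / 2 = exp (real (m n) * ln \<gamma> - ln 2)"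
        using \<gamma>(4) by (simp add: exp_diff exp_of_nat_mult)
      then have "d * exp (- real n * (i + \<delta>)) = exp (- real (m n) * (c f + \<epsilon>) + (real (m n) * ln \<gamma> - ln 2) + - real n * (i + \<delta>))"
        unfolding d_def exp_add by simp
      also have "- real (m n) * (c f + \<epsilon>) + (real (m n) * ln \<gamma> - ln 2) + - real n * (i + \<delta>)
          = - real n * ((i + \<delta>) + real (m n) / real n * (c f + \<epsilon> - ln \<gamma>) + ln 2 / real n)"
        using n(2) by (simp add: field_simps)
      finally show ?thesis using elim(3) n(2) by (simp add: mult_left_mono)
    qed
    ultimately show ?case by linarith
  qed
qed

section \<open>Closed sets, and regularity of the rate function\<close>

lemma upper:
  assumes F: "closedin weak_topology F" and a: "\<And>\<nu>. \<nu> \<in> F \<Longrightarrow> ereal a < K \<nu>" and b: "b < a"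
  shows "\<forall>\<^sub>F n in sequentially. P n F \<le> exp (- real n * b)"
proof -
  obtain C where C: "closed C" "F = {\<mu>\<in>M1. emb \<mu> \<in> C}" using F closedin_weak_topology_iff by blast
  define D where "D = linear_functionals \<inter> C"
  have D: "compact D" unfolding D_def by (intro compact_Int_closed compact_linear_functionals C)
  define \<U> where "\<U> = {U. open U \<and> (\<forall>b<a. \<forall>\<^sub>F n in sequentially. P n {\<nu>\<in>M1. emb \<nu> \<in> U} \<le> exp (- real n * b))}"
  \<comment> \<open>D may contain functionals that are not measures; over them the hypothesis of
    \<open>local_upper\<close> holds vacuously.\<close>
  have "D \<subseteq> \<Union>\<U>"
  proof
    fix \<Lambda> assume \<Lambda>: "\<Lambda> \<in> D"
    then have lin: "\<Lambda> \<in> linear_functionals" by (simp add: D_def)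
    have "\<nu> \<in> F" if "\<nu> \<in> M1" "emb \<nu> = \<Lambda>" for \<nu>
      using that \<Lambda> by (simp add: D_def C(2))
    then have "\<forall>\<nu>\<in>M1. emb \<nu> = \<Lambda> \<longrightarrow> ereal a < K \<nu>" using a by blast
    from local_upper[OF lin this] obtain U where "U \<in> \<U>" "\<Lambda> \<in> U" unfolding \<U>_def by blast
    then show "\<Lambda> \<in> \<Union>\<U>" by blast
  qed
  moreover have "open U" if "U \<in> \<U>" for U using that by (simp add: \<U>_def)
  ultimately obtain J where J: "J \<subseteq> \<U>" "finite J" "D \<subseteq> \<Union>J"
    using compactE[OF D, of \<U>] by blast
  have "\<forall>\<^sub>F n in sequentially. (\<Sum>U\<in>J. P n {\<nu>\<in>M1. emb \<nu> \<in> U}) \<le> exp (- real n * b)"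
    by (rule expbound_sum[OF J(2) _ b]) (use J(1) in \<open>auto simp: \<U>_def\<close>)
  then show ?thesis using eventually_ge_at_top[of 1]
  proof eventually_elim
    case (elim n)
    interpret L: prob_space "law_M1 M (L n)" by (rule prob_space_law_L[OF elim(2)])
    have s: "{\<nu>\<in>M1. emb \<nu> \<in> U} \<in> sets (law_M1 M (L n))" if "U \<in> J" for U
      unfolding sets_law_M1 using that J(1)
      by (intro openin_borel_of openin_weak_topologyI) (auto simp: \<U>_def)
    have "P n F \<le> P n (\<Union>U\<in>J. {\<nu>\<in>M1. emb \<nu> \<in> U})"
      unfolding P_def
    proof (rule L.finite_measure_mono)
      show "F \<subseteq> (\<Union>U\<in>J. {\<nu>\<in>M1. emb \<nu> \<in> U})"
        using J(3) emb_linear_functionals unfolding C(2) D_def by blast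
      show "(\<Union>U\<in>J. {\<nu>\<in>M1. emb \<nu> \<in> U}) \<in> sets (law_M1 M (L n))" using J(2) s by (intro sets.finite_UN) auto
    qed
    also have "\<dots> \<le> (\<Sum>U\<in>J. P n {\<nu>\<in>M1. emb \<nu> \<in> U})"
      unfolding P_def using s by (intro L.finite_measure_subadditive_finite J(2)) auto
    finally show ?case using elim(1) by linarith
  qed
qed

text \<open>By injectivity of \<open>emb\<close>, the fibre over \<open>emb \<nu>\<close> is \<nu>
  alone, so \<open>local_upper\<close> applies at \<nu>. The intermediate a' turns its weak
  inequality into the strict one required.\<close>

lemma lsc_K: "lsc_on weak_topology K"
  unfolding lsc_on_def topspace_weak_topology
proof (rule allI, subst openin_subopen, rule ballI)
  fix a :: ereal and \<nu> assume "\<nu> \<in> {\<nu>\<in>M1. a < K \<nu>}"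
  then have \<nu>: "\<nu> \<in> M1" "a < K \<nu>" by auto
  obtain a' where a': "a < ereal a'" "ereal a' < K \<nu>" using ereal_dense2[OF \<nu>(2)] by blast
  have "\<nu>' = \<nu>" if "\<nu>' \<in> M1" "emb \<nu>' = emb \<nu>" for \<nu>'
    by (rule emb_inj[OF that(1) \<nu>(1) that(2)])
  then have "\<forall>\<nu>'\<in>M1. emb \<nu>' = emb \<nu> \<longrightarrow> ereal a' < K \<nu>'" using a'(2) by blast
  from local_upper[OF emb_linear_functionals[OF \<nu>(1)] this]
  obtain U where U: "open U" "emb \<nu> \<in> U" "\<forall>\<nu>\<in>M1. emb \<nu> \<in> U \<longrightarrow> ereal a' \<le> K \<nu>" by blast
  have "{\<mu>\<in>M1. emb \<mu> \<in> U} \<subseteq> {\<nu>\<in>M1. a < K \<nu>}" using U(3) a'(1) by (auto intro: less_le_trans)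
  then show "\<exists>T. openin weak_topology T \<and> \<nu> \<in> T \<and> T \<subseteq> {\<nu>\<in>M1. a < K \<nu>}"
    using openin_weak_topologyI[OF U(1)] U(2) \<nu>(1) by (intro exI[of _ "{\<mu>\<in>M1. emb \<mu> \<in> U}"]) auto
qed

text \<open>The image of a level set is the compact space of functionals minus an open set: every
  functional outside the image, measure or not, has a neighbourhood on which \<open>K\<close> is at
  least some a > \<alpha>.\<close>

lemma good_K: "good_rate weak_topology K"
  unfolding good_rate_def topspace_weak_topology
proof
  fix \<alpha> :: real
  define S where "S = {\<nu>\<in>M1. K \<nu> \<le> ereal \<alpha>}"
  define T where "T = \<Union>{U. open U \<and> U \<inter> emb ` S = {}}"
  have "emb ` S = linear_functionals - T"
  proof
    show "emb ` S \<subseteq> linear_functionals - T"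
      using emb_linear_functionals unfolding S_def T_def by blast
    show "linear_functionals - T \<subseteq> emb ` S"
    proof (rule subsetI, rule ccontr)
      fix \<Lambda> assume \<Lambda>: "\<Lambda> \<in> linear_functionals - T" "\<Lambda> \<notin> emb ` S"
      \<comment> \<open>The strict inequality matters, since \<open>local_upper\<close> yields only
        a \<le> K. Over a functional that is no measure any a above \<alpha> will do.\<close>
      have "\<exists>a>\<alpha>. \<forall>\<nu>\<in>M1. emb \<nu> = \<Lambda> \<longrightarrow> ereal a < K \<nu>"
      proof (cases "\<exists>\<nu>\<in>M1. emb \<nu> = \<Lambda>")
        case True
        then obtain \<nu> where \<nu>: "\<nu> \<in> M1" "emb \<nu> = \<Lambda>" by blast
        then have "\<nu> \<notin> S" using \<Lambda>(2) by blast
        then have "ereal \<alpha> < K \<nu>" using \<nu>(1) by (simp add: S_def not_le)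
        then obtain a where "ereal \<alpha> < ereal a" "ereal a < K \<nu>" using ereal_dense2 by blast
        moreover have "\<nu>' = \<nu>" if "\<nu>' \<in> M1" "emb \<nu>' = \<Lambda>" for \<nu>' using emb_inj[OF that(1) \<nu>(1)] that(2) \<nu>(2) by simp
        ultimately show ?thesis by (intro exI[of _ a]) auto
      next
        case False
        then show ?thesis by (intro exI[of _ "\<alpha> + 1"]) auto
      qed
      then obtain a where a: "a > \<alpha>" "\<forall>\<nu>\<in>M1. emb \<nu> = \<Lambda> \<longrightarrow> ereal a < K \<nu>" by blast
      from local_upper[OF DiffD1[OF \<Lambda>(1)] a(2)]
      obtain U where U: "open U" "\<Lambda> \<in> U" "\<forall>\<nu>\<in>M1. emb \<nu> \<in> U \<longrightarrow> ereal a \<le> K \<nu>" by blast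
      have "emb \<nu> \<notin> U" if "\<nu> \<in> S" for \<nu>
      proof
        assume "emb \<nu> \<in> U"
        then have "ereal a \<le> K \<nu>" "K \<nu> \<le> ereal \<alpha>" using U(3) that unfolding S_def by blast+
        then have "ereal a \<le> ereal \<alpha>" by (rule order_trans)
        then show False using a(1) by simp
      qed
      then have "U \<inter> emb ` S = {}" by blast
      then show False using U(1,2) \<Lambda>(1) unfolding T_def by blast
    qed
  qed
  moreover have "open T" unfolding T_def by auto
  ultimately have "compact (emb ` S)" using compact_diff[OF compact_linear_functionals] by simp
  then show "compactin weak_topology {\<nu>\<in>M1. K \<nu> \<le> ereal \<alpha>}"
    using compactin_weak_topologyI[of S] by (auto simp: S_def)
qed

theorem LDP_L: "LDP weak_topology (\<lambda>n. law_M1 M (L n)) K"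
proof (rule LDP_expI)
  show "0 \<le> K \<nu>" if "\<nu> \<in> topspace weak_topology" for \<nu>
    using that unfolding topspace_weak_topology by (rule K_nonneg)
  show "\<forall>\<^sub>F n in sequentially. exp (- real n * r) \<le> measure (law_M1 M (L n)) G"
    if "openin weak_topology G" "\<nu> \<in> G" "K \<nu> < ereal r" for G \<nu> r
    using lower[OF that] unfolding P_def .
  show "\<forall>\<^sub>F n in sequentially. measure (law_M1 M (L n)) F \<le> exp (- real n * b)"
    if "closedin weak_topology F" "\<And>\<nu>. \<nu> \<in> F \<Longrightarrow> ereal a < K \<nu>" "b < a" for F a b
    using upper[OF that] unfolding P_def .
qed (use prob_space_law_L lsc_K in \<open>simp_all add: sets_law_M1\<close>)

text \<open>At a zero of \<open>I\<close> only the entropy term remains. The factor lam is carried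
  past the infimum by multiplying with its inverse, which works in \<open>ereal\<close> because lam
  is positive and finite.\<close>

lemma K_le_zeros: "K \<nu> \<le> ereal lam * (INF \<eta>\<in>{\<eta>\<in>M1. I \<eta> = 0}. rel_entropy \<nu> \<eta>)"
proof -
  have "ereal (1 / lam) * K \<nu> \<le> (INF \<eta>\<in>{\<eta>\<in>M1. I \<eta> = 0}. rel_entropy \<nu> \<eta>)"
  proof (rule INF_greatest)
    fix \<eta> assume \<eta>: "\<eta> \<in> {\<eta>\<in>M1. I \<eta> = 0}"
    then have "\<eta> \<in> M1" "I \<eta> = 0" by blast+
    from K_le[OF this(1), of \<nu>] have "K \<nu> \<le> ereal lam * rel_entropy \<nu> \<eta>"
      unfolding \<open>I \<eta> = 0\<close> add_0_right .
    then have "ereal (1 / lam) * K \<nu> \<le> ereal (1 / lam) * (ereal lam * rel_entropy \<nu> \<eta>)"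
      using lam_pos by (intro ereal_mult_left_mono) auto
    also have "\<dots> = rel_entropy \<nu> \<eta>" using lam_pos by (simp add: mult.assoc[symmetric])
    finally show "ereal (1 / lam) * K \<nu> \<le> rel_entropy \<nu> \<eta>" .
  qed
  then have "ereal lam * (ereal (1 / lam) * K \<nu>) \<le> ereal lam * (INF \<eta>\<in>{\<eta>\<in>M1. I \<eta> = 0}. rel_entropy \<nu> \<eta>)"
    using lam_pos by (intro ereal_mult_left_mono) auto
  then show ?thesis using lam_pos by (simp add: mult.assoc[symmetric])
qed

end

theorem corollary2p2:
  fixes M :: "'w measure"
    and m :: "nat \<Rightarrow> nat" and lam :: real
    and W :: "nat \<Rightarrow> nat \<Rightarrow> 'w \<Rightarrow> real"
    and X :: "nat \<Rightarrow> nat \<Rightarrow> 'w \<Rightarrow> 'a::polish_space"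
    and I_X :: "'a measure \<Rightarrow> ereal"
  assumes prob: "prob_space M"
    and m_pos: "\<And>n. n \<ge> 1 \<Longrightarrow> m n > 0"
    and m_lim: "(\<lambda>n. real (m n) / real n) \<longlonglongrightarrow> lam"
    and lam_pos: "lam > 0"
    and W_rv: "\<And>n i. n \<ge> 1 \<Longrightarrow> i \<in> {1..n} \<Longrightarrow> W n i \<in> borel_measurable M"
    and W_law: "\<And>n. n \<ge> 1 \<Longrightarrow>
      distr M (\<Pi>\<^sub>M i\<in>{1..n}. borel) (\<lambda>\<omega>. \<lambda>i\<in>{1..n}. real (m n) / real n * W n i \<omega>) =
      distr (measure_pmf (mult_unif_pmf n (m n))) (\<Pi>\<^sub>M i\<in>{1..n}. borel)
        (\<lambda>N. \<lambda>i\<in>{1..n}. real (N i))"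
    and X_rv: "\<And>n i. n \<ge> 1 \<Longrightarrow> i \<in> {1..n} \<Longrightarrow> X n i \<in> borel_measurable M"
    and X_LDP: "LDP weak_topology
      (\<lambda>n. law_M1 M (\<lambda>\<omega>. weighted_empirical n (\<lambda>i. 1) (\<lambda>i. X n i \<omega>))) I_X"
    and X_good: "good_rate weak_topology I_X"
    and indep: "\<And>n. n \<ge> 1 \<Longrightarrow> indep_rv M
      (\<Pi>\<^sub>M i\<in>{1..n}. borel) (\<lambda>\<omega>. \<lambda>i\<in>{1..n}. X n i \<omega>)
      (\<Pi>\<^sub>M i\<in>{1..n}. borel) (\<lambda>\<omega>. \<lambda>i\<in>{1..n}. W n i \<omega>)"
  shows "\<exists>K.
    LDP weak_topology
      (\<lambda>n. law_M1 M (\<lambda>\<omega>. weighted_empirical n (\<lambda>i. W n i \<omega>) (\<lambda>i. X n i \<omega>))) K \<and>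
    good_rate weak_topology K \<and>
    (\<forall>\<nu>\<in>M1. K \<nu> = (INF \<zeta>\<in>M1. ereal lam * rel_entropy \<nu> \<zeta> + I_X \<zeta>) \<and>
      (INF \<zeta>\<in>M1. ereal lam * rel_entropy \<nu> \<zeta> + I_X \<zeta>)
        \<le> ereal lam * (INF \<eta>\<in>{\<eta>\<in>M1. I_X \<eta> = 0}. rel_entropy \<nu> \<eta>))"
proof -
  interpret multinomial_weights M m W X
    by (intro multinomial_weights.intro multinomial_weights_axioms.intro prob m_pos W_rv W_law X_rv indep)
  have emp: "emp n = (\<lambda>\<omega>. weighted_empirical n (\<lambda>i. 1) (\<lambda>i. X n i \<omega>))" for n
    by (rule ext) (rule emp_def)
  have L: "L n = (\<lambda>\<omega>. weighted_empirical n (\<lambda>i. W n i \<omega>) (\<lambda>i. X n i \<omega>))" for n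
    by (rule ext) (rule L_def)
  interpret resampled_LDP M m W X lam I_X
    by unfold_locales (use m_lim lam_pos X_LDP X_good in \<open>simp_all add: emp\<close>)
  show ?thesis
    by (intro exI[of _ K] conjI ballI)
      (use LDP_L good_K K_le_zeros in \<open>simp_all only: L K_def\<close>)
qed

end
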